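(* Let $A$ be a finite abelian group of rank 2. Every strongly regular Cayley graph over $A$ with Paley parameters $(\nu,(\nu-1)/2,(\nu-5)/4,(\nu-1)/4)$, where $\nu=|A|$, is defined by a $((p+1)/2,(p-1)/2,\dots,(p-1)/2)$-homogeneous set over $\mathbb Z_{p^n}\oplus\mathbb Z_{p^n}$, where $p$ is an odd prime; that is, $A\cong\mathbb Z_{p^n}\oplus\mathbb Z_{p^n}$ for some odd prime $p$ and some $n\ge1$, and, identifying $A$ with this group, the graph is defined by a $((p+1)/2,(p-1)/2,\dots,(p-1)/2)$-homogeneous subset of $\Delta$.
   Context: Rank 2 means that the minimal number of generators is 2. An undirected graph without loops and multiple edges on $\nu$ vertices is $(\nu,k,\lambda,\mu)$-strongly regular if each vertex has $k$ neighbours, each adjacent pair of vertices has exactly $\lambda$ common neighbours, and each non-adjacent pair of distinct vertices has exactly $\mu$ common neighbours. A strongly regular Cayley graph over $A$ is a strongly regular graph of the form $\Gamma_A(S)$, the Cayley graph with vertex set $A$ and connection set $S$, where $S\subseteq A$ is symmetric and does not contain the identity. For $G=\mathbb Z_{p^n}\oplus\mathbb Z_{p^n}$ with identity $e$, $\Delta$ is the set of all cyclic subgroups of $G$. For $H\in\Delta$: $O_H$ is the set of generators of $H$; $l(H)=i$ if $|H|=p^i$; $\mathrm{Sons}(H)=\{F\in\Delta: F\ne\{e\},\ pF=H\}$. A subset $S\subseteq\Delta$ with $\{e\}\notin S$ defines the Cayley graph $\Gamma_G(\bigcup_{H\in S}O_H)$. For an integer vector $(a_1,\dots,a_n)$ with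 $0\le a_1\le p+1$ and $0\le a_m\le p-1$ for $2\le m\le n$, a subset $S\subseteq\Delta$ is $(a_1,\dots,a_n)$-homogeneous if $\{e\}\notin S$ and for each $H\in\Delta$ with $0\le l(H)<n$ one has $|\mathrm{Sons}(H)\cap S|=a_{l(H)+1}+1$ if $H\in S$, and $|\mathrm{Sons}(H)\cap S|=a_{l(H)+1}$ if $H\notin S$. *)

theory Defs
  imports
    Complex_Main
    "HOL-Algebra.Elementary_Groups"
    "HOL-Computational_Algebra.Primes"
    "Graph_Theory.Pair_Digraph"
begin

definition group_rank :: "('a, 'b) monoid_scheme \<Rightarrow> nat" where
  "group_rank A =
    (LEAST r. \<exists>X. X \<subseteq> carrier A \<and> finite X \<and> card X = r \<and> generate A X = carrier A)"

text \<open>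
  An undirected simple graph is a \<open>pair_graph\<close>: a finite loopfree digraph with a symmetric
  arc relation, so that every edge is represented by two opposite arcs.
\<close>

definition neighbours :: "'a pair_pre_digraph \<Rightarrow> 'a \<Rightarrow> 'a set" where
  "neighbours \<Gamma> x = {y. (x, y) \<in> parcs \<Gamma>}"

definition strongly_regular :: "'a pair_pre_digraph \<Rightarrow> nat \<Rightarrow> nat \<Rightarrow> nat \<Rightarrow> nat \<Rightarrow> bool" where
  "strongly_regular \<Gamma> \<nu> k l m \<longleftrightarrow>
    pair_graph \<Gamma> \<and> card (pverts \<Gamma>) = \<nu> \<and>
    (\<forall>x\<in>pverts \<Gamma>. card (neighbours \<Gamma> x) = k) \<and>
    (\<forall>x\<in>pverts \<Gamma>. \<forall>y\<in>pverts \<Gamma>. (x, y) \<in> parcs \<Gamma> \<longrightarrow>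
       card (neighbours \<Gamma> x \<inter> neighbours \<Gamma> y) = l) \<and>
    (\<forall>x\<in>pverts \<Gamma>. \<forall>y\<in>pverts \<Gamma>. x \<noteq> y \<and> (x, y) \<notin> parcs \<Gamma> \<longrightarrow>
       card (neighbours \<Gamma> x \<inter> neighbours \<Gamma> y) = m)"

definition connection_set :: "('a, 'b) monoid_scheme \<Rightarrow> 'a set \<Rightarrow> bool" where
  "connection_set A T \<longleftrightarrow> T \<subseteq> carrier A \<and> \<one>\<^bsub>A\<^esub> \<notin> T \<and> (\<forall>x\<in>T. inv\<^bsub>A\<^esub> x \<in> T)"

definition cayley_graph :: "('a, 'b) monoid_scheme \<Rightarrow> 'a set \<Rightarrow> 'a pair_pre_digraph" where
  "cayley_graph A T =
    \<lparr>pverts = carrier A, parcs = {(x, t \<otimes>\<^bsub>A\<^esub> x) | x t. x \<in> carrier A \<and> t \<in> T}\<rparr>"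

definition graph_image :: "('a \<Rightarrow> 'b) \<Rightarrow> 'a pair_pre_digraph \<Rightarrow> 'b pair_pre_digraph" where
  "graph_image f \<Gamma> = \<lparr>pverts = f ` pverts \<Gamma>, parcs = map_prod f f ` parcs \<Gamma>\<rparr>"

definition Zpn2 :: "nat \<Rightarrow> nat \<Rightarrow> (int \<times> int) monoid" where
  "Zpn2 p n = integer_mod_group (p ^ n) \<times>\<times> integer_mod_group (p ^ n)"

definition cyclic_subgroups :: "('a, 'b) monoid_scheme \<Rightarrow> 'a set set" where
  "cyclic_subgroups G = {generate G {x} | x. x \<in> carrier G}"

definition generators :: "('a, 'b) monoid_scheme \<Rightarrow> 'a set \<Rightarrow> 'a set" where
  "generators G H = {x \<in> H. generate G {x} = H}"

text \<open>Only meaningful for a prime \<open>p\<close> and a subgroup \<open>H\<close> of \<open>p\<close>-power order.\<close>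

definition level :: "nat \<Rightarrow> 'a set \<Rightarrow> nat" where
  "level p H = (THE i. card H = p ^ i)"

text \<open>
  The groups of the library are written multiplicatively, so \<open>pF\<close> is the set of \<open>p\<close>-th powers.
\<close>

definition sons :: "('a, 'b) monoid_scheme \<Rightarrow> nat \<Rightarrow> 'a set \<Rightarrow> 'a set set" where
  "sons G p H =
    {F \<in> cyclic_subgroups G. F \<noteq> {\<one>\<^bsub>G\<^esub>} \<and> (\<lambda>x. x [^]\<^bsub>G\<^esub> p) ` F = H}"

text \<open>
  The vector \<open>(a\<^sub>1, \<dots>, a\<^sub>n)\<close> is a list, and list indices start at 0: \<open>a ! i\<close> is \<open>a\<^sub>i\<^sub>+\<^sub>1\<close>.
\<close>

definition homogeneous :: "nat \<Rightarrow> nat \<Rightarrow> nat list \<Rightarrow> (int \<times> int) set set \<Rightarrow> bool" where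
  "homogeneous p n a S \<longleftrightarrow>
    length a = n \<and>
    (0 < n \<longrightarrow> a ! 0 \<le> p + 1) \<and>
    (\<forall>i. 1 \<le> i \<and> i < n \<longrightarrow> a ! i \<le> p - 1) \<and>
    S \<subseteq> cyclic_subgroups (Zpn2 p n) \<and>
    {\<one>\<^bsub>Zpn2 p n\<^esub>} \<notin> S \<and>
    (\<forall>H\<in>cyclic_subgroups (Zpn2 p n). level p H < n \<longrightarrow>
       card (sons (Zpn2 p n) p H \<inter> S) =
         (if H \<in> S then a ! level p H + 1 else a ! level p H))"

definition subgroup_family_graph ::
    "('a, 'b) monoid_scheme \<Rightarrow> 'a set set \<Rightarrow> 'a pair_pre_digraph" where
  "subgroup_family_graph G S = cayley_graph G (\<Union>H\<in>S. generators G H)"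

end

theory Submission
  imports Defs "HOL-Number_Theory.Residues" "HOL-Algebra.Sylow"
begin

text \<open>
  Let \<open>A\<close> have order \<open>\<nu>\<close>, and put \<open>d = 0\<close> at the identity, \<open>d = 1\<close> on the connection set and \<open>d = -1\<close>
  elsewhere. The graph is strongly regular with Paley parameters exactly if, in the integral group
  ring, \<open>d * d = \<nu> e - \<Sigma>\<close>, where \<open>\<Sigma>\<close> is the sum of all elements of \<open>A\<close>. All that follows is a
  computation with this identity in the integral group ring; characters are replaced by sums over
  the fibres of a power map and over the cosets of a subgroup.

  Multipliers. For an odd prime \<open>q\<close>, the \<open>q\<close>-th convolution power of \<open>d\<close> is
  \<open>\<nu> ^ ((q - 1) / 2) d\<close>, and modulo \<open>q\<close> it is the push-forward of \<open>d\<close> under \<open>x \<mapsto> x ^ q\<close>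
  (\<open>frobenius\<close>). If \<open>q\<close> does not divide \<open>\<nu>\<close>, comparison of small integers gives
  \<open>d (x ^ q) = \<plusminus> d x\<close> with one sign for all \<open>x\<close>; hence every \<open>t\<close> coprime to \<open>\<nu>\<close> acts on \<open>d\<close> by a sign
  (\<open>multiplier_exists\<close>). The function \<open>d\<close> is called rational if all these signs are \<open>1\<close>.

  Fibre sums. If \<open>q\<close> divides \<open>\<nu>\<close>, the sum of \<open>d\<close> over each fibre of \<open>x \<mapsto> x ^ q\<close> is divisible by \<open>q\<close>.
  The squares of these sums add up to \<open>\<nu> - \<bar>\<Omega>\<bar>\<close>, where \<open>\<Omega>\<close> is the kernel. Over a \<open>q\<close>-th power other
  than the identity the sum is odd, so at least \<open>q\<close> in absolute value. As \<open>\<bar>\<Omega>\<bar> \<le> q ^ 2\<close> in a group with two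
  generators, there is no slack: the sums are \<open>\<plusminus> q\<close> away from the identity and \<open>0\<close> at the identity
  (\<open>fibre_sum_rigidity\<close>). If \<open>\<nu>\<close> had two prime divisors, then \<open>d\<close> would be rational and the value \<open>\<plusminus> q\<close>
  would be impossible for a divisor \<open>q \<ge> 5\<close> (\<open>no_second_prime\<close>). So \<open>A\<close> is a \<open>p\<close>-group with \<open>p\<close> odd.

  Shape of the group. Write \<open>A = \<langle>x\<rangle> \<times> \<langle>y\<rangle>\<close> with orders \<open>p ^ a\<close>, \<open>p ^ b\<close> and \<open>a \<ge> b \<ge> 1\<close>, let \<open>v\<close> be an
  element of order \<open>p\<close> in \<open>\<langle>x\<rangle>\<close>, and let \<open>c\<close> be the sum of \<open>d\<close> over a coset of \<open>L = \<langle>y\<rangle>\<close>. Then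
  \<open>p \<Sum> c(v ^ k)^2 - (\<Sum> c(v ^ k))^2 = (p - 1) \<nu>\<close>, both sums over \<open>k < p\<close> (\<open>socle_energy\<close>); this is
  Parseval for the \<open>p - 1\<close> nontrivial characters of \<open>\<langle>v\<rangle>\<close>, which extend to characters of \<open>A / L\<close>, where the
  transform of \<open>d\<close> has absolute value \<open>sqrt \<nu>\<close>. In the rational case the identity
  becomes \<open>(c(1) - c(v))^2 = \<nu>\<close>, and since \<open>\<bar>c\<bar> \<le> p ^ b\<close>, it follows that \<open>a = b\<close>. Otherwise it becomes
  \<open>p c(v)^2 = \<nu>\<close>; then \<open>\<bar>c(v)\<bar> = p ^ b\<close> is as large as it can be, so \<open>d\<close> is constant on the coset \<open>v L\<close>,
  and the same with \<open>y v\<close> in place of \<open>y\<close> gives a contradiction (\<open>twisted_impossible\<close>).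

  Homogeneity. Now \<open>a = b = n\<close> and \<open>d\<close> is rational, so the connection set is a union of sets \<open>O_H\<close>.
  Counting sons amounts to computing fibre sums: homogeneity says that the sum of \<open>d\<close> over the fibre
  of \<open>z\<close> under \<open>x \<mapsto> x ^ p\<close> is \<open>p d(z)\<close> for every \<open>p\<close>-th power \<open>z\<close>. Only the sign is still in question.
  For a cyclic subgroup \<open>\<langle>l\<rangle>\<close> of order \<open>p ^ n\<close>, the equation \<open>c(1) - c(v) = \<plusminus> p ^ n\<close> bounds the sum of
  the defects \<open>p d(z) - fibre_sum z\<close> over the \<open>p\<close>-th powers of \<open>\<langle>l\<rangle>\<close> so well that this sum vanishes;
  as the defects are constant on generators, and the generators of each nontrivial subgroup outnumber its
  other elements, every defect vanishes (\<open>zero_if_sum_zero\<close>, \<open>fibre_sum_eq_d\<close>).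
\<close>

section \<open>Finite sums of integers\<close>

text \<open>
  The orbits of a permutation of prime order \<open>q\<close> are fixed points or have \<open>q\<close> elements, and an
  orbit of the second kind contributes a multiple of \<open>q\<close> to the sum of an invariant weight.
\<close>

lemma prime_dvd_sum_minus_fixpoints:
  fixes w :: "'b \<Rightarrow> int" and r :: "'b \<Rightarrow> 'b"
  assumes q: "prime (q::nat)" and "finite X"
    and "\<And>x. x \<in> X \<Longrightarrow> r x \<in> X" "\<And>x. x \<in> X \<Longrightarrow> (r ^^ q) x = x" "\<And>x. x \<in> X \<Longrightarrow> w (r x) = w x"
  shows "int q dvd (\<Sum>x\<in>X. w x) - (\<Sum>x | x \<in> X \<and> r x = x. w x)"
  using assms(2-)
proof (induction X rule: finite_psubset_induct)
  case (psubset X)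
  show ?case
  proof (cases "\<forall>x\<in>X. r x = x")
    case True
    then have "{x. x \<in> X \<and> r x = x} = X" by auto
    then show ?thesis by simp
  next
    case False
    then obtain x where x: "x \<in> X" "r x \<noteq> x" by auto
    have iter: "(r ^^ i) x \<in> X \<and> w ((r ^^ i) x) = w x" for i
      by (induction i) (auto simp: x psubset.prems)
    define C where "C = (\<lambda>i. (r ^^ i) x) ` {..<q}"
    \<comment> \<open>As \<open>k\<close> is invertible modulo \<open>q\<close>, the map \<open>r\<close> is itself an iterate of \<open>r ^^ k\<close> on \<open>X\<close>.\<close>
    have nofix: "(r ^^ k) x \<noteq> x" if "0 < k" "k < q" for k
    proof
      assume k: "(r ^^ k) x = x"
      have "coprime k q" using that q
        by (metis coprime_commute nat_dvd_not_less prime_imp_coprime)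
      then obtain a where a: "[k * a = 1] (mod q)" using cong_solve_coprime_nat by fastforce
      have "(r ^^ (k * a)) x = x"
        using funpow_mod_eq[of k r x "k * a"] k by simp
      moreover have "(r ^^ (k * a)) x = (r ^^ ((k * a) mod q)) x"
        using funpow_mod_eq[of q r x "k * a"] psubset.prems(2)[OF x(1)] by simp
      moreover have "(k * a) mod q = 1"
        using a prime_gt_1_nat[OF q] by (simp add: cong_def)
      ultimately show False using x(2) by simp
    qed
    have inj: "inj_on (\<lambda>i. (r ^^ i) x) {..<q}"
    proof (rule linorder_inj_onI)
      fix i j assume ij: "i < j" "i \<in> {..<q}" "j \<in> {..<q}"
      show "(r ^^ i) x \<noteq> (r ^^ j) x"
      proof
        assume "(r ^^ i) x = (r ^^ j) x"
        then have "(r ^^ (q - j)) ((r ^^ i) x) = (r ^^ (q - j)) ((r ^^ j) x)" by simp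
        then have "(r ^^ (q - j + i)) x = (r ^^ q) x"
          using ij funpow_add[of "q - j" i r] funpow_add[of "q - j" j r] by (simp add: comp_def fun_eq_iff)
        moreover have "0 < q - j + i" "q - j + i < q" using ij by auto
        ultimately show False using nofix[of "q - j + i"] psubset.prems(2)[OF x(1)] by simp
      qed
    qed auto
    have CX: "C \<subseteq> X" using iter by (auto simp: C_def)
    have Cr: "r y \<in> C" if "y \<in> C" for y
    proof -
      from that obtain i where i: "i < q" "y = (r ^^ i) x" by (auto simp: C_def)
      show ?thesis
      proof (cases "Suc i < q")
        case True
        then show ?thesis unfolding C_def i by (intro image_eqI[of _ _ "Suc i"]) auto
      next
        case False
        then have "Suc i = q" using i by simp
        then have "r y = x" using psubset.prems(2)[OF x(1)] i by auto
        then show ?thesis unfolding C_def using prime_gt_0_nat[OF q]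
          by (intro image_eqI[of _ _ 0]) auto
      qed
    qed
    have Ciff: "y \<in> C" if "r y \<in> C" "y \<in> X" for y
    proof -
      have "(r ^^ i) (r y) \<in> C" for i by (induction i) (auto simp: that Cr)
      then have "(r ^^ (q - 1)) (r y) \<in> C" .
      moreover have "(r ^^ (q - 1)) (r y) = (r ^^ q) y"
        using prime_gt_0_nat[OF q] by (cases q) (simp_all add: funpow_swap1)
      ultimately show ?thesis using psubset.prems(2) that by simp
    qed
    have noC: "r y \<noteq> y" if "y \<in> C" for y
    proof
      assume ry: "r y = y"
      from that obtain i where i: "i < q" "y = (r ^^ i) x" by (auto simp: C_def)
      have fx: "(r ^^ j) y = y" for j by (induction j) (auto simp: ry)
      have "(r ^^ (q - i)) y = x"
        using i psubset.prems(2)[OF x(1)] funpow_add[of "q - i" i r] by (simp add: comp_def fun_eq_iff)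
      then show False using fx[of "q - i"] ry x(2) by simp
    qed
    have "x \<in> C" unfolding C_def using prime_gt_0_nat[OF q] by (intro image_eqI[of _ _ 0]) auto
    then have "X - C \<subset> X" using x by auto
    then have IH: "int q dvd (\<Sum>x\<in>X - C. w x) - (\<Sum>x | x \<in> X - C \<and> r x = x. w x)"
      using psubset.prems Ciff by (intro psubset.IH) auto
    have "(\<Sum>x\<in>C. w x) = (\<Sum>i<q. w ((r ^^ i) x))"
      unfolding C_def by (subst sum.reindex[OF inj]) simp
    also have "\<dots> = int q * w x" using iter by simp
    finally have sC: "(\<Sum>x\<in>C. w x) = int q * w x" .
    have "(\<Sum>x\<in>X. w x) = (\<Sum>x\<in>X - C. w x) + (\<Sum>x\<in>C. w x)"
      using CX psubset.hyps by (metis sum.subset_diff)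
    moreover have "{x. x \<in> X - C \<and> r x = x} = {x. x \<in> X \<and> r x = x}" using noC by auto
    ultimately have eq: "(\<Sum>x\<in>X. w x) - (\<Sum>x | x \<in> X \<and> r x = x. w x)
        = ((\<Sum>x\<in>X - C. w x) - (\<Sum>x | x \<in> X - C \<and> r x = x. w x)) + int q * w x"
      using sC by simp
    show ?thesis unfolding eq by (intro dvd_add IH dvd_triv_left)
  qed
qed

lemma card_eq_mult_card_image:
  assumes "finite X" "\<And>x. x \<in> X \<Longrightarrow> card {y \<in> X. g y = g x} = m"
  shows "card X = m * card (g ` X)"
proof -
  have "(\<Sum>z\<in>g ` X. \<Sum>y | y \<in> X \<and> g y = z. 1) = (\<Sum>y\<in>X. (1::nat))"
    by (rule sum.group) (use assms(1) in auto)
  moreover have "(\<Sum>z\<in>g ` X. \<Sum>y | y \<in> X \<and> g y = z. (1::nat)) = (\<Sum>z\<in>g ` X. m)"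
    by (rule sum.cong) (use assms(2) in auto)
  ultimately show ?thesis by simp
qed

lemma power_split_last: "n \<ge> 1 \<Longrightarrow> p ^ n = p ^ (n - 1) * (p::nat)"
  by (cases n) auto

lemma even_exponent_if_square:
  assumes p: "prime (p::nat)" and square: "int p ^ m = k\<^sup>2"
  shows "\<exists>i. m = 2 * i \<and> \<bar>k\<bar> = int p ^ i"
proof -
  have "(nat \<bar>k\<bar>)\<^sup>2 = p ^ m"
  proof -
    have "int ((nat \<bar>k\<bar>)\<^sup>2) = int (p ^ m)" using square by simp
    then show ?thesis by (simp only: of_nat_eq_iff)
  qed
  then have "nat \<bar>k\<bar> dvd p ^ m" by (metis dvd_triv_left power2_eq_square)
  then obtain i where i: "nat \<bar>k\<bar> = p ^ i" using divides_primepow_nat[OF p] by blast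
  then have "p ^ (2 * i) = p ^ m" using \<open>(nat \<bar>k\<bar>)\<^sup>2 = p ^ m\<close> by (simp add: power_mult[symmetric] mult.commute)
  then have "m = 2 * i" using prime_gt_1_nat[OF p] power_inject_exp by metis
  moreover have "\<bar>k\<bar> = int p ^ i" using i by (metis abs_ge_zero nat_eq_iff2 of_nat_power nat_0_le)
  ultimately show ?thesis by blast
qed

lemma sum_split_zero:
  fixes f :: "nat \<Rightarrow> int"
  assumes "p > 0"
  shows "(\<Sum>k<p. f k) = f 0 + (\<Sum>k\<in>{1..<p}. f k)"
  using assms by (simp add: lessThan_atLeast0 sum.atLeast_Suc_lessThan)

lemma sum_periodic_shift:
  fixes f :: "nat \<Rightarrow> 'b::cancel_comm_monoid_add"
  assumes "\<And>j. f (j + p) = f j"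
  shows "(\<Sum>j<p. f (k + j)) = (\<Sum>j<p. f j)"
proof (induction k)
  case (Suc k)
  have "(\<Sum>j<p. f (Suc k + j)) + f k = (\<Sum>j<Suc p. f (k + j))"
    by (simp only: sum.lessThan_Suc_shift) (simp add: add.commute)
  also have "\<dots> = (\<Sum>j<p. f (k + j)) + f k" using assms[of k] by simp
  finally show ?case using Suc by simp
qed simp

lemma sum_periodic_mult:
  fixes f :: "nat \<Rightarrow> 'b::comm_monoid_add"
  assumes f: "\<And>i j. [i = j] (mod p) \<Longrightarrow> f i = f j" and t: "coprime t p"
  shows "(\<Sum>j<p. f (t * j)) = (\<Sum>j<p. f j)"
proof (cases "p = 0")
  case False
  have "inj_on (\<lambda>j. t * j mod p) {..<p}"
  proof (rule inj_onI)
    fix i j assume ij: "i \<in> {..<p}" "j \<in> {..<p}" "t * i mod p = t * j mod p"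
    then have "[t * i = t * j] (mod p)" by (simp add: cong_def)
    then have "[i = j] (mod p)" using t cong_mult_lcancel_nat by blast
    then show "i = j" using ij by (simp add: cong_def)
  qed
  moreover have "(\<lambda>j. t * j mod p) ` {..<p} \<subseteq> {..<p}" using False by auto
  ultimately have bij: "bij_betw (\<lambda>j. t * j mod p) {..<p} {..<p}"
    by (metis bij_betw_def endo_inj_surj finite_lessThan)
  have "(\<Sum>j<p. f (t * j)) = (\<Sum>j<p. f (t * j mod p))"
    by (intro sum.cong refl f) (simp add: cong_def)
  also have "\<dots> = (\<Sum>j<p. f j)" by (rule sum.reindex_bij_betw[OF bij])
  finally show ?thesis .
qed simp

lemma sum_period_multiple:
  fixes f :: "nat \<Rightarrow> int"
  assumes "\<And>i. f (i + N) = f i"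
  shows "(\<Sum>i<p * N. f i) = int p * (\<Sum>i<N. f i)"
proof (induction p)
  case (Suc p)
  have "(\<Sum>i<n + k. f i) = (\<Sum>i<n. f i) + (\<Sum>j<k. f (n + j))" for n k
    by (induction k) auto
  then have "(\<Sum>i<Suc p * N. f i) = (\<Sum>i<p * N. f i) + (\<Sum>j<N. f (p * N + j))"
    by (simp add: add.commute[of N])
  also have "(\<Sum>j<N. f (p * N + j)) = (\<Sum>j<N. f j)" by (rule sum_periodic_shift) (rule assms)
  finally show ?case using Suc by (simp add: algebra_simps)
qed simp

lemma sum_split_multiples:
  fixes f :: "nat \<Rightarrow> int"
  assumes p: "p > 0" and const: "\<And>i. \<not> p dvd i \<Longrightarrow> f i = c"
  shows "(\<Sum>i<p * N. f i) = (int p - 1) * int N * c + (\<Sum>i<N. f (p * i))"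
proof (induction N)
  case (Suc N)
  have "(\<Sum>i<p * Suc N. f i) = (\<Sum>i<p * N. f i) + (\<Sum>j<p. f (p * N + j))"
  proof -
    have "(\<Sum>i<n + k. f i) = (\<Sum>i<n. f i) + (\<Sum>j<k. f (n + j))" for n k
      by (induction k) auto
    then show ?thesis by (simp add: add.commute[of p])
  qed
  also have "(\<Sum>j<p. f (p * N + j)) = f (p * N) + (\<Sum>j\<in>{1..<p}. f (p * N + j))"
    using p by (simp add: lessThan_atLeast0 sum.atLeast_Suc_lessThan)
  also have "(\<Sum>j\<in>{1..<p}. f (p * N + j)) = (\<Sum>j\<in>{1..<p}. c)"
  proof (rule sum.cong[OF refl])
    fix j assume "j \<in> {1..<p}"
    then have "\<not> p dvd p * N + j" using nat_dvd_not_less[of j p] by (simp add: dvd_add_right_iff)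
    then show "f (p * N + j) = c" by (rule const)
  qed
  finally show ?case using Suc p by (simp add: algebra_simps of_nat_diff)
qed simp

text \<open>
  Think of \<open>f\<close> as a function on the cyclic group of order \<open>p ^ m\<close> that is constant on the
  generators of each subgroup. For \<open>p \<ge> 3\<close> the generators outnumber the other elements, so a vanishing
  sum forces \<open>f 1 = 0\<close>; the rest follows by passing to the subgroup of index \<open>p\<close>.
\<close>

lemma zero_if_sum_zero:
  fixes f :: "nat \<Rightarrow> int"
  assumes p: "p \<ge> 3"
  shows "\<lbrakk>\<And>i. \<bar>f i\<bar> \<le> 1; \<And>s u. \<not> p dvd u \<Longrightarrow> f (p ^ s * u) = f (p ^ s);
    (\<Sum>i<p ^ m. f i) = 0; s < m\<rbrakk> \<Longrightarrow> f (p ^ s) = 0"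
proof (induction m arbitrary: f s)
  case (Suc m)
  have p0: "p > 0" using p by linarith
  have "f i = f 1" if "\<not> p dvd i" for i using Suc.prems(2)[OF that, of 0] by simp
  then have "(\<Sum>i<p * p ^ m. f i) = (int p - 1) * int (p ^ m) * f 1 + (\<Sum>i<p ^ m. f (p * i))"
    by (rule sum_split_multiples[OF p0])
  then have split: "(int p - 1) * int (p ^ m) * f 1 + (\<Sum>i<p ^ m. f (p * i)) = 0"
    using Suc.prems(3) by simp
  have "\<bar>\<Sum>i<p ^ m. f (p * i)\<bar> \<le> (\<Sum>i<p ^ m. \<bar>f (p * i)\<bar>)" by (rule sum_abs)
  also have "\<dots> \<le> (\<Sum>i<p ^ m. 1)" by (rule sum_mono) (rule Suc.prems(1))
  finally have le: "\<bar>\<Sum>i<p ^ m. f (p * i)\<bar> \<le> int (p ^ m)" by simp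
  have f1: "f 1 = 0"
  proof (rule ccontr)
    assume "f 1 \<noteq> 0"
    then have "\<bar>f 1\<bar> = 1" using Suc.prems(1)[of 1] by linarith
    then have "\<bar>(int p - 1) * int (p ^ m) * f 1\<bar> = (int p - 1) * int (p ^ m)"
      using p by (simp add: abs_mult)
    moreover have "\<bar>(int p - 1) * int (p ^ m) * f 1\<bar> \<le> int (p ^ m)" using split le by linarith
    moreover have "2 * int (p ^ m) \<le> (int p - 1) * int (p ^ m)" using p by (intro mult_right_mono) auto
    moreover have "int (p ^ m) > 0" using p by simp
    ultimately show False by linarith
  qed
  show ?case
  proof (cases s)
    case 0
    then show ?thesis using f1 by simp
  next
    case (Suc s')
    have "f (p * (p ^ s')) = 0"
    proof (rule Suc.IH[of "\<lambda>i. f (p * i)" s'])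
      show "\<bar>f (p * i)\<bar> \<le> 1" for i by (rule Suc.prems(1))
      show "f (p * (p ^ s * u)) = f (p * p ^ s)" if "\<not> p dvd u" for s u
        using Suc.prems(2)[OF that, of "Suc s"] by (simp add: mult.assoc)
      show "(\<Sum>i<p ^ m. f (p * i)) = 0" using split f1 by simp
      show "s' < m" using Suc.prems(4) Suc by simp
    qed
    then show ?thesis using Suc by simp
  qed
qed simp

lemma eq_if_sum_extremal:
  fixes f :: "'b \<Rightarrow> int"
  assumes "finite L" "\<And>l. l \<in> L \<Longrightarrow> \<bar>f l\<bar> \<le> 1" "\<bar>\<Sum>l\<in>L. f l\<bar> = int (card L)" "l \<in> L" "l' \<in> L"
  shows "f l = f l'"
proof -
  have *: "f l = 1" if "\<And>l. l \<in> L \<Longrightarrow> \<bar>f l\<bar> \<le> 1" "(\<Sum>l\<in>L. f l) = int (card L)" "l \<in> L"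
    for f :: "'b \<Rightarrow> int" and l
  proof -
    have "(\<Sum>l\<in>L. 1 - f l) = 0" using that by (simp add: sum_subtractf)
    moreover have "1 - f l \<ge> 0" if "l \<in> L" for l using that \<open>\<And>l. l \<in> L \<Longrightarrow> \<bar>f l\<bar> \<le> 1\<close>[of l] by linarith
    ultimately show ?thesis using assms(1) that(3) by (subst (asm) sum_nonneg_eq_0_iff) auto
  qed
  have "(\<Sum>l\<in>L. f l) = int (card L) \<or> (\<Sum>l\<in>L. - f l) = int (card L)"
    using assms(3) by (auto simp: abs_if sum_negf split: if_splits)
  then show ?thesis
  proof
    assume "(\<Sum>l\<in>L. f l) = int (card L)"
    then show ?thesis using *[of f l] *[of f l'] assms by simp
  next
    assume "(\<Sum>l\<in>L. - f l) = int (card L)"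
    then show ?thesis using *[of "\<lambda>l. - f l" l] *[of "\<lambda>l. - f l" l'] assms by fastforce
  qed
qed

lemma sum_eq_one_indicator:
  assumes "finite X" "c \<in> X"
  shows "(\<Sum>x\<in>X. (if x = c then 1 else 0) * f x) = (f c :: int)"
proof -
  have "(\<Sum>x\<in>X. (if x = c then 1 else 0) * f x) = (\<Sum>x\<in>X. if x = c then f x else 0)"
    by (rule sum.cong) auto
  then show ?thesis using assms by simp
qed

section \<open>Powers and cyclic subgroups in finite abelian groups\<close>

locale finite_abelian = comm_group G for G (structure) +
  assumes fin: "finite (carrier G)"
begin

lemma sum_translate:
  assumes "a \<in> carrier G"
  shows "(\<Sum>x\<in>carrier G. f (a \<otimes> x)) = (\<Sum>x\<in>carrier G. f x)"
  using sum.reindex[of "(\<otimes>) a" "carrier G" f] assms surj_const_mult[of a] inj_on_cmult[of a]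
  by simp

lemma sum_invert: "(\<Sum>x\<in>carrier G. f (inv x)) = (\<Sum>x\<in>carrier G. f x)"
  by (rule sum.reindex_bij_witness[of _ "\<lambda>x. inv x" "\<lambda>x. inv x"]) auto

lemma order_pos: "order G > 0"
  using fin by (simp add: order_gt_0_iff_finite)

lemma pow_cong:
  assumes "x \<in> carrier G" "x [^] k = \<one>" "[m = n] (mod k)"
  shows "x [^] m = x [^] (n::nat)"
proof -
  have *: "x [^] m = x [^] (m mod k)" for m
  proof -
    have "x [^] m = x [^] (k * (m div k) + m mod k)" by simp
    also have "\<dots> = (x [^] k) [^] (m div k) \<otimes> x [^] (m mod k)"
      using assms(1) by (simp add: nat_pow_mult nat_pow_pow)
    finally show ?thesis using assms by simp
  qed
  show ?thesis using *[of m] *[of n] assms(3) by (simp add: cong_def)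
qed

lemma pow_cong_order:
  assumes "x \<in> carrier G" "[m = n] (mod order G)"
  shows "x [^] m = x [^] (n::nat)"
  using pow_cong[OF assms(1) _ assms(2)] pow_order_eq_1[OF assms(1)] by simp

lemma coprime_power_inverse:
  assumes "coprime t (order G)"
  obtains u where "coprime u (order G)" "\<And>x. x \<in> carrier G \<Longrightarrow> (x [^] t) [^] (u::nat) = x"
proof -
  obtain u where u: "[t * u = 1] (mod order G)"
    using cong_solve_coprime_nat[OF assms] by auto
  show thesis
  proof
    show "coprime u (order G)"
      using u by (metis coprime_iff_invertible_nat mult.commute One_nat_def)
    show "(x [^] t) [^] u = x" if "x \<in> carrier G" for x
      using that pow_cong_order[OF that u] by (simp add: nat_pow_pow)
  qed
qed

lemma coprime_power_inj:
  assumes "coprime t (order G)" "x \<in> carrier G" "y \<in> carrier G" "x [^] t = y [^] (t::nat)"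
  shows "x = y"
  using coprime_power_inverse[OF assms(1)] assms(2-) by metis

lemma inv_eq_power: "x \<in> carrier G \<Longrightarrow> inv x = x [^] (order G - 1)"
  using pow_order_eq_1[of x] order_pos
  by (intro inv_equality) (auto simp flip: nat_pow_Suc)

definition fibre :: "nat \<Rightarrow> 'a \<Rightarrow> 'a set" where
  "fibre q z = {x \<in> carrier G. x [^] q = z}"

lemma finite_fibre [simp]: "finite (fibre q z)"
  unfolding fibre_def using fin by simp

lemma fibre_eq_coset:
  assumes "x \<in> carrier G"
  shows "fibre q (x [^] q) = (\<otimes>) x ` fibre q \<one>"
proof (intro equalityI subsetI)
  fix y assume "y \<in> fibre q (x [^] q)"
  then have y: "y \<in> carrier G" "y [^] q = x [^] q" by (auto simp: fibre_def)
  have "y = x \<otimes> (inv x \<otimes> y)" using y assms by (simp add: m_assoc[symmetric])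
  moreover have "inv x \<otimes> y \<in> fibre q \<one>"
  proof -
    have "(inv x \<otimes> y) [^] q = (inv x \<otimes> x) [^] q"
      using y assms by (simp only: pow_mult_distrib[OF m_comm] inv_closed)
    then show ?thesis using y assms by (simp add: fibre_def)
  qed
  ultimately show "y \<in> (\<otimes>) x ` fibre q \<one>" by blast
qed (use assms in \<open>auto simp: fibre_def pow_mult_distrib[OF m_comm]\<close>)

lemma card_fibre:
  assumes "x \<in> carrier G"
  shows "card (fibre q (x [^] q)) = card (fibre q \<one>)"
  unfolding fibre_eq_coset[OF assms]
  by (rule card_image) (use assms in \<open>auto simp: inj_on_def fibre_def\<close>)

definition powers :: "nat \<Rightarrow> 'a set" where
  "powers q = (\<lambda>x. x [^] q) ` carrier G"

lemma one_in_powers: "\<one> \<in> powers q"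
  unfolding powers_def by (rule image_eqI[of _ _ \<one>]) auto

lemma finite_powers: "finite (powers q)"
  using fin by (simp add: powers_def)

lemma card_powers: "card (powers q) * card (fibre q \<one>) = order G"
proof -
  have "(\<Sum>z\<in>powers q. \<Sum>x | x \<in> carrier G \<and> x [^] q = z. 1) = (\<Sum>x\<in>carrier G. (1::nat))"
    by (rule sum.group) (auto simp: powers_def fin)
  moreover have "(\<Sum>x | x \<in> carrier G \<and> x [^] q = z. (1::nat)) = card (fibre q \<one>)"
    if "z \<in> powers q" for z
    using that card_fibre by (auto simp: powers_def fibre_def)
  ultimately show ?thesis by (simp add: order_def)
qed

text \<open>
  Modulo \<open>q\<close>-th powers every element is one of the \<open>q\<^sup>2\<close> products of small powers of the two
  generators, and the index of the subgroup of \<open>q\<close>-th powers is the order of the kernel.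
\<close>

lemma card_fibre_le:
  assumes g: "g \<in> carrier G" "h \<in> carrier G"
    and gen: "\<And>z. z \<in> carrier G \<Longrightarrow> \<exists>(i::nat) (j::nat). z = g [^] i \<otimes> h [^] j"
    and q: "q > 0"
  shows "card (fibre q \<one>) \<le> q\<^sup>2"
proof -
  let ?f = "\<lambda>(i, j, w). g [^] i \<otimes> h [^] j \<otimes> w"
  have "carrier G \<subseteq> ?f ` ({..<q} \<times> {..<q} \<times> powers q)"
  proof
    fix z assume "z \<in> carrier G"
    then obtain i j :: nat where z: "z = g [^] i \<otimes> h [^] j" using gen by blast
    have split: "x [^] i = x [^] (i mod q) \<otimes> (x [^] (i div q)) [^] q" if "x \<in> carrier G" for x and i :: nat
      using that by (simp add: nat_pow_pow nat_pow_mult)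
    have "z = g [^] (i mod q) \<otimes> h [^] (j mod q) \<otimes> (g [^] (i div q) \<otimes> h [^] (j div q)) [^] q"
      unfolding z split[OF g(1), of i] split[OF g(2), of j]
      using g by (simp add: pow_mult_distrib[OF m_comm] m_ac)
    moreover have "(g [^] (i div q) \<otimes> h [^] (j div q)) [^] q \<in> powers q"
      using g by (auto simp: powers_def)
    ultimately show "z \<in> ?f ` ({..<q} \<times> {..<q} \<times> powers q)"
      using q by (intro image_eqI[where x = "(i mod q, j mod q, (g [^] (i div q) \<otimes> h [^] (j div q)) [^] q)"]) auto
  qed
  then have "order G \<le> card (?f ` ({..<q} \<times> {..<q} \<times> powers q))"
    unfolding order_def using finite_powers by (intro card_mono) auto
  also have "\<dots> \<le> card ({..<q} \<times> {..<q} \<times> powers q)"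
    using finite_powers by (intro card_image_le) auto
  also have "\<dots> = q\<^sup>2 * card (powers q)" by (simp add: card_cartesian_product power2_eq_square)
  finally have "card (powers q) * card (fibre q \<one>) \<le> card (powers q) * q\<^sup>2"
    using card_powers[of q] by (simp add: mult.commute)
  moreover have "card (powers q) > 0" using one_in_powers finite_powers by (auto simp: card_gt_0_iff)
  ultimately show ?thesis by simp
qed

abbreviation cyc :: "'a \<Rightarrow> 'a set" where "cyc x \<equiv> generate G {x}"

lemma cyc_eq: "x \<in> carrier G \<Longrightarrow> cyc x = {x [^] k | k::nat. True}"
  using generate_pow_on_finite_carrier[OF fin] by auto

lemma in_cyc_self: "x \<in> carrier G \<Longrightarrow> x \<in> cyc x"
  by (simp add: generate.incl)

lemma cyc_subset:
  assumes "x \<in> carrier G" "y \<in> cyc x"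
  shows "cyc y \<subseteq> cyc x"
proof -
  have y: "y \<in> carrier G" using assms generate_incl[of "{x}"] by auto
  then show ?thesis using assms by (auto simp: cyc_eq nat_pow_pow)
qed

lemma cyc_closed: "x \<in> carrier G \<Longrightarrow> cyc x \<subseteq> carrier G"
  by (rule generate_incl) simp

lemma finite_cyc: "x \<in> carrier G \<Longrightarrow> finite (cyc x)"
  using cyc_closed fin finite_subset by blast

lemma subgroup_cyc: "x \<in> carrier G \<Longrightarrow> subgroup (cyc x) G"
  by (rule generate_is_subgroup) simp

lemma ord_prime:
  assumes "prime q" "x \<in> carrier G" "x \<noteq> \<one>" "x [^] q = \<one>"
  shows "ord x = q"
  using assms pow_eq_id[of x q] ord_eq_1[of x] prime_nat_iff by metis

lemma cyc_prime_generators: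
  assumes q: "prime q" and x: "x \<in> carrier G" "x \<noteq> \<one>" "x [^] q = \<one>"
  shows "{y \<in> carrier G. cyc y = cyc x} = cyc x - {\<one>}" and "card (cyc x - {\<one>}) = q - 1"
proof -
  have card: "card (cyc x) = q" using generate_pow_card[OF x(1)] ord_prime[OF q x] by simp
  have one: "\<one> \<in> cyc x" by (simp add: generate.one)
  show "card (cyc x - {\<one>}) = q - 1" using card one finite_cyc[OF x(1)] by simp
  show "{y \<in> carrier G. cyc y = cyc x} = cyc x - {\<one>}"
  proof (intro equalityI subsetI)
    fix y assume y: "y \<in> {y \<in> carrier G. cyc y = cyc x}"
    then have "y \<in> cyc x" using in_cyc_self[of y] by auto
    moreover have "y \<noteq> \<one>"
    proof
      assume "y = \<one>"
      then have "cyc x = {\<one>}" using y generate_one by auto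
      then show False using in_cyc_self[OF x(1)] x(2) by auto
    qed
    ultimately show "y \<in> cyc x - {\<one>}" by simp
  next
    fix y assume y: "y \<in> cyc x - {\<one>}"
    then have yc: "y \<in> carrier G" using cyc_closed[OF x(1)] by auto
    obtain k :: nat where k: "y = x [^] k" using y cyc_eq[OF x(1)] by auto
    have "y [^] q = (x [^] q) [^] k" using x(1) k by (simp add: nat_pow_pow mult.commute)
    then have "ord y = q" using ord_prime[OF q yc] y x by auto
    then have "card (cyc y) = card (cyc x)" using generate_pow_card[OF yc] card by simp
    moreover have "cyc y \<subseteq> cyc x" using cyc_subset[OF x(1)] y by auto
    ultimately have "cyc y = cyc x" using finite_cyc[OF x(1)] by (metis card_subset_eq)
    then show "y \<in> {y \<in> carrier G. cyc y = cyc x}" using yc by simp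
  qed
qed

text \<open>
  Such a set is a disjoint union of sets of generators of subgroups of order \<open>q\<close>.
\<close>

lemma card_unit_closed_dvd:
  assumes q: "prime q" and X: "X \<subseteq> fibre q \<one> - {\<one>}"
    and closed: "\<And>x t. \<lbrakk>x \<in> X; \<not> q dvd t\<rbrakk> \<Longrightarrow> x [^] (t::nat) \<in> X"
  shows "(q - 1) dvd card X"
proof -
  have "card {y \<in> X. cyc y = cyc x} = q - 1" if "x \<in> X" for x
  proof -
    have x: "x \<in> carrier G" "x \<noteq> \<one>" "x [^] q = \<one>" using that X by (auto simp: fibre_def)
    have "y \<in> X" if y: "y \<in> cyc x - {\<one>}" for y
    proof -
      obtain k :: nat where k: "y = x [^] k" using y cyc_eq[OF x(1)] by auto
      have "\<not> q dvd k"
      proof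
        assume "q dvd k"
        then obtain j where "k = q * j" by auto
        then have "y = (x [^] q) [^] j" using k x(1) by (simp add: nat_pow_pow)
        then show False using y x by simp
      qed
      then show ?thesis using closed \<open>x \<in> X\<close> k by simp
    qed
    then have "{y \<in> X. cyc y = cyc x} = cyc x - {\<one>}"
      using cyc_prime_generators(1)[OF q x] X by (auto simp: fibre_def)
    then show ?thesis using cyc_prime_generators(2)[OF q x] by simp
  qed
  moreover have "finite X" using X finite_subset finite_fibre by blast
  ultimately show ?thesis using card_eq_mult_card_image[of X cyc "q - 1"] by simp
qed

lemma exists_prime_order:
  assumes "prime r" "r dvd order G"
  obtains x where "x \<in> carrier G" "x \<noteq> \<one>" "x [^] r = \<one>"
proof -
  obtain m where "order G = r ^ 1 * m" using assms(2) by auto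
  then obtain H where H: "subgroup H G" "card H = r"
    using sylow_thm[OF assms(1) is_group _ fin] by (metis power_one_right)
  have "\<one> \<in> H" using H(1) by (rule subgroup.one_closed)
  moreover have "H \<noteq> {\<one>}" using H(2) prime_gt_1_nat[OF assms(1)] by auto
  ultimately obtain x where x: "x \<in> H" "x \<noteq> \<one>" by blast
  interpret H: group "G\<lparr>carrier := H\<rparr>" using H(1) is_group by (rule subgroup.subgroup_is_group)
  have "x [^]\<^bsub>G\<lparr>carrier := H\<rparr>\<^esub> order (G\<lparr>carrier := H\<rparr>) = \<one>"
    using H.pow_order_eq_1[of x] x by simp
  then have "x [^] r = \<one>" using H(2) by (simp add: order_def nat_pow_consistent[symmetric])
  then show thesis using that x H(1) subgroup.mem_carrier by metis
qed

lemma ord_prime_power: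
  assumes "prime p" "order G = p ^ m" "x \<in> carrier G"
  obtains a where "ord x = p ^ a" "a \<le> m"
  using ord_dvd_group_order[OF assms(3)] assms(1,2) by (metis divides_primepow_nat)

lemma p_power_image_cyc:
  assumes "x \<in> carrier G"
  shows "(\<lambda>z. z [^] (p::nat)) ` cyc x = cyc (x [^] p)"
proof -
  have "(\<lambda>z. z [^] p) ` cyc x = {(x [^] k) [^] p | k::nat. True}"
    unfolding cyc_eq[OF assms] by auto
  also have "\<dots> = {(x [^] p) [^] k | k::nat. True}"
    using assms by (simp add: nat_pow_pow mult.commute)
  finally show ?thesis using cyc_eq[of "x [^] p"] assms by simp
qed

lemma level_cyc:
  assumes p: "prime p" and y: "y \<in> carrier G" "ord y = p ^ i"
  shows "level p (cyc y) = i"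
  unfolding level_def
proof (rule the_equality)
  show "card (cyc y) = p ^ i" using generate_pow_card[OF y(1)] y(2) by simp
  show "j = i" if "card (cyc y) = p ^ j" for j
    using that generate_pow_card[OF y(1)] y(2) prime_gt_1_nat[OF p] by (metis power_inject_exp)
qed

text \<open>
  An exponent that acts as \<open>t\<close> on elements of order \<open>r\<close> and trivially on elements of any other prime
  order, while still being invertible modulo the group order.
\<close>

lemma crt_unit:
  assumes r: "prime r" "r dvd order G" and t: "\<not> r dvd t"
  obtains t' where "coprime t' (order G)" "[t' = t] (mod r)"
    "\<And>r'. \<lbrakk>prime r'; r' \<noteq> r; r' dvd order G\<rbrakk> \<Longrightarrow> [t' = 1] (mod r')"
proof -
  obtain M where M: "order G = r ^ multiplicity r (order G) * M" "\<not> r dvd M"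
    using multiplicity_decompose'[of "order G" r] order_pos r(1)
    by (metis not_prime_unit less_numeral_extra(3) mult.commute)
  let ?R = "r ^ multiplicity r (order G)"
  have cRM: "coprime ?R M" using M(2) r(1) prime_imp_coprime coprime_power_left_iff by blast
  obtain t' where t': "[t' = t] (mod ?R)" "[t' = 1] (mod M)"
    using binary_chinese_remainder_nat[OF cRM] by blast
  have pos: "multiplicity r (order G) > 0"
    using r order_pos by (simp add: prime_multiplicity_gt_zero_iff)
  show thesis
  proof
    have "coprime t ?R"
      using t r(1) prime_imp_coprime coprime_power_right_iff coprime_commute by metis
    then have "coprime t' ?R" using t'(1) by (metis coprime_cong_cong_left)
    moreover have "coprime t' M" using t'(2) by (metis coprime_1_left coprime_cong_cong_left)
    ultimately show "coprime t' (order G)" by (subst M(1)) simp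
    show "[t' = t] (mod r)" using t'(1) pos by (metis cong_dvd_modulus_nat dvd_power)
    fix r' assume r': "prime r'" "r' \<noteq> r" "r' dvd order G"
    then have "\<not> r' dvd ?R" using r(1) by (metis prime_dvd_power primes_dvd_imp_eq)
    then have "r' dvd M" using r' M(1) by (metis prime_dvd_mult_iff)
    then show "[t' = 1] (mod r')" using t'(2) by (metis cong_dvd_modulus_nat)
  qed
qed

end

section \<open>Bases of abelian p-groups of rank two\<close>

lemma group_Zpn2: "group (Zpn2 p n)"
  unfolding Zpn2_def by (intro DirProd_group) auto

context finite_abelian
begin

definition spans :: "'a \<Rightarrow> 'a \<Rightarrow> bool" where
  "spans x y \<longleftrightarrow> x \<in> carrier G \<and> y \<in> carrier G \<and>
    (\<forall>z\<in>carrier G. \<exists>(i::nat) (j::nat). z = x [^] i \<otimes> y [^] j)"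

text \<open>
  A presentation of the group as an internal direct product of cyclic groups of orders \<open>p ^ a\<close>
  and \<open>p ^ b\<close>: the condition on the group order makes the representation \<open>x ^ i y ^ j\<close> unique and
  the two orders exact.
\<close>

definition basis :: "nat \<Rightarrow> nat \<Rightarrow> nat \<Rightarrow> 'a \<Rightarrow> 'a \<Rightarrow> bool" where
  "basis p a b x y \<longleftrightarrow> spans x y \<and> x [^] (p ^ a) = \<one> \<and> y [^] (p ^ b) = \<one> \<and> order G = p ^ (a + b)"

lemma spans_if_generate:
  assumes "g \<in> carrier G" "h \<in> carrier G" "generate G {g, h} = carrier G"
  shows "spans g h"
proof -
  have "\<exists>(i::nat) (j::nat). z = g [^] i \<otimes> h [^] j" if "z \<in> generate G {g, h}" for z
    using that
  proof (induction rule: generate.induct)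
    case one
    have "\<one> = g [^] (0::nat) \<otimes> h [^] (0::nat)" by simp
    then show ?case by blast
  next
    case (incl z)
    have "g = g [^] (1::nat) \<otimes> h [^] (0::nat)" "h = g [^] (0::nat) \<otimes> h [^] (1::nat)" using assms by auto
    then show ?case using incl by blast
  next
    case (inv z)
    have "inv g = g [^] (order G - 1) \<otimes> h [^] (0::nat)" "inv h = g [^] (0::nat) \<otimes> h [^] (order G - 1)"
      using assms inv_eq_power by auto
    then show ?case using inv by blast
  next
    case (eng z w)
    then obtain i j k l :: nat where "z = g [^] i \<otimes> h [^] j" "w = g [^] k \<otimes> h [^] l" by blast
    then have "z \<otimes> w = g [^] (i + k) \<otimes> h [^] (j + l)"
      using assms by (simp add: nat_pow_mult[symmetric] m_ac)
    then show ?case by blast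
  qed
  then show ?thesis using assms by (auto simp: spans_def)
qed

lemma rank_two_generators:
  assumes "group_rank G = 2"
  obtains g h where "spans g h" "\<And>x. x \<in> carrier G \<Longrightarrow> cyc x \<noteq> carrier G"
proof -
  let ?P = "\<lambda>r. \<exists>X. X \<subseteq> carrier G \<and> finite X \<and> card X = r \<and> generate G X = carrier G"
  have "generate G (carrier G) = carrier G"
    using generate_incl[of "carrier G"] generate.incl[of _ "carrier G" G] by blast
  then have "?P (card (carrier G))" using fin by blast
  then have "?P (group_rank G)" unfolding group_rank_def by (rule LeastI)
  then obtain X where X: "X \<subseteq> carrier G" "card X = 2" "generate G X = carrier G" using assms by auto
  then obtain g h where gh: "X = {g, h}" by (auto simp: card_2_iff)
  have "spans g h" using X gh by (intro spans_if_generate) auto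
  moreover have "cyc x \<noteq> carrier G" if "x \<in> carrier G" for x
  proof
    assume "cyc x = carrier G"
    then have "?P 1" using that by (intro exI[of _ "{x}"]) auto
    then have "group_rank G \<le> 1" unfolding group_rank_def by (rule Least_le)
    then show False using assms by simp
  qed
  ultimately show thesis using that by blast
qed

lemma spans_carrier: "spans x y \<Longrightarrow> x \<in> carrier G \<and> y \<in> carrier G"
  by (simp add: spans_def)

lemma spans_commute: "spans x y \<Longrightarrow> spans y x"
  unfolding spans_def by (metis m_comm nat_pow_closed)

lemma spans_change:
  assumes "spans x y" "w \<in> carrier G" "y = x [^] (k::nat) \<otimes> w [^] (l::nat)"
  shows "spans x w"
  unfolding spans_def
proof (intro conjI ballI)
  show x: "x \<in> carrier G" using assms by (simp add: spans_def)
  fix z assume "z \<in> carrier G"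
  then obtain i j :: nat where "z = x [^] i \<otimes> y [^] j" using assms(1) by (auto simp: spans_def)
  then have "z = x [^] (i + k * j) \<otimes> w [^] (l * j)"
    using x assms(2,3) by (simp add: pow_mult_distrib[OF m_comm] nat_pow_pow nat_pow_mult[symmetric] m_ac)
  then show "\<exists>(i::nat) (j::nat). z = x [^] i \<otimes> w [^] j" by blast
qed (fact assms)

lemma spans_image:
  assumes "spans x y" "x [^] k = \<one>" "y [^] l = \<one>" "k > 0" "l > 0"
  shows "(\<lambda>(i, j). x [^] i \<otimes> y [^] j) ` ({..<k::nat} \<times> {..<l::nat}) = carrier G"
proof (intro equalityI subsetI)
  have xy: "x \<in> carrier G" "y \<in> carrier G" using assms spans_carrier by auto
  fix z assume "z \<in> carrier G"
  then obtain i j :: nat where z: "z = x [^] i \<otimes> y [^] j" using assms(1) by (auto simp: spans_def)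
  have "x [^] i = x [^] (i mod k)" "y [^] j = y [^] (j mod l)"
    using pow_cong[OF xy(1) assms(2), of i "i mod k"] pow_cong[OF xy(2) assms(3), of j "j mod l"]
    by (auto simp: cong_def)
  then show "z \<in> (\<lambda>(i, j). x [^] i \<otimes> y [^] j) ` ({..<k} \<times> {..<l})"
    using z assms(4,5) by (intro image_eqI[where x = "(i mod k, j mod l)"]) auto
qed (use assms spans_carrier in auto)

text \<open>
  Let \<open>g\<close> be the generator of larger order \<open>p ^ a\<close>. If the cyclic quotient by \<open>\<langle>g\<rangle>\<close> has order
  \<open>p ^ b\<close>, then \<open>h ^ (p ^ b) = g ^ k\<close>, and \<open>p ^ b\<close> divides \<open>k\<close> because \<open>p ^ a\<close> annihilates \<open>h\<close>. So \<open>h\<close> can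
  be corrected by a power of \<open>g\<close> to an element that is killed by \<open>p ^ b\<close>.
\<close>

theorem basis_exists:
  assumes p: "prime p" and N: "order G = p ^ m" and "spans g h"
  obtains a b x y where "b \<le> a" "basis p a b x y"
proof -
  have main: "\<exists>a b x y. b \<le> a \<and> basis p a b x y" if gh: "spans g h" "ord h \<le> ord g" for g h
  proof -
    have carr: "g \<in> carrier G" "h \<in> carrier G" using gh spans_carrier by auto
    obtain a where a: "ord g = p ^ a" "a \<le> m" using ord_prime_power[OF p N carr(1)] .
    obtain c where c: "ord h = p ^ c" "c \<le> m" using ord_prime_power[OF p N carr(2)] .
    have "c \<le> a" using power_le_imp_le_exp[OF prime_gt_1_nat[OF p]] gh(2) a(1) c(1) by metis
    \<comment> \<open>The quotient by the subgroup generated by \<open>g\<close> has order \<open>p ^ b\<close>.\<close>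
    define b where "b = m - a"
    have m: "m = a + b" using a by (simp add: b_def)
    have pos: "p ^ k > 0" for k using prime_gt_0_nat[OF p] by simp
    have "g [^] (p ^ a) = \<one>" "h [^] (p ^ c) = \<one>"
      using pow_ord_eq_1 carr a(1) c(1) by metis+
    then have "(\<lambda>(i, j). g [^] i \<otimes> h [^] j) ` ({..<p ^ a} \<times> {..<p ^ c}) = carrier G"
      using pos by (intro spans_image[OF gh(1)])
    then have "order G \<le> card ({..<p ^ a} \<times> {..<p ^ c})"
      unfolding order_def by (metis card_image_le finite_cartesian_product finite_lessThan)
    then have "p ^ m \<le> p ^ (a + c)" using N by (simp add: card_cartesian_product power_add)
    then have "m \<le> a + c" by (rule power_le_imp_le_exp[OF prime_gt_1_nat[OF p]])
    then have "b \<le> a" using \<open>c \<le> a\<close> m by simp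
    let ?H = "cyc g"
    have sub: "subgroup ?H G" using carr(1) by (rule subgroup_cyc)
    then interpret H: normal ?H G by (rule subgroup_imp_normal)
    interpret Q: group "G Mod ?H" by (rule H.factorgroup_is_group)
    have "card (rcosets ?H) * p ^ a = p ^ b * p ^ a"
      using lagrange[OF sub] N m a generate_pow_card[OF carr(1)] by (simp add: power_add mult.commute)
    then have oQ: "order (G Mod ?H) = p ^ b" using prime_gt_0_nat[OF p] by (simp add: order_def FactGroup_def)
    have inQ: "?H #> h \<in> carrier (G Mod ?H)" using carr by (auto simp: FactGroup_def RCOSETS_def)
    have "(?H #> h) [^]\<^bsub>G Mod ?H\<^esub> (p ^ b) = \<one>\<^bsub>G Mod ?H\<^esub>"
      using Q.pow_order_eq_1[OF inQ] unfolding oQ .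
    then have "?H #> (h [^] (p ^ b)) = ?H"
      using H.FactGroup_pow[OF carr(2), of "p ^ b"] by simp
    then have "h [^] (p ^ b) \<in> ?H" using rcos_self[OF _ sub, of "h [^] (p ^ b)"] carr by simp
    then obtain k :: nat where k: "h [^] (p ^ b) = g [^] k" using cyc_eq[OF carr(1)] by auto
    have ab: "p ^ b * p ^ (a - b) = p ^ a" using \<open>b \<le> a\<close> by (simp flip: power_add)
    have "g [^] (k * p ^ (a - b)) = (g [^] k) [^] (p ^ (a - b))" using carr by (simp add: nat_pow_pow)
    also have "\<dots> = h [^] (p ^ a)" using carr by (simp add: nat_pow_pow ab flip: k)
    also have "\<dots> = \<one>" using c \<open>c \<le> a\<close> pow_eq_id[OF carr(2)] by (simp add: le_imp_power_dvd)
    finally have "p ^ b * p ^ (a - b) dvd k * p ^ (a - b)" using pow_eq_id[OF carr(1)] a ab by simp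
    then have "p ^ b dvd k" using prime_gt_0_nat[OF p] by simp
    then obtain k' where k': "k = p ^ b * k'" by auto
    define y where "y = h \<otimes> inv (g [^] k')"
    have y: "y \<in> carrier G" using carr by (simp add: y_def)
    have hy: "h = g [^] k' \<otimes> y [^] (1::nat)" using carr by (simp add: y_def m_ac)
    have "spans g y" by (rule spans_change[OF gh(1) y hy])
    moreover have "y [^] (p ^ b) = \<one>"
    proof -
      have "g [^] k = g [^] k \<otimes> y [^] (p ^ b)"
        using carr y unfolding k[symmetric] by (subst hy) (simp add: pow_mult_distrib[OF m_comm] nat_pow_pow k k' mult.commute)
      then show ?thesis using carr y by simp
    qed
    moreover have "g [^] (p ^ a) = \<one>" using pow_ord_eq_1[OF carr(1)] a by simp
    ultimately have "basis p a b g y" using N m by (simp add: basis_def)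
    then show ?thesis using \<open>b \<le> a\<close> by blast
  qed
  have "\<exists>a b x y. b \<le> a \<and> basis p a b x y"
    using main[of g h] main[of h g] assms(3) spans_commute nat_le_linear by blast
  then show thesis using that by blast
qed

lemma basis_carrier: "basis p a b x y \<Longrightarrow> x \<in> carrier G \<and> y \<in> carrier G"
  by (simp add: basis_def spans_def)

text \<open>
  The map is onto the group, and domain and range have equal cardinality.
\<close>

lemma basis_inj:
  assumes "prime p" "basis p a b x y"
  shows "inj_on (\<lambda>(i, j). x [^] i \<otimes> y [^] j) ({..<p ^ a} \<times> {..<p ^ b})"
proof (rule eq_card_imp_inj_on)
  have "(\<lambda>(i, j). x [^] i \<otimes> y [^] j) ` ({..<p ^ a} \<times> {..<p ^ b}) = carrier G"
    using assms prime_gt_0_nat by (intro spans_image) (auto simp: basis_def)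
  then show "card ((\<lambda>(i, j). x [^] i \<otimes> y [^] j) ` ({..<p ^ a} \<times> {..<p ^ b})) = card ({..<p ^ a} \<times> {..<p ^ b})"
    using assms(2) by (simp add: basis_def order_def card_cartesian_product power_add)
qed simp

lemma basis_eq_iff:
  assumes "prime p" "basis p a b x y"
  shows "x [^] i \<otimes> y [^] j = x [^] i' \<otimes> y [^] (j'::nat) \<longleftrightarrow> [i = i'] (mod p ^ a) \<and> [j = j'] (mod p ^ b)"
proof -
  have xy: "x \<in> carrier G" "y \<in> carrier G" "x [^] (p ^ a) = \<one>" "y [^] (p ^ b) = \<one>"
    using assms spans_carrier by (auto simp: basis_def)
  have red: "x [^] i = x [^] (i mod p ^ a)" "y [^] i = y [^] (i mod p ^ b)" for i :: nat
    using pow_cong[OF xy(1,3), of i "i mod p ^ a"] pow_cong[OF xy(2,4), of i "i mod p ^ b"]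
    by (auto simp: cong_def)
  have pos: "p ^ k > 0" for k using prime_gt_0_nat[OF assms(1)] by simp
  show ?thesis
  proof
    assume eq: "x [^] i \<otimes> y [^] j = x [^] i' \<otimes> y [^] j'"
    then have "x [^] (i mod p ^ a) \<otimes> y [^] (j mod p ^ b) = x [^] (i' mod p ^ a) \<otimes> y [^] (j' mod p ^ b)"
      by (simp flip: red)
    then have "(i mod p ^ a, j mod p ^ b) = (i' mod p ^ a, j' mod p ^ b)"
      using inj_onD[OF basis_inj[OF assms], of "(i mod p ^ a, j mod p ^ b)" "(i' mod p ^ a, j' mod p ^ b)"] pos by simp
    then show "[i = i'] (mod p ^ a) \<and> [j = j'] (mod p ^ b)" by (simp add: cong_def)
  next
    assume "[i = i'] (mod p ^ a) \<and> [j = j'] (mod p ^ b)"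
    then show "x [^] i \<otimes> y [^] j = x [^] i' \<otimes> y [^] j'" 
      using pow_cong[OF xy(1,3), of i i'] pow_cong[OF xy(2,4), of j j'] by simp
  qed
qed

lemma basis_pow_eq_one_iff:
  assumes "prime p" "basis p a b x y"
  shows "x [^] (i::nat) \<otimes> y [^] (j::nat) = \<one> \<longleftrightarrow> p ^ a dvd i \<and> p ^ b dvd j"
  using basis_eq_iff[OF assms, of i j 0 0] by (simp add: cong_0_iff)

lemma basis_ords:
  assumes "prime p" "basis p a b x y"
  shows "ord x = p ^ a" "ord y = p ^ b"
proof -
  have "x [^] (i::nat) = \<one> \<longleftrightarrow> p ^ a dvd i" "y [^] (i::nat) = \<one> \<longleftrightarrow> p ^ b dvd i" for i
    using basis_pow_eq_one_iff[OF assms, of i 0] basis_pow_eq_one_iff[OF assms, of 0 i]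
      basis_carrier[OF assms(2)] by auto
  then show "ord x = p ^ a" "ord y = p ^ b"
    using pow_eq_id basis_carrier[OF assms(2)] by (metis dvd_antisym dvd_refl)+
qed

lemma basis_card_cyc:
  assumes "prime p" "basis p a b x y"
  shows "card (cyc y) = p ^ b"
  using basis_ords(2)[OF assms] generate_pow_card basis_carrier[OF assms(2)] by simp

lemma basis_commute: "basis p n n x y \<Longrightarrow> basis p n n y x"
  by (simp add: basis_def spans_commute)

text \<open>
  Since \<open>j\<close> is invertible modulo \<open>p ^ n\<close>, the second basis element can be recovered from
  \<open>x\<close> and \<open>x ^ i y ^ j\<close>.
\<close>

lemma basis_replace:
  assumes p: "prime p" and bas: "basis p n n x y" and j: "\<not> p dvd j"
  shows "basis p n n x (x [^] (i::nat) \<otimes> y [^] (j::nat))"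
proof -
  have xy: "x \<in> carrier G" "y \<in> carrier G" "x [^] (p ^ n) = \<one>" "y [^] (p ^ n) = \<one>"
    using bas basis_carrier[OF bas] by (auto simp: basis_def)
  let ?l = "x [^] i \<otimes> y [^] j"
  have "coprime j (p ^ n)"
    using j p by (metis coprime_commute coprime_power_right_iff prime_imp_coprime)
  then obtain m where m: "[j * m = 1] (mod p ^ n)" using cong_solve_coprime_nat by fastforce
  have lm: "?l [^] m = x [^] (i * m) \<otimes> y"
    using xy pow_cong[OF xy(2,4) m] by (simp add: pow_mult_distrib[OF m_comm] nat_pow_pow)
  have "y = x [^] ((order G - 1) * (i * m)) \<otimes> (x [^] (i * m) \<otimes> y)"
  proof -
    have "x [^] ((order G - 1) * (i * m)) \<otimes> x [^] (i * m) = x [^] (order G * (i * m))"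
      using xy order_pos by (simp add: nat_pow_mult algebra_simps)
    also have "\<dots> = \<one>" using xy pow_order_eq_1[OF xy(1)] by (simp flip: nat_pow_pow)
    finally show ?thesis using xy by (simp add: m_assoc[symmetric])
  qed
  then have "spans x ?l" using bas xy lm
    by (intro spans_change[of x y ?l "(order G - 1) * (i * m)" m]) (auto simp: basis_def)
  moreover have "?l [^] (p ^ n) = (x [^] (p ^ n)) [^] i \<otimes> (y [^] (p ^ n)) [^] j"
    using xy(1,2) by (simp add: pow_mult_distrib[OF m_comm] nat_pow_pow mult.commute)
  ultimately show ?thesis using bas xy by (simp add: basis_def)
qed

lemma iso_Zpn2:
  assumes p: "prime p" and bas: "basis p n n x y"
  shows "G \<cong> Zpn2 p n"
proof -
  have xy: "x \<in> carrier G" "y \<in> carrier G" "x [^] (p ^ n) = \<one>" "y [^] (p ^ n) = \<one>"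
    using bas basis_carrier[OF bas] by (auto simp: basis_def)
  have pn: "p ^ n > 0" using prime_gt_0_nat[OF p] by simp
  let ?f = "\<lambda>(i, j). x [^] nat i \<otimes> y [^] nat j"
  have carr: "carrier (Zpn2 p n) = {0..<int (p ^ n)} \<times> {0..<int (p ^ n)}"
    using prime_gt_0_nat[OF p] by (simp add: Zpn2_def carrier_integer_mod_group)
  have add: "z [^] nat ((i + i') mod int (p ^ n)) = z [^] nat i \<otimes> z [^] nat i'"
    if "z \<in> carrier G" "z [^] (p ^ n) = \<one>" "0 \<le> i" "0 \<le> i'" for z i i'
  proof -
    have "nat ((i + i') mod int (p ^ n)) = (nat i + nat i') mod (p ^ n)"
      using that(3,4) pn by (simp add: nat_mod_distrib nat_add_distrib nat_power_eq)
    then have "[nat ((i + i') mod int (p ^ n)) = nat i + nat i'] (mod p ^ n)" by (simp add: cong_def)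
    then show ?thesis using pow_cong[OF that(1,2)] that(1) by (simp add: nat_pow_mult)
  qed
  have hom: "?f \<in> hom (Zpn2 p n) G"
  proof (rule homI)
    fix P Q assume PQ: "P \<in> carrier (Zpn2 p n)" "Q \<in> carrier (Zpn2 p n)"
    obtain i j i' j' where ij: "P = (i, j)" "Q = (i', j')" by fastforce
    have "?f (P \<otimes>\<^bsub>Zpn2 p n\<^esub> Q) = x [^] nat ((i + i') mod int (p ^ n)) \<otimes> y [^] nat ((j + j') mod int (p ^ n))"
      by (simp add: ij Zpn2_def)
    also have "\<dots> = (x [^] nat i \<otimes> x [^] nat i') \<otimes> (y [^] nat j \<otimes> y [^] nat j')"
      using PQ xy by (simp only: add carr ij mem_Sigma_iff atLeastLessThan_iff)
    also have "\<dots> = ?f P \<otimes> ?f Q" using xy by (simp add: ij m_ac)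
    finally show "?f (P \<otimes>\<^bsub>Zpn2 p n\<^esub> Q) = ?f P \<otimes> ?f Q" .
  qed (use xy in \<open>auto simp: case_prod_unfold\<close>)
  have img: "?f ` carrier (Zpn2 p n) = carrier G"
  proof (intro equalityI subsetI)
    fix z assume "z \<in> carrier G"
    then have "z \<in> (\<lambda>(i, j). x [^] i \<otimes> y [^] j) ` ({..<p ^ n} \<times> {..<p ^ n})"
      using spans_image[of x y "p ^ n" "p ^ n"] bas pn by (simp add: basis_def)
    then obtain i j where "i < p ^ n" "j < p ^ n" "z = x [^] i \<otimes> y [^] j" by auto
    then show "z \<in> ?f ` carrier (Zpn2 p n)"
      unfolding carr by (intro image_eqI[of _ _ "(int i, int j)"]) (auto simp flip: of_nat_power)
  qed (use xy in auto)
  have "card (?f ` carrier (Zpn2 p n)) = card (carrier (Zpn2 p n))"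
    unfolding img using bas by (simp add: carr order_def[symmetric] basis_def card_cartesian_product power_add nat_power_eq)
  then have "inj_on ?f (carrier (Zpn2 p n))"
    by (intro eq_card_imp_inj_on) (simp_all add: carr)
  then have "?f \<in> iso (Zpn2 p n) G" using hom img by (simp add: iso_def bij_betw_def)
  then have "Zpn2 p n \<cong> G" by (auto simp: is_iso_def)
  then show ?thesis by (rule group.iso_sym[OF group_Zpn2])
qed

context
  fixes p a b :: nat and x y :: 'a
  assumes p: "prime p" and bas: "basis p a b x y" and a: "a \<ge> 1"
begin

lemmas xy = conjunct1[OF basis_carrier[OF bas]] conjunct2[OF basis_carrier[OF bas]]

text \<open>
  A generator of the subgroup of order \<open>p\<close> of \<open>\<langle>x\<rangle>\<close>. Its powers represent the elements of order
  dividing \<open>p\<close> in the cyclic quotient by \<open>\<langle>y\<rangle>\<close>.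
\<close>

definition socle_gen :: 'a where "socle_gen = x [^] (p ^ (a - 1))"

lemma socle_gen_closed: "socle_gen \<in> carrier G" using xy by (simp add: socle_gen_def)

lemma socle_gen_pow: "socle_gen [^] (k::nat) = x [^] (p ^ (a - 1) * k)"
  using xy by (simp add: socle_gen_def nat_pow_pow)

lemma socle_gen_pow_p: "socle_gen [^] p = \<one>"
  using bas unfolding socle_gen_pow power_split_last[OF a, of p, symmetric] by (simp add: basis_def)

lemma socle_gen_pow_in_iff: "socle_gen [^] k \<in> cyc y \<longleftrightarrow> p dvd (k::nat)"
proof
  assume "socle_gen [^] k \<in> cyc y"
  then obtain j :: nat where "x [^] (p ^ (a - 1) * k) = y [^] j"
    using cyc_eq[OF xy(2)] by (auto simp: socle_gen_pow)
  then have "x [^] (p ^ (a - 1) * k) \<otimes> y [^] (0::nat) = x [^] (0::nat) \<otimes> y [^] j" using xy by simp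
  then have "p ^ a dvd p ^ (a - 1) * k"
    using basis_eq_iff[OF p bas, of "p ^ (a - 1) * k" 0 0 j] by (simp add: cong_0_iff)
  then have "p ^ (a - 1) * p dvd p ^ (a - 1) * k" unfolding power_split_last[OF a, of p] .
  then show "p dvd k" using prime_gt_0_nat[OF p] by simp
next
  assume "p dvd k"
  then obtain j where "k = p * j" by auto
  then have "socle_gen [^] k = (socle_gen [^] p) [^] j" using socle_gen_closed by (simp add: nat_pow_pow)
  then show "socle_gen [^] k \<in> cyc y" using socle_gen_pow_p by (simp add: generate.one)
qed

lemma socle_gen_neq_one: "socle_gen \<noteq> \<one>"
proof
  assume "socle_gen = \<one>"
  then have "socle_gen [^] (1::nat) \<in> cyc y" by (simp add: generate.one)
  then have "p dvd 1" using socle_gen_pow_in_iff by blast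
  then show False using p by (metis not_prime_unit)
qed

lemma coprime_order_iff: "coprime t (order G) \<longleftrightarrow> \<not> p dvd t"
proof -
  have "coprime t p \<longleftrightarrow> \<not> p dvd t"
    using coprime_common_divisor_nat[of t p p] prime_imp_coprime[OF p, of t] p
    by (auto simp: coprime_commute)
  moreover have "order G = p ^ (a + b)" "a + b > 0" using bas a by (auto simp: basis_def)
  ultimately show ?thesis by (auto simp: coprime_power_right_iff)
qed

end

context
  fixes p n :: nat and g h :: 'a
  assumes p: "prime p" and n: "n \<ge> 1" and gh: "basis p n n g h"
begin

lemma p_dvd_order: "p dvd order G"
  using gh n by (simp add: basis_def)

lemma card_socle_le: "card (fibre p \<one>) \<le> p\<^sup>2"
  using gh prime_gt_0_nat[OF p] basis_carrier[OF gh]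
  by (intro card_fibre_le[of g h]) (simp_all add: basis_def spans_def)

text \<open>
  The elements of order dividing \<open>p\<close> number at most \<open>p\<^sup>2\<close>, and the socles of \<open>\<langle>w\<rangle>\<close> and \<open>\<langle>l\<rangle>\<close>
  already provide \<open>p\<^sup>2\<close> of them.
\<close>

lemma socle_eq:
  assumes bas: "basis p n n w l"
  defines "v \<equiv> socle_gen p n w" and "u \<equiv> socle_gen p n l"
  shows "inj_on (\<lambda>(k, j). v [^] k \<otimes> u [^] j) ({..<p} \<times> {..<p})"
    and "(\<lambda>(k, j). v [^] k \<otimes> u [^] j) ` ({..<p} \<times> {..<p}) = fibre p \<one>"
proof -
  have bas': "basis p n n l w" using bas by (rule basis_commute)
  note vpow = socle_gen_pow[OF p bas n] and upow = socle_gen_pow[OF p bas' n]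
  have vu: "v \<in> carrier G" "u \<in> carrier G" "v [^] p = \<one>" "u [^] p = \<one>"
    using socle_gen_closed[OF p bas n] socle_gen_closed[OF p bas' n]
      socle_gen_pow_p[OF p bas n] socle_gen_pow_p[OF p bas' n] by (auto simp: v_def u_def)
  show inj: "inj_on (\<lambda>(k, j). v [^] k \<otimes> u [^] j) ({..<p} \<times> {..<p})"
  proof (rule inj_onI)
    fix P Q assume PQ: "P \<in> {..<p} \<times> {..<p}" "Q \<in> {..<p} \<times> {..<p}"
      "(case P of (k, j) \<Rightarrow> v [^] k \<otimes> u [^] j) = (case Q of (k, j) \<Rightarrow> v [^] k \<otimes> u [^] j)"
    obtain k j k' j' where kj: "P = (k, j)" "Q = (k', j')" by fastforce
    have lt: "k < p" "j < p" "k' < p" "j' < p" using PQ kj by auto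
    have "w [^] (p ^ (n - 1) * k) \<otimes> l [^] (p ^ (n - 1) * j) = w [^] (p ^ (n - 1) * k') \<otimes> l [^] (p ^ (n - 1) * j')"
      using PQ(3) unfolding kj by (simp add: v_def u_def vpow upow)
    then have c: "[p ^ (n - 1) * k = p ^ (n - 1) * k'] (mod p ^ n)" "[p ^ (n - 1) * j = p ^ (n - 1) * j'] (mod p ^ n)"
      using basis_eq_iff[OF p bas] by blast+
    have eq: "i = i'" if "[p ^ (n - 1) * i = p ^ (n - 1) * i'] (mod p ^ n)" "i < p" "i' < p" for i i'
    proof -
      have "(p ^ (n - 1) * i) mod (p ^ (n - 1) * p) = (p ^ (n - 1) * i') mod (p ^ (n - 1) * p)"
        using that(1) unfolding cong_def power_split_last[OF n, of p] .
      then have "p ^ (n - 1) * (i mod p) = p ^ (n - 1) * (i' mod p)" by (simp only: mult_mod_right)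
      then show ?thesis using that(2,3) prime_gt_0_nat[OF p] by simp
    qed
    show "P = Q" using eq[OF c(1)] eq[OF c(2)] lt kj by simp
  qed
  have "(\<lambda>(k, j). v [^] k \<otimes> u [^] j) ` ({..<p} \<times> {..<p}) \<subseteq> fibre p \<one>"
  proof clarify
    fix k j :: nat
    have "(v [^] k \<otimes> u [^] j) [^] p = (v [^] p) [^] k \<otimes> (u [^] p) [^] j"
      using vu(1,2) by (simp add: pow_mult_distrib[OF m_comm] nat_pow_pow mult.commute)
    then show "v [^] k \<otimes> u [^] j \<in> fibre p \<one>" using vu by (simp add: fibre_def)
  qed
  moreover have "card (fibre p \<one>) \<le> card ((\<lambda>(k, j). v [^] k \<otimes> u [^] j) ` ({..<p} \<times> {..<p}))"
    unfolding card_image[OF inj] using card_socle_le by (simp add: card_cartesian_product power2_eq_square)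
  ultimately show "(\<lambda>(k, j). v [^] k \<otimes> u [^] j) ` ({..<p} \<times> {..<p}) = fibre p \<one>"
    by (intro card_seteq) auto
qed

lemma card_socle: "card (fibre p \<one>) = p\<^sup>2"
  using socle_eq[OF gh] by (metis card_image card_cartesian_product card_lessThan power2_eq_square)

text \<open>
  Divide both exponents of \<open>u\<close> by the largest common power of \<open>p\<close>; one of the quotients is
  prime to \<open>p\<close>, so the resulting element belongs to a basis.
\<close>

lemma primitive_vector:
  assumes "u \<in> carrier G" "u \<noteq> \<one>"
  obtains w l s where "basis p n n w l" "u = l [^] (p ^ s)"
proof -
  obtain i j :: nat where ij: "u = g [^] i \<otimes> h [^] j"
    using gh assms(1) by (auto simp: basis_def spans_def)
  have gc: "g \<in> carrier G" "h \<in> carrier G" using basis_carrier[OF gh] by auto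
  let ?c = "gcd i j"
  have c0: "?c \<noteq> 0"
  proof
    assume "?c = 0"
    then have "i = 0" "j = 0" by auto
    then show False using ij assms(2) by simp
  qed
  obtain q where q: "?c = p ^ multiplicity p ?c * q" "\<not> p dvd q"
    using multiplicity_decompose'[OF c0, of p] p by (metis not_prime_unit mult.commute)
  define s where "s = multiplicity p ?c"
  have "p ^ s dvd i" "p ^ s dvd j" using q(1) unfolding s_def by (metis dvd_triv_left dvd_trans gcd_dvd1 gcd_dvd2)+
  then obtain i' j' where i': "i = p ^ s * i'" and j': "j = p ^ s * j'" by (auto elim!: dvdE)
  have "\<not> (p dvd i' \<and> p dvd j')"
  proof
    assume "p dvd i' \<and> p dvd j'"
    then have "p ^ s * p dvd ?c" using i' j' by (auto intro!: gcd_greatest mult_dvd_mono)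
    then have "p ^ s * p dvd p ^ s * q" using q(1) unfolding s_def by metis
    then show False using q(2) prime_gt_0_nat[OF p] by simp
  qed
  define l where "l = g [^] i' \<otimes> h [^] j'"
  have "u = l [^] (p ^ s)"
    using gc by (simp add: ij i' j' l_def pow_mult_distrib[OF m_comm] nat_pow_pow mult.commute)
  moreover have "\<exists>w. basis p n n w l"
  proof (cases "p dvd j'")
    case False
    then show ?thesis using basis_replace[OF p gh] by (auto simp: l_def)
  next
    case True
    then have "\<not> p dvd i'" using \<open>\<not> (p dvd i' \<and> p dvd j')\<close> by simp
    then have "basis p n n h (h [^] j' \<otimes> g [^] i')"
      by (rule basis_replace[OF p basis_commute[OF gh]])
    moreover have "h [^] j' \<otimes> g [^] i' = l" using gc by (simp add: l_def m_comm)
    ultimately show ?thesis by auto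
  qed
  ultimately show thesis using that by blast
qed

lemma cyc_unit_power:
  assumes "\<not> p dvd t" "x \<in> carrier G"
  shows "cyc (x [^] t) = cyc x"
proof -
  have ct: "coprime t (order G)" using coprime_order_iff[OF p gh n] assms(1) by simp
  obtain u :: nat where u: "(x [^] t) [^] u = x" using coprime_power_inverse[OF ct] assms(2) by metis
  have "x [^] t \<in> cyc x" using cyc_eq[OF assms(2)] by auto
  moreover have "x \<in> cyc (x [^] t)" using cyc_eq[of "x [^] t"] assms(2) u by (metis (mono_tags, lifting) mem_Collect_eq nat_pow_closed)
  ultimately show ?thesis using cyc_subset assms(2) by (metis nat_pow_closed subset_antisym)
qed

text \<open>
  Two generators of one cyclic subgroup are powers of each other, and an exponent divisible by \<open>p\<close>
  would lower the order. For the identity the exponent \<open>1\<close> is used.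
\<close>

lemma generator_power:
  assumes x: "x \<in> carrier G" "x' \<in> carrier G" "cyc x' = cyc x"
  obtains t where "\<not> p dvd t" "x' = x [^] t"
proof (cases "x = \<one>")
  case True
  then have "x' = \<one>" using x in_cyc_self[OF x(2)] generate_one by auto
  moreover have "\<not> p dvd 1" using p by (metis not_prime_unit)
  ultimately show thesis using that[of 1] True by simp
next
  case False
  obtain t :: nat where t: "x' = x [^] t" using in_cyc_self[OF x(2)] x cyc_eq[OF x(1)] by auto
  have "\<not> p dvd t"
  proof
    assume "p dvd t"
    then obtain r where r: "t = p * r" by auto
    obtain i where i: "ord x = p ^ i" using ord_prime_power[OF p _ x(1)] gh by (auto simp: basis_def)
    have "i \<noteq> 0" using False i ord_eq_1[OF x(1)] by (metis power_0)
    then have pi: "p ^ i = p ^ (i - 1) * p" by (cases i) auto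
    have "x' [^] (p ^ (i - 1)) = (x [^] (p ^ i)) [^] r"
      using x(1) unfolding t r pi by (simp add: nat_pow_pow mult_ac)
    also have "\<dots> = \<one>" using pow_ord_eq_1[OF x(1)] i by simp
    finally have "ord x' dvd p ^ (i - 1)" using pow_eq_id[OF x(2)] by blast
    moreover have "ord x' = p ^ i" using generate_pow_card x i by metis
    ultimately have "p ^ (i - 1) * p dvd p ^ (i - 1)" using pi by simp
    then show False using p prime_gt_0_nat[OF p] by (simp add: not_prime_unit)
  qed
  then show thesis using that t by blast
qed

text \<open>
  By \<open>primitive_vector\<close>, the elements of less than maximal order are exactly the \<open>p\<close>-th powers.
\<close>

lemma powers_if_level_less:
  assumes y: "y \<in> carrier G" and lev: "level p (cyc y) < n"
  shows "y \<in> powers p"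
proof (cases "y = \<one>")
  case True
  then show ?thesis using one_in_powers by simp
next
  case False
  obtain w l s where l: "basis p n n w l" "y = l [^] (p ^ s)"
    using primitive_vector[OF y False] by metis
  have lc: "l \<in> carrier G" using basis_carrier[OF l(1)] by simp
  have "s \<noteq> 0"
  proof
    assume "s = 0"
    then have "y = l" using l(2) lc by simp
    then have "level p (cyc y) = n" using level_cyc[OF p y] basis_ords(2)[OF p l(1)] by simp
    then show False using lev by simp
  qed
  then have "p ^ s = p ^ (s - 1) * p" by (cases s) auto
  then have "y = (l [^] (p ^ (s - 1))) [^] p" using l(2) lc by (simp add: nat_pow_pow)
  then show ?thesis using lc by (auto simp: powers_def)
qed

end

end

section \<open>Paley functions and the Frobenius congruence\<close>

text \<open>
  The equation \<open>conv\<close> is \<open>d * d = \<nu> e - \<Sigma>\<close> in the integral group ring, \<open>\<Sigma>\<close> being the sum of all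
  elements: the identity for the \<open>\<plusminus>1\<close> function of a Paley type partial difference set.
\<close>

locale paley = finite_abelian G for G (structure) +
  fixes d :: "'a \<Rightarrow> int"
  assumes odd_order: "odd (order G)"
    and d_one: "d \<one> = 0"
    and d_vals: "\<lbrakk>x \<in> carrier G; x \<noteq> \<one>\<rbrakk> \<Longrightarrow> d x = 1 \<or> d x = -1"
    and d_inv: "x \<in> carrier G \<Longrightarrow> d (inv x) = d x"
    and conv: "z \<in> carrier G \<Longrightarrow>
      (\<Sum>x\<in>carrier G. d x * d (inv x \<otimes> z)) = (if z = \<one> then int (order G) else 0) - 1"
begin

lemma d_abs_le: "x \<in> carrier G \<Longrightarrow> \<bar>d x\<bar> \<le> 1"
  using d_vals[of x] d_one by (cases "x = \<one>") auto

lemma d_nonzero: "\<lbrakk>x \<in> carrier G; x \<noteq> \<one>\<rbrakk> \<Longrightarrow> d x \<noteq> 0"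
  using d_vals by fastforce

text \<open>
  Applying the augmentation to \<open>d * d = \<nu> e - \<Sigma>\<close> gives \<open>(\<Sum> d)\<^sup>2 = \<nu> - \<nu> = 0\<close>.
\<close>

lemma sum_d: "(\<Sum>x\<in>carrier G. d x) = 0"
proof -
  have "(\<Sum>x\<in>carrier G. d x) * (\<Sum>x\<in>carrier G. d x)
      = (\<Sum>x\<in>carrier G. d x * (\<Sum>z\<in>carrier G. d (inv x \<otimes> z)))"
    by (simp add: sum_distrib_right sum_translate)
  also have "\<dots> = (\<Sum>z\<in>carrier G. \<Sum>x\<in>carrier G. d x * d (inv x \<otimes> z))"
    by (simp add: sum_distrib_left, rule sum.swap)
  also have "\<dots> = (\<Sum>z\<in>carrier G. (if z = \<one> then int (order G) else 0) - 1)"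
    by (intro sum.cong) (auto simp: conv)
  also have "\<dots> = 0" using fin
    by (simp add: sum_subtractf sum.delta order_def)
  finally show ?thesis by simp
qed

lemma correlation:
  assumes u: "u \<in> carrier G"
  shows "(\<Sum>x\<in>carrier G. d x * d (x \<otimes> u)) = (if u = \<one> then int (order G) else 0) - 1"
proof -
  have "(\<Sum>x\<in>carrier G. d x * d (x \<otimes> u)) = (\<Sum>x\<in>carrier G. d (inv x) * d (inv x \<otimes> u))"
    by (rule sum_invert[symmetric])
  also have "\<dots> = (\<Sum>x\<in>carrier G. d x * d (inv x \<otimes> u))"
    by (intro sum.cong) (auto simp: d_inv)
  finally show ?thesis using conv[OF u] by simp
qed

primrec conv_power :: "nat \<Rightarrow> 'a \<Rightarrow> int" where
  "conv_power 0 z = (if z = \<one> then 1 else 0)"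
| "conv_power (Suc n) z = (\<Sum>x\<in>carrier G. d x * conv_power n (inv x \<otimes> z))"

text \<open>
  Convolution with \<open>d * d = \<nu> e - \<Sigma>\<close> multiplies a function of sum zero by \<open>\<nu>\<close>.
\<close>

lemma conv_power_odd: "z \<in> carrier G \<Longrightarrow> conv_power (2 * k + 1) z = int (order G) ^ k * d z"
proof (induction k arbitrary: z)
  case 0
  have "conv_power (2 * 0 + 1) z = (\<Sum>x\<in>carrier G. if x = z then d x else 0)"
    unfolding One_nat_def mult_0_right add_0 conv_power.simps
    by (rule sum.cong) (use 0 in \<open>auto simp: inv_solve_left'\<close>)
  then show ?case using 0 fin by simp
next
  case (Suc k)
  define F where "F = conv_power (2 * k + 1)"
  have shift: "(\<Sum>y\<in>carrier G. d y * F (inv y \<otimes> (inv x \<otimes> z)))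
      = (\<Sum>c\<in>carrier G. d (inv x \<otimes> c) * F (inv c \<otimes> z))" if x: "x \<in> carrier G" for x
  proof -
    have "inv (inv x \<otimes> c) \<otimes> (inv x \<otimes> z) = inv c \<otimes> z" if c: "c \<in> carrier G" for c
    proof -
      have "inv (inv x \<otimes> c) \<otimes> (inv x \<otimes> z) = (x \<otimes> inv x) \<otimes> (inv c \<otimes> z)"
        using x c Suc.prems by (simp only: inv_mult inv_inv inv_closed m_closed m_ac)
      then show ?thesis using x c Suc.prems by simp
    qed
    then have "(\<Sum>c\<in>carrier G. d (inv x \<otimes> c) * F (inv (inv x \<otimes> c) \<otimes> (inv x \<otimes> z)))
        = (\<Sum>c\<in>carrier G. d (inv x \<otimes> c) * F (inv c \<otimes> z))"
      by (intro sum.cong refl) metis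
    moreover have "(\<Sum>c\<in>carrier G. d (inv x \<otimes> c) * F (inv (inv x \<otimes> c) \<otimes> (inv x \<otimes> z)))
        = (\<Sum>y\<in>carrier G. d y * F (inv y \<otimes> (inv x \<otimes> z)))"
      using x by (intro sum_translate) auto
    ultimately show ?thesis by simp
  qed
  have eq: "2 * Suc k + 1 = Suc (Suc (2 * k + 1))" by simp
  have "conv_power (2 * Suc k + 1) z
      = (\<Sum>x\<in>carrier G. d x * (\<Sum>y\<in>carrier G. d y * F (inv y \<otimes> (inv x \<otimes> z))))"
    unfolding F_def by (subst eq) (simp only: conv_power.simps)
  also have "\<dots> = (\<Sum>x\<in>carrier G. d x * (\<Sum>c\<in>carrier G. d (inv x \<otimes> c) * F (inv c \<otimes> z)))"
    by (intro sum.cong refl) (simp only: shift)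
  also have "\<dots> = (\<Sum>c\<in>carrier G. (\<Sum>x\<in>carrier G. d x * d (inv x \<otimes> c)) * F (inv c \<otimes> z))"
    by (simp add: sum_distrib_left sum_distrib_right mult.assoc, rule sum.swap)
  also have "\<dots> = (\<Sum>c\<in>carrier G. ((if c = \<one> then int (order G) else 0) - 1) * F (inv c \<otimes> z))"
    by (intro sum.cong) (auto simp: conv)
  also have "\<dots> = int (order G) * F z - (\<Sum>c\<in>carrier G. F (inv c \<otimes> z))"
    using fin Suc.prems
    by (simp add: left_diff_distrib sum_subtractf if_distrib[of "\<lambda>x. x * _"] sum.delta cong: if_cong)
  also have "(\<Sum>c\<in>carrier G. F (inv c \<otimes> z)) = (\<Sum>c\<in>carrier G. F (c \<otimes> z))"
    by (rule sum_invert[of "\<lambda>c. F (c \<otimes> z)"])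
  also have "\<dots> = (\<Sum>c\<in>carrier G. F (z \<otimes> c))"
    using Suc.prems by (intro sum.cong) (auto simp: m_comm)
  also have "\<dots> = (\<Sum>c\<in>carrier G. F c)" using Suc.prems by (rule sum_translate)
  also have "\<dots> = (\<Sum>c\<in>carrier G. int (order G) ^ k * d c)"
    unfolding F_def by (intro sum.cong refl Suc.IH)
  also have "\<dots> = 0" by (simp add: sum_d flip: sum_distrib_left)
  also have "F z = int (order G) ^ k * d z" unfolding F_def by (rule Suc.IH[OF Suc.prems])
  finally show ?case by simp
qed

definition tuples :: "nat \<Rightarrow> 'a \<Rightarrow> 'a list set" where
  "tuples n z = {xs. length xs = n \<and> set xs \<subseteq> carrier G \<and> foldr (\<otimes>) xs \<one> = z}"

lemma finite_tuples: "finite (tuples n z)"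
  by (rule finite_subset[OF _ finite_lists_length_eq[OF fin, of n]]) (auto simp: tuples_def)

lemma foldr_closed: "set xs \<subseteq> carrier G \<Longrightarrow> foldr (\<otimes>) xs \<one> \<in> carrier G"
  by (induction xs) auto

lemma foldr_snoc:
  "\<lbrakk>set xs \<subseteq> carrier G; x \<in> carrier G\<rbrakk> \<Longrightarrow> foldr (\<otimes>) (xs @ [x]) \<one> = x \<otimes> foldr (\<otimes>) xs \<one>"
  using foldr_closed by (induction xs) (auto simp: m_ac)

lemma foldr_replicate_pow: "x \<in> carrier G \<Longrightarrow> foldr (\<otimes>) (replicate n x) \<one> = x [^] n"
  by (induction n) (simp_all add: m_comm del: foldr_replicate)

lemma conv_power_eq_sum_tuples:
  "z \<in> carrier G \<Longrightarrow> conv_power n z = (\<Sum>xs\<in>tuples n z. prod_list (map d xs))"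
proof (induction n arbitrary: z)
  case 0
  have "tuples 0 z = (if z = \<one> then {[]} else {})" by (auto simp: tuples_def)
  then show ?case by simp
next
  case (Suc n)
  have eq: "tuples (Suc n) z = (\<Union>x\<in>carrier G. (#) x ` tuples n (inv x \<otimes> z))"
    unfolding tuples_def using Suc.prems
    by (auto simp: length_Suc_conv image_iff inv_solve_left' foldr_closed m_assoc[symmetric])
  have "(\<Sum>xs\<in>tuples (Suc n) z. prod_list (map d xs))
      = (\<Sum>x\<in>carrier G. \<Sum>xs\<in>(#) x ` tuples n (inv x \<otimes> z). prod_list (map d xs))"
    unfolding eq by (rule sum.UNION_disjoint) (auto simp: fin finite_tuples)
  also have "\<dots> = (\<Sum>x\<in>carrier G. \<Sum>xs\<in>tuples n (inv x \<otimes> z). d x * prod_list (map d xs))"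
    by (rule sum.cong[OF refl], subst sum.reindex) auto
  also have "\<dots> = conv_power (Suc n) z"
    using Suc by (simp add: sum_distrib_left)
  finally show ?case by simp
qed

text \<open>
  The Frobenius congruence in the group ring: the \<open>q\<close>-th convolution power counts weighted
  \<open>q\<close>-tuples with product \<open>z\<close>. Rotating the tuples, only the constant ones survive modulo \<open>q\<close>, and
  these are the \<open>q\<close>-th roots of \<open>z\<close>, each with weight \<open>d x ^ q = d x\<close>.
\<close>

lemma frobenius:
  assumes q: "prime q" "odd q" and z: "z \<in> carrier G"
  shows "int q dvd int (order G) ^ ((q - 1) div 2) * d z - (\<Sum>x\<in>fibre q z. d x)"
proof -
  have q2: "2 * ((q - 1) div 2) + 1 = q" using q(2) by (cases q) auto
  have d_pow: "d x ^ q = d x" if "x \<in> carrier G" for x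
    using that d_vals[of x] d_one q by (cases "x = \<one>") (auto simp: prime_gt_0_nat)
  have "int q dvd (\<Sum>xs\<in>tuples q z. prod_list (map d xs))
      - (\<Sum>xs | xs \<in> tuples q z \<and> rotate1 xs = xs. prod_list (map d xs))"
  proof (rule prime_dvd_sum_minus_fixpoints[OF q(1) finite_tuples])
    fix xs assume xs: "xs \<in> tuples q z"
    then obtain y ys where y: "xs = y # ys"
      using prime_gt_0_nat[OF q(1)] by (cases xs) (auto simp: tuples_def)
    show "rotate1 xs \<in> tuples q z"
      using xs by (auto simp: tuples_def y foldr_snoc simp del: foldr_append)
    show "(rotate1 ^^ q) xs = xs"
      using xs by (simp add: tuples_def rotate_id flip: rotate_def)
    show "prod_list (map d (rotate1 xs)) = prod_list (map d xs)" by (simp add: y)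
  qed
  moreover have "{xs. xs \<in> tuples q z \<and> rotate1 xs = xs} = replicate q ` fibre q z"
  proof (intro equalityI subsetI)
    fix xs assume "xs \<in> {xs. xs \<in> tuples q z \<and> rotate1 xs = xs}"
    then have xs: "xs \<in> tuples q z" "rotate1 xs = xs" by auto
    moreover have "xs \<noteq> []" using xs prime_gt_0_nat[OF q(1)] by (auto simp: tuples_def)
    ultimately obtain y where "set xs = {y}"
      using rotate1_fixpoint_card card_1_singletonE by metis
    then have eq: "replicate q y = xs"
      using xs replicate_length_same[of xs y] by (auto simp: tuples_def)
    moreover have "y \<in> fibre q z"
      using xs(1) \<open>set xs = {y}\<close> unfolding eq[symmetric] by (auto simp: tuples_def fibre_def foldr_replicate_pow simp del: foldr_replicate)
    ultimately show "xs \<in> replicate q ` fibre q z" by blast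
  next
    fix xs assume "xs \<in> replicate q ` fibre q z"
    then show "xs \<in> {xs. xs \<in> tuples q z \<and> rotate1 xs = xs}"
      using prime_gt_0_nat[OF q(1)]
      by (auto simp: tuples_def fibre_def foldr_replicate_pow simp del: foldr_replicate)
  qed
  moreover have "(\<Sum>xs\<in>replicate q ` fibre q z. prod_list (map d xs)) = (\<Sum>x\<in>fibre q z. d x)"
    using prime_gt_0_nat[OF q(1)] 
    by (subst sum.reindex) (auto simp: inj_on_def replicate_eq_replicate prod_list_replicate d_pow fibre_def intro!: sum.cong)
  ultimately show ?thesis
    using conv_power_odd[OF z, of "(q - 1) div 2"] conv_power_eq_sum_tuples[OF z, of q]
    unfolding q2 by simp
qed

section \<open>Multipliers\<close>

definition multiplier :: "nat \<Rightarrow> int \<Rightarrow> bool" where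
  "multiplier t s \<longleftrightarrow> (s = 1 \<or> s = -1) \<and> (\<forall>x\<in>carrier G. d (x [^] t) = s * d x)"

text \<open>
  By Fermat, \<open>\<nu> ^ ((q - 1) / 2)\<close> is congruent to a sign modulo \<open>q\<close>. The two sides of the Frobenius
  congruence are then integers in \<open>{-1, 0, 1}\<close> that agree modulo \<open>q \<ge> 3\<close>.
\<close>

lemma multiplier_prime:
  assumes q: "prime q" "odd q" "\<not> q dvd order G"
  shows "\<exists>s. multiplier q s"
proof -
  define h where "h = (q - 1) div 2"
  have h: "2 * h = q - 1" unfolding h_def using q(2) by auto
  have q3: "q \<ge> 3" using prime_ge_2_nat[OF q(1)] q(2) by (cases "q = 2") auto
  have "[order G ^ (q - 1) = 1] (mod q)" by (rule fermat_theorem[OF q(1,3)])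
  then have "[int (order G ^ (q - 1)) = int 1] (mod int q)" by (simp only: cong_int_iff)
  moreover have "int (order G ^ (q - 1)) = (int (order G) ^ h)\<^sup>2"
    by (simp only: h[symmetric] of_nat_power power_mult[symmetric] mult.commute[of 2 h])
  ultimately have "[(int (order G) ^ h)\<^sup>2 = 1] (mod int q)" by simp
  then have "int q dvd (int (order G) ^ h)\<^sup>2 - 1" by (simp add: cong_iff_dvd_diff)
  also have "(int (order G) ^ h)\<^sup>2 - 1 = (int (order G) ^ h - 1) * (int (order G) ^ h + 1)"
    by (simp add: algebra_simps power2_eq_square)
  finally have "int q dvd int (order G) ^ h - 1 \<or> int q dvd int (order G) ^ h + 1"
    using q(1) by (simp add: prime_dvd_mult_iff)
  then obtain s :: int where s: "s = 1 \<or> s = -1" "int q dvd int (order G) ^ h - s"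
    by (metis diff_minus_eq_add)
  have "d (x [^] q) = s * d x" if x: "x \<in> carrier G" for x
  proof -
    let ?y = "x [^] q"
    have cop: "coprime q (order G)" using q prime_imp_coprime by blast
    have "fibre q ?y = {x}"
      using x coprime_power_inj[OF cop] by (auto simp: fibre_def)
    then have "int q dvd int (order G) ^ h * d ?y - d x"
      using frobenius[OF q(1,2), of ?y] x by (simp add: h_def)
    moreover have "int q dvd (int (order G) ^ h - s) * d ?y" using s(2) by simp
    ultimately have "int q dvd (int (order G) ^ h * d ?y - d x) - (int (order G) ^ h - s) * d ?y"
      by (rule dvd_diff)
    then have "int q dvd s * d ?y - d x" by (simp add: algebra_simps)
    moreover have "\<bar>s * d ?y - d x\<bar> < int q"
      using d_abs_le[OF x] d_abs_le[of ?y] x s(1) q3 by auto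
    ultimately have "s * d ?y - d x = 0" by (metis dvd_imp_le_int abs_of_nat not_le)
    then show ?thesis using s(1) by auto
  qed
  then show ?thesis using s(1) by (auto simp: multiplier_def)
qed

lemma multiplier_mult:
  assumes "multiplier t s" "multiplier t' s'"
  shows "multiplier (t * t') (s * s')"
  using assms by (auto simp: multiplier_def simp flip: nat_pow_pow)

text \<open>
  Odd exponents are products of odd primes not dividing \<open>\<nu>\<close>. For an even exponent, adding the odd
  number \<open>\<nu>\<close> changes the parity and leaves the power map as it is.
\<close>

lemma multiplier_exists:
  assumes "coprime t (order G)"
  shows "\<exists>s. multiplier t s"
proof -
  have odd_case: "odd t \<and> coprime t (order G) \<longrightarrow> (\<exists>s. multiplier t s)" for t :: nat
  proof (induction t rule: prime_divisors_induct)
    case (unit t)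
    have "multiplier 1 1" by (auto simp: multiplier_def)
    then show ?case using unit by auto
  next
    case (factor q t)
    show ?case
    proof
      assume *: "odd (q * t) \<and> coprime (q * t) (order G)"
      then have "\<not> q dvd order G" using factor(1)
        by (metis coprime_common_divisor_nat coprime_mult_left_iff dvd_refl not_prime_1)
      then obtain s where "multiplier q s" using multiplier_prime factor(1) * by auto
      moreover obtain s' where "multiplier t s'" using factor(2) * by auto
      ultimately show "\<exists>s. multiplier (q * t) s" using multiplier_mult by blast
    qed
  qed auto
  show ?thesis
  proof (cases "odd t")
    case True
    then show ?thesis using odd_case assms by blast
  next
    case False
    then have "odd (t + order G)" using odd_order by simp
    moreover have "coprime (t + order G) (order G)" using assms by (simp add: coprime_iff_gcd_eq_1)
    ultimately obtain s where "multiplier (t + order G) s" using odd_case by blast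
    moreover have "x [^] (t + order G) = x [^] t" if "x \<in> carrier G" for x
      by (rule pow_cong_order[OF that]) (simp add: cong_def)
    ultimately have "multiplier t s" by (simp add: multiplier_def)
    then show ?thesis ..
  qed
qed

text \<open>
  The sign of an exponent can be read off at any nonidentity element, for instance at one that
  the power map fixes.
\<close>

lemma multiplier_cong_one:
  assumes "multiplier t s" "x \<in> carrier G" "x \<noteq> \<one>" "x [^] k = \<one>" "[t = 1] (mod k)"
  shows "s = 1"
proof -
  have "x [^] t = x" using pow_cong[OF assms(2,4,5)] assms(2) by simp
  then have "d x = s * d x" using assms(1,2) unfolding multiplier_def by metis
  then show ?thesis using d_nonzero[OF assms(2,3)] by (metis mult_cancel_right1)
qed

text \<open>
  The sign of \<open>t\<close> is seen on elements of order \<open>r\<close>. Replacing \<open>t\<close> by an exponent that agrees with \<open>t\<close>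
  modulo \<open>r\<close> and is \<open>1\<close> modulo \<open>r'\<close> does not change it, and elements of order \<open>r'\<close> show that it is \<open>1\<close>.
\<close>

lemma multiplier_one_if_two_primes:
  assumes r: "prime r" "r dvd order G" "prime r'" "r' dvd order G" "r' \<noteq> r"
    and t: "coprime t (order G)" "multiplier t s"
  shows "s = 1"
proof -
  obtain x where x: "x \<in> carrier G" "x \<noteq> \<one>" "x [^] r = \<one>" using exists_prime_order r by blast
  obtain y where y: "y \<in> carrier G" "y \<noteq> \<one>" "y [^] r' = \<one>" using exists_prime_order r by blast
  have "\<not> r dvd t" using coprime_common_divisor_nat[OF t(1), of r] r(1,2) by auto
  then obtain t' where t': "coprime t' (order G)" "[t' = t] (mod r)" "[t' = 1] (mod r')"
    using crt_unit[OF r(1,2)] r(3-5) by metis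
  obtain s' where s': "multiplier t' s'" using multiplier_exists[OF t'(1)] ..
  have "s' = 1" using multiplier_cong_one[OF s' y t'(3)] .
  then have "d (x [^] t') = d x" using s' x(1) by (simp add: multiplier_def)
  moreover have "d (x [^] t) = s * d x" using t(2) x(1) by (simp add: multiplier_def)
  ultimately have "d x = s * d x" using pow_cong[OF x(1,3) t'(2)] by simp
  then show ?thesis using d_nonzero[OF x(1,2)] by (metis mult_cancel_right1)
qed

text \<open>
  Equivalently, the set where \<open>d = 1\<close> is a union of sets of generators of cyclic subgroups.
\<close>

definition rational :: bool where
  "rational \<longleftrightarrow> (\<forall>t s. coprime t (order G) \<longrightarrow> multiplier t s \<longrightarrow> s = 1)"

lemma rationalD: "\<lbrakk>rational; coprime t (order G); multiplier t s\<rbrakk> \<Longrightarrow> s = 1"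
  by (simp add: rational_def)

section \<open>Fibre sums of the q-th power map\<close>

definition fibre_sum :: "nat \<Rightarrow> 'a \<Rightarrow> int" where
  "fibre_sum q z = (\<Sum>x\<in>fibre q z. d x)"

definition coset_sum :: "'a set \<Rightarrow> 'a \<Rightarrow> int" where
  "coset_sum L z = (\<Sum>l\<in>L. d (z \<otimes> l))"

lemma fibre_sum_eq:
  assumes "x \<in> carrier G"
  shows "fibre_sum q (x [^] q) = coset_sum (fibre q \<one>) x"
  unfolding fibre_sum_def coset_sum_def fibre_eq_coset[OF assms]
  by (subst sum.reindex) (use assms in \<open>auto simp: inj_on_def fibre_def\<close>)

text \<open>
  The square of the push-forward of \<open>d\<close> is the push-forward of \<open>d * d\<close>; this is its coefficient at
  the identity.
\<close>

lemma sum_fibre_sum_squares: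
  "(\<Sum>z\<in>powers q. (fibre_sum q z)\<^sup>2) = int (order G) - int (card (fibre q \<one>))"
proof -
  have "(\<Sum>z\<in>powers q. (fibre_sum q z)\<^sup>2)
      = (\<Sum>z\<in>powers q. \<Sum>x | x \<in> carrier G \<and> x [^] q = z. d x * fibre_sum q (x [^] q))"
    by (intro sum.cong)
      (auto simp: power2_eq_square fibre_sum_def[of q "_::'a"] sum_distrib_right fibre_def intro!: sum.cong)
  also have "\<dots> = (\<Sum>x\<in>carrier G. d x * fibre_sum q (x [^] q))"
    by (rule sum.group) (auto simp: powers_def fin)
  also have "\<dots> = (\<Sum>x\<in>carrier G. \<Sum>c\<in>fibre q \<one>. d x * d (x \<otimes> c))"
    by (intro sum.cong) (auto simp: fibre_sum_eq coset_sum_def sum_distrib_left)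
  also have "\<dots> = (\<Sum>c\<in>fibre q \<one>. \<Sum>x\<in>carrier G. d x * d (x \<otimes> c))"
    by (rule sum.swap)
  also have "\<dots> = (\<Sum>c\<in>fibre q \<one>. (if c = \<one> then int (order G) else 0) - 1)"
    by (intro sum.cong) (auto simp: correlation fibre_def)
  also have "\<dots> = int (order G) - int (card (fibre q \<one>))"
    by (simp add: sum_subtractf sum.delta) (simp add: fibre_def)
  finally show ?thesis .
qed

lemma prime_dvd_fibre_sum:
  assumes q: "prime q" "q dvd order G" and z: "z \<in> carrier G"
  shows "int q dvd fibre_sum q z"
proof -
  have "odd q" using q odd_order by auto
  then have "(q - 1) div 2 > 0" using prime_ge_2_nat[OF q(1)] by (cases "q = 2") auto
  then have "int q dvd int (order G) ^ ((q - 1) div 2) * d z"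
    using q(2) by (metis dvd_mult2 dvd_power dvd_trans int_dvd_int_iff of_nat_power)
  then show ?thesis
    using frobenius[OF q(1) \<open>odd q\<close> z] dvd_diff_right_iff unfolding fibre_sum_def by blast
qed

text \<open>
  The fibre is a coset of the kernel, so it has an odd number of elements, and it does not contain
  the identity, where alone \<open>d\<close> is even.
\<close>

lemma odd_fibre_sum:
  assumes "z \<in> powers q" "z \<noteq> \<one>"
  shows "odd (fibre_sum q z)"
proof -
  have "odd (d x)" if "x \<in> fibre q z" for x
  proof -
    have "x \<noteq> \<one>" using that assms(2) by (auto simp: fibre_def)
    then show ?thesis using d_vals[of x] that by (auto simp: fibre_def)
  qed
  then have "{x \<in> fibre q z. odd (d x)} = fibre q z" by auto
  moreover have "odd (card (fibre q z))"
    using assms(1) card_fibre[of _ q] card_powers[of q] odd_order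
    by (metis (no_types, lifting) even_mult_iff image_iff powers_def)
  ultimately show ?thesis unfolding fibre_sum_def by (simp add: even_sum_iff)
qed

text \<open>
  Every fibre sum over a \<open>q\<close>-th power other than the identity is an odd multiple of \<open>q\<close>, so its
  square is at least \<open>q\<^sup>2\<close>. With \<open>P\<close> the set of \<open>q\<close>-th powers and \<open>\<omega> \<le> q\<^sup>2\<close> the order of the kernel, all
  the squares together sum to \<open>\<nu> - \<omega> = \<omega> (\<bar>P\<bar> - 1)\<close>. Hence all the inequalities are equalities.
\<close>

theorem fibre_sum_rigidity:
  assumes q: "prime q" "q dvd order G" and small: "card (fibre q \<one>) \<le> q\<^sup>2"
  shows "fibre_sum q \<one> = 0"
    and "\<And>z. \<lbrakk>z \<in> powers q; z \<noteq> \<one>\<rbrakk> \<Longrightarrow> \<bar>fibre_sum q z\<bar> = int q"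
    and "card (powers q) > 1 \<Longrightarrow> card (fibre q \<one>) = q\<^sup>2"
proof -
  define \<omega> where "\<omega> = card (fibre q \<one>)"
  have ge: "(fibre_sum q z)\<^sup>2 \<ge> (int q)\<^sup>2" if z: "z \<in> powers q - {\<one>}" for z
  proof -
    have "z \<in> carrier G" using z by (auto simp: powers_def)
    then have "int q dvd fibre_sum q z" using prime_dvd_fibre_sum q by blast
    moreover have "fibre_sum q z \<noteq> 0" using odd_fibre_sum[of z q] z by auto
    ultimately have "int q \<le> \<bar>fibre_sum q z\<bar>" by (metis dvd_abs_iff zdvd_imp_le zero_less_abs_iff)
    then show ?thesis by (simp add: abs_le_square_iff[symmetric])
  qed
  let ?e = "\<lambda>z. (fibre_sum q z)\<^sup>2 - (int q)\<^sup>2"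
  have card1: "card (powers q - {\<one>}) = card (powers q) - 1" "card (powers q) \<ge> 1"
    using one_in_powers finite_powers by (auto simp: Suc_le_eq card_gt_0_iff)
  have "(\<Sum>z\<in>powers q. (fibre_sum q z)\<^sup>2)
      = (fibre_sum q \<one>)\<^sup>2 + (\<Sum>z\<in>powers q - {\<one>}. (fibre_sum q z)\<^sup>2)"
    by (rule sum.remove[OF finite_powers one_in_powers])
  moreover have "int (order G) = int (card (powers q)) * int \<omega>"
    unfolding card_powers[of q, symmetric] \<omega>_def by simp
  ultimately have key: "(fibre_sum q \<one>)\<^sup>2 + (\<Sum>z\<in>powers q - {\<one>}. ?e z)
      = (int (card (powers q)) - 1) * (int \<omega> - (int q)\<^sup>2)"
    using sum_fibre_sum_squares[of q] card1
    by (simp add: sum_subtractf \<omega>_def algebra_simps of_nat_diff)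
  have "int \<omega> \<le> (int q)\<^sup>2" using small unfolding \<omega>_def by (metis of_nat_le_iff of_nat_power)
  then have rhs: "(int (card (powers q)) - 1) * (int \<omega> - (int q)\<^sup>2) \<le> 0"
    using card1 by (intro mult_nonneg_nonpos) auto
  have nonneg: "(\<Sum>z\<in>powers q - {\<one>}. ?e z) \<ge> 0" by (rule sum_nonneg) (use ge in auto)
  have sq: "(fibre_sum q \<one>)\<^sup>2 = 0" and se: "(\<Sum>z\<in>powers q - {\<one>}. ?e z) = 0"
    using key rhs nonneg zero_le_power2[of "fibre_sum q \<one>"] by linarith+
  show "fibre_sum q \<one> = 0" using sq by simp
  show "\<bar>fibre_sum q z\<bar> = int q" if "z \<in> powers q" "z \<noteq> \<one>" for z
  proof -
    have "?e z = 0" using se ge that finite_powers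
      by (subst (asm) sum_nonneg_eq_0_iff) auto
    then show ?thesis by (auto simp: power2_eq_iff)
  qed
  show "card (fibre q \<one>) = q\<^sup>2" if "card (powers q) > 1"
  proof -
    have "(int (card (powers q)) - 1) * (int \<omega> - (int q)\<^sup>2) = 0" using key sq se by simp
    then have "int \<omega> = (int q)\<^sup>2" using that by auto
    then show ?thesis unfolding \<omega>_def by (metis of_nat_eq_iff of_nat_power)
  qed
qed

text \<open>
  Let \<open>y\<close> have prime order \<open>r \<noteq> q\<close>. By rationality \<open>c \<mapsto> d (y c)\<close> is constant on the generators of
  each of the \<open>q + 1\<close> subgroups of order \<open>q\<close>, so the fibre sum over \<open>y ^ q\<close> is \<open>d y\<close> plus \<open>q - 1\<close> times
  an even number. This cannot be \<open>\<plusminus> q\<close> if \<open>q \<ge> 5\<close>.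
\<close>

lemma no_second_prime:
  assumes q: "prime q" "q dvd order G" "q \<ge> 5" and r: "prime r" "r dvd order G" "r \<noteq> q"
    and small: "card (fibre q \<one>) \<le> q\<^sup>2"
  shows False
proof -
  obtain y where y: "y \<in> carrier G" "y \<noteq> \<one>" "y [^] r = \<one>" using exists_prime_order r by blast
  have yq: "y [^] q \<noteq> \<one>"
    using ord_prime[OF r(1) y] pow_eq_id[OF y(1), of q] q r by (metis primes_dvd_imp_eq)
  have "card {\<one>, y [^] q} \<le> card (powers q)"
    using one_in_powers y by (intro card_mono finite_powers) (auto simp: powers_def)
  then have "card (powers q) > 1" using yq by simp
  then have card: "card (fibre q \<one>) = q\<^sup>2" using fibre_sum_rigidity(3)[OF q(1,2) small] by simp
  have abs: "\<bar>fibre_sum q (y [^] q)\<bar> = int q"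
    using fibre_sum_rigidity(2)[OF q(1,2) small] yq y by (auto simp: powers_def)
  define X where "X = {c \<in> fibre q \<one> - {\<one>}. d (y \<otimes> c) = 1}"
  have dX: "d (y \<otimes> c) = (if c \<in> X then 1 else -1)" if c: "c \<in> fibre q \<one> - {\<one>}" for c
  proof -
    have "y \<otimes> c \<noteq> \<one>"
    proof
      assume "y \<otimes> c = \<one>"
      then have "(y \<otimes> c) [^] q = \<one>" by simp
      then show False using c y yq by (simp add: fibre_def pow_mult_distrib[OF m_comm])
    qed
    then show ?thesis using d_vals[of "y \<otimes> c"] c y by (auto simp: X_def fibre_def)
  qed
  have "(q - 1) dvd card X"
  proof (rule card_unit_closed_dvd[OF q(1)])
    show "X \<subseteq> fibre q \<one> - {\<one>}" by (auto simp: X_def)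
    fix x t assume x: "x \<in> X" and t: "\<not> q dvd (t::nat)"
    have xc: "x \<in> carrier G" "x [^] q = \<one>" "x \<noteq> \<one>" using x by (auto simp: X_def fibre_def)
    obtain t' where t': "coprime t' (order G)" "[t' = t] (mod q)" "[t' = 1] (mod r)"
      using crt_unit[OF q(1,2) t] r by metis
    obtain s where s: "multiplier t' s" using multiplier_exists[OF t'(1)] ..
    have "s = 1" using multiplier_one_if_two_primes[OF q(1,2) r(1,2,3) t'(1) s] .
    have "x [^] t' = x [^] t" using pow_cong[OF xc(1,2) t'(2)] .
    moreover have "y [^] t' = y" using pow_cong[OF y(1,3) t'(3)] y by simp
    ultimately have "(y \<otimes> x) [^] t' = y \<otimes> x [^] t"
      using xc y by (simp add: pow_mult_distrib[OF m_comm])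
    moreover have "d ((y \<otimes> x) [^] t') = d (y \<otimes> x)"
      using s \<open>s = 1\<close> xc y by (simp add: multiplier_def)
    ultimately have "d (y \<otimes> x [^] t) = 1" using x by (simp add: X_def)
    moreover have "x [^] t \<noteq> \<one>"
      using ord_prime[OF q(1) xc(1,3,2)] pow_eq_id[OF xc(1), of t] t by auto
    moreover have "(x [^] t) [^] q = (x [^] q) [^] t"
      using xc(1) by (simp add: nat_pow_pow mult.commute)
    ultimately show "x [^] t \<in> X" using xc by (simp add: X_def fibre_def)
  qed
  then obtain m where m: "card X = (q - 1) * m" by auto
  obtain j where j: "q = 2 * j + 1" using q odd_order by (metis dvd_trans oddE dvd_def)
  have XF: "X \<subseteq> fibre q \<one> - {\<one>}" by (auto simp: X_def)
  have one: "\<one> \<in> fibre q \<one>" by (simp add: fibre_def)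
  have cardF: "card (fibre q \<one> - {\<one>}) = q\<^sup>2 - 1" using card one by simp
  have "fibre_sum q (y [^] q) = d y + (\<Sum>c\<in>fibre q \<one> - {\<one>}. d (y \<otimes> c))"
    unfolding fibre_sum_eq[OF y(1)] coset_sum_def
    by (subst sum.remove[OF _ one]) (use y in auto)
  also have "(\<Sum>c\<in>fibre q \<one> - {\<one>}. d (y \<otimes> c)) = (\<Sum>c\<in>fibre q \<one> - {\<one>}. 2 * (if c \<in> X then 1 else 0) - 1)"
    by (rule sum.cong) (use dX in auto)
  also have "\<dots> = 2 * int (card X) - int (q\<^sup>2 - 1)"
    using XF cardF by (simp add: sum_subtractf sum.If_cases Int_absorb1 flip: sum_distrib_left)
  also have "int (card X) = 2 * int j * int m" using m j by simp
  also have "int (q\<^sup>2 - 1) = 4 * int j * (int j + 1)"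
    using j by (simp add: power2_eq_square algebra_simps)
  \<comment> \<open>With \<open>q = 2 j + 1\<close> the modulus \<open>2 (q - 1)\<close> is \<open>4 j\<close>, which exceeds \<open>q + 1\<close>.\<close>
  finally have "fibre_sum q (y [^] q) = d y + 4 * int j * (int m - int j - 1)"
    by (simp add: algebra_simps)
  then have eq: "4 * int j * (int m - int j - 1) = fibre_sum q (y [^] q) - d y" by simp
  have "\<bar>fibre_sum q (y [^] q) - d y\<bar> < 4 * int j" "fibre_sum q (y [^] q) - d y \<noteq> 0"
    using abs d_abs_le[OF y(1)] j q(3) by auto
  moreover have "4 * int j dvd fibre_sum q (y [^] q) - d y" unfolding eq[symmetric] by simp
  ultimately have "\<bar>4 * int j\<bar> \<le> \<bar>fibre_sum q (y [^] q) - d y\<bar>" by (intro dvd_imp_le_int)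
  with \<open>\<bar>fibre_sum q (y [^] q) - d y\<bar> < 4 * int j\<close> show False by simp
qed

section \<open>Coset sums and the structure of the group\<close>

lemma coset_sum_shift:
  assumes L: "subgroup L G" and z: "z \<in> carrier G" and l: "l \<in> L"
  shows "coset_sum L (z \<otimes> l) = coset_sum L z"
proof -
  have LG: "L \<subseteq> carrier G" using L by (rule subgroup.subset)
  have "(\<Sum>u\<in>L. d (z \<otimes> (l \<otimes> u))) = (\<Sum>u\<in>L. d (z \<otimes> u))"
  proof (rule sum.reindex_bij_witness[of _ "\<lambda>u. inv l \<otimes> u" "\<lambda>u. l \<otimes> u"])
    fix u assume u: "u \<in> L"
    show "inv l \<otimes> (l \<otimes> u) = u" "l \<otimes> (inv l \<otimes> u) = u"
      using u l LG by (auto simp: m_assoc[symmetric] subset_iff)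
    show "l \<otimes> u \<in> L" "inv l \<otimes> u \<in> L"
      using u l L by (auto intro: subgroup.m_closed subgroup.m_inv_closed)
  qed simp
  then show ?thesis unfolding coset_sum_def using z l LG by (simp add: m_assoc subset_iff)
qed

lemma coset_sum_power:
  assumes L: "subgroup L G" and t: "coprime t (order G)" "multiplier t s" and z: "z \<in> carrier G"
  shows "coset_sum L (z [^] t) = s * coset_sum L z"
proof -
  have LG: "L \<subseteq> carrier G" using L by (rule subgroup.subset)
  have fL: "finite L" using LG fin finite_subset by blast
  have "inj_on (\<lambda>l. l [^] t) L" using coprime_power_inj[OF t(1)] LG by (auto simp: inj_on_def)
  moreover have "(\<lambda>l. l [^] t) ` L \<subseteq> L"
  proof -
    have "l [^] t \<in> L" if "l \<in> L" for l
      using that subgroup.one_closed[OF L] subgroup.m_closed[OF L] by (induction t) auto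
    then show ?thesis by auto
  qed
  ultimately have bij: "bij_betw (\<lambda>l. l [^] t) L L"
    using fL by (metis bij_betw_def endo_inj_surj)
  have "coset_sum L (z [^] t) = (\<Sum>l\<in>L. d (z [^] t \<otimes> l [^] t))"
    unfolding coset_sum_def by (rule sum.reindex_bij_betw[OF bij, symmetric])
  also have "\<dots> = (\<Sum>l\<in>L. s * d (z \<otimes> l))"
  proof (rule sum.cong[OF refl])
    fix l assume "l \<in> L"
    then have l: "l \<in> carrier G" using LG by auto
    then have "d ((z \<otimes> l) [^] t) = s * d (z \<otimes> l)" using t(2) z by (simp add: multiplier_def)
    then show "d (z [^] t \<otimes> l [^] t) = s * d (z \<otimes> l)"
      using z l by (simp add: pow_mult_distrib[OF m_comm])
  qed
  finally show ?thesis by (simp add: coset_sum_def sum_distrib_left)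
qed

lemma abs_coset_sum_le:
  assumes "L \<subseteq> carrier G" "z \<in> carrier G"
  shows "\<bar>coset_sum L z\<bar> \<le> int (card L)"
proof -
  have "\<bar>coset_sum L z\<bar> \<le> (\<Sum>l\<in>L. \<bar>d (z \<otimes> l)\<bar>)" unfolding coset_sum_def by (rule sum_abs)
  also have "\<dots> \<le> (\<Sum>l\<in>L. 1)" by (rule sum_mono) (use assms d_abs_le in \<open>auto simp: subset_iff\<close>)
  finally show ?thesis by simp
qed

text \<open>
  The identity lies in \<open>L\<close> and contributes \<open>0\<close>.
\<close>

lemma abs_coset_sum_one_less:
  assumes "L \<subseteq> carrier G" "\<one> \<in> L"
  shows "\<bar>coset_sum L \<one>\<bar> < int (card L)"
proof -
  have fL: "finite L" using assms fin finite_subset by blast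
  have "coset_sum L \<one> = coset_sum (L - {\<one>}) \<one>"
    unfolding coset_sum_def by (rule sum.mono_neutral_right) (use fL d_one in auto)
  also have "\<bar>\<dots>\<bar> \<le> int (card (L - {\<one>}))" using assms by (intro abs_coset_sum_le) auto
  finally show ?thesis using assms fL card_gt_0_iff[of L] by (auto simp: of_nat_diff)
qed

text \<open>
  The push-forward of \<open>d * d = \<nu> e - \<Sigma>\<close> to the quotient by \<open>L\<close>, with each coset counted \<open>\<bar>L\<bar>\<close> times.
\<close>

lemma coset_correlation:
  assumes L: "subgroup L G" and u: "u \<in> carrier G"
  shows "(\<Sum>z\<in>carrier G. coset_sum L z * coset_sum L (z \<otimes> u))
    = (if u \<in> L then int (card L) * int (order G) else 0) - (int (card L))\<^sup>2"
proof -
  have LG: "L \<subseteq> carrier G" using L by (rule subgroup.subset)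
  have fL: "finite L" using LG fin finite_subset by blast
  have one: "(\<Sum>z\<in>carrier G. d (z \<otimes> l) * d (z \<otimes> u \<otimes> l'))
      = (if l = u \<otimes> l' then int (order G) else 0) - 1" if l: "l \<in> L" "l' \<in> L" for l l'
  proof -
    have c: "l \<in> carrier G" "l' \<in> carrier G" using l LG by auto
    have "(\<Sum>z\<in>carrier G. d (z \<otimes> l) * d (z \<otimes> u \<otimes> l'))
        = (\<Sum>z\<in>carrier G. d (inv l \<otimes> z \<otimes> l) * d (inv l \<otimes> z \<otimes> u \<otimes> l'))"
      using c by (intro sum_translate[symmetric, of "inv l"]) auto
    also have "\<dots> = (\<Sum>z\<in>carrier G. d z * d (z \<otimes> (inv l \<otimes> (u \<otimes> l'))))"
    proof (rule sum.cong[OF refl])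
      fix z assume z: "z \<in> carrier G"
      have "inv l \<otimes> z \<otimes> l = z" using z c by (simp add: m_comm[of "inv l"] m_assoc)
      moreover have "inv l \<otimes> z \<otimes> u \<otimes> l' = z \<otimes> (inv l \<otimes> (u \<otimes> l'))"
        using z c u by (simp add: m_comm[of "inv l"] m_assoc)
      ultimately show "d (inv l \<otimes> z \<otimes> l) * d (inv l \<otimes> z \<otimes> u \<otimes> l') = d z * d (z \<otimes> (inv l \<otimes> (u \<otimes> l')))"
        by simp
    qed
    also have "\<dots> = (if inv l \<otimes> (u \<otimes> l') = \<one> then int (order G) else 0) - 1"
      using c u by (intro correlation) auto
    also have "inv l \<otimes> (u \<otimes> l') = \<one> \<longleftrightarrow> l = u \<otimes> l'"
      using c u by (metis inv_closed inv_inv inv_equality l_inv m_closed inv_unique' r_inv)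
    finally show ?thesis .
  qed
  have cnt: "(\<Sum>l'\<in>L. if l = u \<otimes> l' then int (order G) else 0) = (if u \<in> L then int (order G) else 0)"
    if l: "l \<in> L" for l
  proof -
    have iff: "l = u \<otimes> l' \<longleftrightarrow> l' = inv u \<otimes> l" if "l' \<in> L" for l'
      using that l LG u inv_solve_left[of l' u l] by auto
    have "(\<Sum>l'\<in>L. if l = u \<otimes> l' then int (order G) else 0)
        = (\<Sum>l'\<in>L. if l' = inv u \<otimes> l then int (order G) else 0)"
      by (rule sum.cong[OF refl]) (simp add: iff)
    also have "\<dots> = (if inv u \<otimes> l \<in> L then int (order G) else 0)" using fL by simp
    also have "inv u \<otimes> l \<in> L \<longleftrightarrow> u \<in> L"
    proof
      assume "inv u \<otimes> l \<in> L"
      then have "l \<otimes> inv (inv u \<otimes> l) \<in> L" using l L by (auto intro: subgroup.m_closed subgroup.m_inv_closed)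
      moreover have "l \<otimes> inv (inv u \<otimes> l) = u"
      proof -
        have c: "l \<in> carrier G" using l LG by auto
        have "l \<otimes> inv (inv u \<otimes> l) = l \<otimes> (inv l \<otimes> u)" using c u by (simp add: inv_mult m_comm)
        then show ?thesis using c u by (simp add: m_assoc[symmetric])
      qed
      ultimately show "u \<in> L" by simp
    qed (use l L in \<open>auto intro: subgroup.m_closed subgroup.m_inv_closed\<close>)
    finally show ?thesis .
  qed
  have "(\<Sum>z\<in>carrier G. coset_sum L z * coset_sum L (z \<otimes> u))
      = (\<Sum>z\<in>carrier G. \<Sum>l\<in>L. \<Sum>l'\<in>L. d (z \<otimes> l) * d (z \<otimes> u \<otimes> l'))"
    by (simp add: coset_sum_def sum_product)
  also have "\<dots> = (\<Sum>l\<in>L. \<Sum>z\<in>carrier G. \<Sum>l'\<in>L. d (z \<otimes> l) * d (z \<otimes> u \<otimes> l'))"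
    by (rule sum.swap)
  also have "\<dots> = (\<Sum>l\<in>L. \<Sum>l'\<in>L. \<Sum>z\<in>carrier G. d (z \<otimes> l) * d (z \<otimes> u \<otimes> l'))"
    by (rule sum.cong[OF refl], rule sum.swap)
  also have "\<dots> = (\<Sum>l\<in>L. \<Sum>l'\<in>L. (if l = u \<otimes> l' then int (order G) else 0) - 1)"
    using one by (intro sum.cong refl) blast
  also have "\<dots> = (\<Sum>l\<in>L. (if u \<in> L then int (order G) else 0) - int (card L))"
    by (rule sum.cong[OF refl]) (simp add: sum_subtractf cnt)
  finally show ?thesis by (simp add: power2_eq_square right_diff_distrib)
qed

text \<open>
  Sum the difference of the correlations of the coset sums \<open>c\<close> at \<open>1\<close> and at \<open>v ^ k\<close> over all \<open>k < p\<close>.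
  By assumption \<open>c\<close> is invariant under \<open>v\<close> outside the subgroup \<open>K\<close> generated by \<open>v\<close> and \<open>L\<close>, so only \<open>K\<close>
  contributes, and there the sum can be written in terms of the numbers \<open>c (v ^ k)\<close>.
\<close>

lemma coset_energy:
  assumes L: "subgroup L G" and v: "v \<in> carrier G" "v [^] p \<in> L"
    and vL: "\<And>k. \<lbrakk>0 < k; k < p\<rbrakk> \<Longrightarrow> v [^] k \<notin> L" and p: "p > 0"
    and const: "\<And>z k. \<lbrakk>z \<in> carrier G; z \<notin> (\<lambda>(k, l). v [^] k \<otimes> l) ` ({..<p} \<times> L)\<rbrakk>
      \<Longrightarrow> coset_sum L (z \<otimes> v [^] (k::nat)) = coset_sum L z"
  shows "int p * (\<Sum>k<p. (coset_sum L (v [^] k))\<^sup>2) - (\<Sum>k<p. coset_sum L (v [^] k))\<^sup>2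
    = (int p - 1) * int (order G)"
proof -
  have LG: "L \<subseteq> carrier G" using L by (rule subgroup.subset)
  have fL: "finite L" using LG fin finite_subset by blast
  let ?c = "coset_sum L"
  define \<sigma> where "\<sigma> = (\<Sum>k<p. ?c (v [^] k))"
  let ?f = "\<lambda>(k::nat, l). v [^] k \<otimes> l"
  let ?K = "?f ` ({..<p} \<times> L)"
  let ?g = "\<lambda>z. ?c z * (int p * ?c z - (\<Sum>k<p. ?c (z \<otimes> v [^] k)))"
  have inj: "inj_on ?f ({..<p} \<times> L)"
  proof -
    have less: False if "k < k'" "k' < p" "l \<in> L" "l' \<in> L" "v [^] k \<otimes> l = v [^] k' \<otimes> l'" for k k' :: nat and l l'
    proof -
      have c: "l \<in> carrier G" "l' \<in> carrier G" using that LG by auto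
      have "v [^] k' = v [^] k \<otimes> v [^] (k' - k)" using that v by (simp add: nat_pow_mult)
      then have "v [^] k \<otimes> l = v [^] k \<otimes> (v [^] (k' - k) \<otimes> l')" using that(5) v c by (simp add: m_assoc)
      then have "l = v [^] (k' - k) \<otimes> l'" using v c by simp
      then have "v [^] (k' - k) = l \<otimes> inv l'" using v c by (simp add: m_assoc)
      then have "v [^] (k' - k) \<in> L"
        using that L by (simp add: subgroup.m_closed subgroup.m_inv_closed)
      then show False using vL[of "k' - k"] that by simp
    qed
    show ?thesis
    proof (rule inj_onI)
      fix P Q assume PQ: "P \<in> {..<p} \<times> L" "Q \<in> {..<p} \<times> L" "?f P = ?f Q"
      obtain k l k' l' where kl: "P = (k, l)" "Q = (k', l')" by fastforce
      then have a: "k < p" "l \<in> L" "k' < p" "l' \<in> L" "v [^] k \<otimes> l = v [^] k' \<otimes> l'" using PQ by auto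
      have "k = k'" using less[of k k' l l'] less[of k' k l' l] a by (metis linorder_neqE_nat)
      moreover have "l = l'" using a v LG \<open>k = k'\<close> by (auto simp: subset_iff)
      ultimately show "P = Q" using kl by simp
    qed
  qed
  have KG: "?K \<subseteq> carrier G" using v LG by auto
  have "(\<Sum>z\<in>carrier G. ?g z) = (\<Sum>z\<in>carrier G. \<Sum>k<p. ?c z * ?c (z \<otimes> \<one>) - ?c z * ?c (z \<otimes> v [^] k))"
    by (rule sum.cong[OF refl]) (simp add: sum_subtractf sum_distrib_left right_diff_distrib)
  also have "\<dots> = (\<Sum>k<p. (\<Sum>z\<in>carrier G. ?c z * ?c (z \<otimes> \<one>)) - (\<Sum>z\<in>carrier G. ?c z * ?c (z \<otimes> v [^] k)))"
    by (subst sum.swap) (simp add: sum_subtractf)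
  also have "\<dots> = (\<Sum>k<p. if k = 0 then 0 else int (card L) * int (order G))"
  proof (rule sum.cong[OF refl])
    fix k assume "k \<in> {..<p}"
    then have "v [^] k \<in> L \<longleftrightarrow> k = 0" using vL[of k] subgroup.one_closed[OF L] by (cases "k = 0") auto
    then show "(\<Sum>z\<in>carrier G. ?c z * ?c (z \<otimes> \<one>)) - (\<Sum>z\<in>carrier G. ?c z * ?c (z \<otimes> v [^] k))
        = (if k = 0 then 0 else int (card L) * int (order G))"
      using coset_correlation[OF L, of "v [^] k"] coset_correlation[OF L, of \<one>] v subgroup.one_closed[OF L] by simp
  qed
  also have "\<dots> = (int p - 1) * (int (card L) * int (order G))"
    using p by (cases p) (simp_all add: sum.lessThan_Suc_shift del: sum.lessThan_Suc)
  finally have total: "(\<Sum>z\<in>carrier G. ?g z) = (int p - 1) * (int (card L) * int (order G))" .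
  have "(\<Sum>z\<in>carrier G. ?g z) = (\<Sum>z\<in>?K. ?g z)"
    by (rule sum.mono_neutral_right[OF fin KG]) (simp add: const)
  also have "\<dots> = (\<Sum>(k, l)\<in>{..<p} \<times> L. ?g (v [^] k \<otimes> l))"
    by (subst sum.reindex[OF inj]) (simp add: case_prod_unfold)
  also have "\<dots> = (\<Sum>(k, l)\<in>{..<p} \<times> L. ?c (v [^] k) * (int p * ?c (v [^] k) - \<sigma>))"
  proof (rule sum.cong[OF refl], clarify)
    fix k :: nat and l assume l: "l \<in> L"
    have c: "l \<in> carrier G" using l LG by auto
    have "?c (v [^] k \<otimes> l \<otimes> v [^] j) = ?c (v [^] (k + j))" for j :: nat
    proof -
      have "v [^] k \<otimes> l \<otimes> v [^] j = v [^] (k + j) \<otimes> l"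
        using v c by (simp add: nat_pow_mult[symmetric] m_ac)
      then show ?thesis using coset_sum_shift[OF L _ l, of "v [^] (k + j)"] v by simp
    qed
    moreover have "(\<Sum>j<p. ?c (v [^] (k + j))) = \<sigma>"
      unfolding \<sigma>_def
    proof (rule sum_periodic_shift)
      show "?c (v [^] (j + p)) = ?c (v [^] j)" for j :: nat
        using coset_sum_shift[OF L _ v(2), of "v [^] j"] v by (simp add: nat_pow_mult)
    qed
    ultimately show "?g (v [^] k \<otimes> l) = ?c (v [^] k) * (int p * ?c (v [^] k) - \<sigma>)"
      using coset_sum_shift[OF L _ l, of "v [^] k"] v by simp
  qed
  also have "\<dots> = int (card L) * (\<Sum>k<p. ?c (v [^] k) * (int p * ?c (v [^] k) - \<sigma>))"
    by (simp add: sum.cartesian_product[symmetric] sum_distrib_left)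
  also have "(\<Sum>k<p. ?c (v [^] k) * (int p * ?c (v [^] k) - \<sigma>)) = int p * (\<Sum>k<p. (?c (v [^] k))\<^sup>2) - \<sigma>\<^sup>2"
    by (simp add: right_diff_distrib sum_subtractf sum_distrib_left sum_distrib_right[symmetric] power2_eq_square \<sigma>_def[symmetric] mult.left_commute)
  finally have "int (card L) * (int p * (\<Sum>k<p. (?c (v [^] k))\<^sup>2) - \<sigma>\<^sup>2)
      = int (card L) * ((int p - 1) * int (order G))"
    unfolding total by (simp only: mult.left_commute)
  moreover have "card L \<noteq> 0" using fL subgroup.one_closed[OF L] by auto
  ultimately show ?thesis unfolding \<sigma>_def[symmetric] by simp
qed

context
  fixes p a b :: nat and x y :: 'a
  assumes p: "prime p" and bas: "basis p a b x y" and a: "a \<ge> 1"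
begin

lemmas xy = conjunct1[OF basis_carrier[OF bas]] conjunct2[OF basis_carrier[OF bas]]

abbreviation \<upsilon> :: 'a where "\<upsilon> \<equiv> socle_gen p a x"

text \<open>
  Outside the preimage of the subgroup of order \<open>p\<close>, multiplication by a power of \<open>\<upsilon>\<close> has the same
  effect modulo \<open>\<langle>y\<rangle>\<close> as a power map with exponent congruent to \<open>1\<close> modulo \<open>p\<close>; and such an exponent is
  a multiplier with sign \<open>1\<close>, rational or not, because it fixes \<open>\<upsilon>\<close>.
\<close>

lemma coset_sum_socle_shift:
  assumes z: "z \<in> carrier G"
    and off: "z \<notin> (\<lambda>(k, l). \<upsilon> [^] k \<otimes> l) ` ({..<p} \<times> cyc y)"
  shows "coset_sum (cyc y) (z \<otimes> \<upsilon> [^] (k::nat)) = coset_sum (cyc y) z"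
proof -
  obtain i j :: nat where ij: "z = x [^] i \<otimes> y [^] j"
    using bas z by (auto simp: basis_def spans_def)
  have ni: "\<not> p ^ (a - 1) dvd i"
  proof
    assume "p ^ (a - 1) dvd i"
    then obtain q where "i = p ^ (a - 1) * q" by auto
    then have "x [^] i = \<upsilon> [^] q" by (simp add: socle_gen_pow[OF p bas a])
    also have "\<dots> = \<upsilon> [^] (q mod p)"
      by (rule pow_cong[OF socle_gen_closed[OF p bas a] socle_gen_pow_p[OF p bas a]]) (simp add: cong_def)
    finally have "z = \<upsilon> [^] (q mod p) \<otimes> y [^] j" using ij by simp
    moreover have "y [^] j \<in> cyc y" using cyc_eq[OF xy(2)] by auto
    ultimately show False using off prime_gt_0_nat[OF p]
      by (auto intro!: image_eqI[where x = "(q mod p, y [^] j)"])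
  qed
  then have "i \<noteq> 0" by (metis dvd_0_right)
  then obtain u where u: "i = p ^ multiplicity p i * u" "\<not> p dvd u"
    using multiplicity_decompose'[of i p] p by (metis not_prime_unit mult.commute)
  define s where "s = multiplicity p i"
  have "s < a - 1"
  proof (rule ccontr)
    assume "\<not> s < a - 1"
    then have "p ^ (a - 1) dvd p ^ s" by (simp add: le_imp_power_dvd)
    then show False using ni u(1) unfolding s_def[symmetric] by (metis dvd_mult2)
  qed
  have "coprime u p" using u(2) p prime_imp_coprime coprime_commute by blast
  then obtain u' where u': "[u * u' = 1] (mod p)" using cong_solve_coprime_nat by fastforce
  \<comment> \<open>Chosen such that \<open>i * t\<close> is \<open>i + p ^ (a - 1) * k\<close> modulo \<open>p ^ a\<close>.\<close>
  define t where "t = 1 + p ^ (a - 1 - s) * u' * k"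
  have "0 < a - 1 - s" using \<open>s < a - 1\<close> by linarith
  then have "p dvd p ^ (a - 1 - s)" by (intro dvd_power) simp
  then have "p dvd p ^ (a - 1 - s) * u' * k" by simp
  then have tp: "[t = 1] (mod p)" unfolding t_def by (metis cong_0_iff cong_add_lcancel_0_nat)
  then have "\<not> p dvd t" using p by (metis cong_dvd_iff not_prime_unit)
  then have ct: "coprime t (order G)" by (simp add: coprime_order_iff[OF p bas a])
  obtain s0 where s0: "multiplier t s0" using multiplier_exists[OF ct] ..
  then have m1: "multiplier t 1"
    using multiplier_cong_one[OF s0 socle_gen_closed[OF p bas a] socle_gen_neq_one[OF p bas a] socle_gen_pow_p[OF p bas a] tp] by simp
  have "p ^ s * p ^ (a - 1 - s) = p ^ (a - 1)" using \<open>s < a - 1\<close> by (simp flip: power_add)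
  then have it: "i * t = i + p ^ (a - 1) * (u * u') * k"
    using u(1) unfolding s_def[symmetric] t_def by (simp add: algebra_simps)
  have "x [^] (i * t) = x [^] i \<otimes> (\<upsilon> [^] (u * u')) [^] k"
    unfolding it using xy by (simp add: socle_gen_pow[OF p bas a] nat_pow_mult nat_pow_pow)
  also have "\<upsilon> [^] (u * u') = \<upsilon>"
    using pow_cong[OF socle_gen_closed[OF p bas a] socle_gen_pow_p[OF p bas a] u'] socle_gen_closed[OF p bas a] by simp
  finally have xt: "x [^] (i * t) = x [^] i \<otimes> \<upsilon> [^] k" .
  have "z [^] t = x [^] (i * t) \<otimes> y [^] (j * t)"
    using xy by (simp add: ij pow_mult_distrib[OF m_comm] nat_pow_pow)
  also have "j * t = j + j * (t - 1)" by (simp add: t_def algebra_simps)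
  finally have zt: "z [^] t = (z \<otimes> \<upsilon> [^] k) \<otimes> y [^] (j * (t - 1))"
    using xy socle_gen_closed[OF p bas a] unfolding xt ij by (simp add: nat_pow_mult[symmetric] m_ac)
  have sub: "subgroup (cyc y) G" using xy(2) by (rule subgroup_cyc)
  have "y [^] (j * (t - 1)) \<in> cyc y" using cyc_eq[OF xy(2)] by auto
  then have "coset_sum (cyc y) (z [^] t) = coset_sum (cyc y) (z \<otimes> \<upsilon> [^] k)"
    unfolding zt using z socle_gen_closed[OF p bas a] by (intro coset_sum_shift[OF sub]) auto
  then show ?thesis using coset_sum_power[OF sub ct m1 z] by simp
qed

text \<open>
  The left side is the sum of the squared absolute values of the transform of the coset sums at the
  nontrivial characters of \<open>\<langle>\<upsilon>\<rangle>\<close>. By \<open>coset_sum_socle_shift\<close> each transform is also the value of \<open>d\<close> at a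
  faithful character of the cyclic quotient by \<open>\<langle>y\<rangle>\<close>, whose squared absolute value is the order of the
  group.
\<close>

lemma socle_energy:
  "int p * (\<Sum>k<p. (coset_sum (cyc y) (\<upsilon> [^] k))\<^sup>2)
    - (\<Sum>k<p. coset_sum (cyc y) (\<upsilon> [^] k))\<^sup>2 = (int p - 1) * int (order G)"
proof (rule coset_energy[OF subgroup_cyc[OF xy(2)] socle_gen_closed[OF p bas a]])
  show "\<upsilon> [^] p \<in> cyc y" "p > 0" "\<And>k. \<lbrakk>0 < k; k < p\<rbrakk> \<Longrightarrow> \<upsilon> [^] k \<notin> cyc y"
    using socle_gen_pow_in_iff[OF p bas a] prime_gt_0_nat[OF p] by (auto dest: dvd_imp_le)
qed (rule coset_sum_socle_shift)

lemma socle_multiplier: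
  assumes "\<not> p dvd k"
  shows "(coset_sum (cyc y) (\<upsilon> [^] k))\<^sup>2 = (coset_sum (cyc y) \<upsilon>)\<^sup>2"
proof -
  have ct: "coprime k (order G)" using assms by (simp add: coprime_order_iff[OF p bas a])
  obtain s where s: "multiplier k s" using multiplier_exists[OF ct] ..
  have "coset_sum (cyc y) (\<upsilon> [^] k) = s * coset_sum (cyc y) \<upsilon>"
    using coset_sum_power[OF subgroup_cyc[OF xy(2)] ct s socle_gen_closed[OF p bas a]] .
  moreover have "s = 1 \<or> s = -1" using s by (simp add: multiplier_def)
  ultimately show ?thesis by (auto simp: power2_eq_square)
qed

text \<open>
  In the rational case the coset sums at the nontrivial powers of \<open>\<upsilon>\<close> coincide, and the quadratic form
  in \<open>socle_energy\<close> becomes \<open>p - 1\<close> times a square.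
\<close>

lemma rational_discriminant:
  assumes rat: rational
  shows "(coset_sum (cyc y) \<one> - coset_sum (cyc y) \<upsilon>)\<^sup>2 = int (order G)"
    and "\<And>k. \<not> p dvd k \<Longrightarrow> coset_sum (cyc y) (\<upsilon> [^] k) = coset_sum (cyc y) \<upsilon>"
proof -
  show eq: "coset_sum (cyc y) (\<upsilon> [^] k) = coset_sum (cyc y) \<upsilon>" if "\<not> p dvd k" for k :: nat
  proof -
    have ct: "coprime k (order G)" using that by (simp add: coprime_order_iff[OF p bas a])
    obtain s where s: "multiplier k s" using multiplier_exists[OF ct] ..
    show ?thesis using coset_sum_power[OF subgroup_cyc[OF xy(2)] ct s socle_gen_closed[OF p bas a]] rationalD[OF rat ct s] by simp
  qed
  define \<alpha> \<beta> where "\<alpha> = coset_sum (cyc y) \<one>" and "\<beta> = coset_sum (cyc y) \<upsilon>"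
  have eq': "coset_sum (cyc y) (\<upsilon> [^] k) = \<beta>" if "k \<in> {1..<p}" for k
    using that eq[of k] nat_dvd_not_less[of k p] by (auto simp: \<beta>_def)
  have c: "int (card {1..<p}) = int p - 1" using prime_gt_0_nat[OF p] by simp
  have "(\<Sum>k<p. (coset_sum (cyc y) (\<upsilon> [^] k))\<^sup>2) = \<alpha>\<^sup>2 + (int p - 1) * \<beta>\<^sup>2"
    unfolding sum_split_zero[OF prime_gt_0_nat[OF p]] c[symmetric] using eq' by (simp add: \<alpha>_def)
  moreover have "(\<Sum>k<p. coset_sum (cyc y) (\<upsilon> [^] k)) = \<alpha> + (int p - 1) * \<beta>"
    unfolding sum_split_zero[OF prime_gt_0_nat[OF p]] c[symmetric] using eq' by (simp add: \<alpha>_def)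
  ultimately have "int p * (\<alpha>\<^sup>2 + (int p - 1) * \<beta>\<^sup>2) - (\<alpha> + (int p - 1) * \<beta>)\<^sup>2 = (int p - 1) * int (order G)"
    using socle_energy by simp
  then have "(int p - 1) * (\<alpha> - \<beta>)\<^sup>2 = (int p - 1) * int (order G)"
    by (simp add: power2_eq_square algebra_simps)
  then show "(\<alpha> - \<beta>)\<^sup>2 = int (order G)" using prime_gt_1_nat[OF p] by simp
qed

text \<open>
  By \<open>rational_discriminant\<close> the order \<open>p ^ (a + b)\<close> is the square of a number less than \<open>2 p ^ b\<close>.
\<close>

lemma rational_homocyclic:
  assumes rat: rational
    and "b \<le> a"
  shows "a = b"
proof -
  define \<kappa> where "\<kappa> = coset_sum (cyc y) \<one> - coset_sum (cyc y) \<upsilon>"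
  have LG: "cyc y \<subseteq> carrier G" by (rule cyc_closed[OF xy(2)])
  have cL: "card (cyc y) = p ^ b" by (rule basis_card_cyc[OF p bas])
  have odd_p: "p \<ge> 3"
  proof -
    have "p dvd order G" using bas a by (simp add: basis_def)
    then have "odd p" using odd_order dvd_trans by blast
    then show ?thesis using prime_ge_2_nat[OF p] by (cases "p = 2") auto
  qed
  have "\<kappa>\<^sup>2 = int p ^ (a + b)"
    using rational_discriminant(1)[OF rat] bas by (simp add: \<kappa>_def basis_def)
  then obtain i where i: "a + b = 2 * i" "\<bar>\<kappa>\<bar> = int p ^ i" using even_exponent_if_square[OF p] by metis
  have "\<bar>\<kappa>\<bar> < 2 * int p ^ b"
    using abs_coset_sum_one_less[OF LG generate.one] abs_coset_sum_le[OF LG socle_gen_closed[OF p bas a]] cL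
    unfolding \<kappa>_def by simp
  then have "int p ^ i < int p ^ b * 2" using i by simp
  also have "\<dots> \<le> int p ^ b * int p" using odd_p by (intro mult_left_mono) auto
  finally have "int p ^ i < int p ^ Suc b" by (simp add: mult.commute)
  then have "i < Suc b" by (rule power_less_imp_less_exp[rotated]) (use prime_gt_1_nat[OF p] in simp)
  then show "a = b" using i assms(2) by simp
qed

text \<open>
  With a multiplier of sign \<open>-1\<close>, the coset sum at \<open>1\<close> and the sum of the coset sums at all powers
  of \<open>\<upsilon>\<close> vanish, so \<open>socle_energy\<close> gives \<open>p c(\<upsilon>)\<^sup>2 = p ^ (a + b)\<close>. Hence \<open>\<bar>c(\<upsilon>)\<bar>\<close> is a power of \<open>p\<close> whose
  exponent \<open>(a + b - 1) / 2\<close> is an integer, at most \<open>b\<close> because the coset has \<open>p ^ b\<close> elements, and at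
  least \<open>b\<close> because \<open>b \<le> a\<close>. So the coset sum is extremal and \<open>d\<close> is constant on the coset.
\<close>

lemma twisted_constant:
  assumes tw: "coprime t (order G)" "multiplier t (-1)" and ba: "b \<le> a"
    and k: "\<not> p dvd k" and l: "l \<in> cyc y"
  shows "d (\<upsilon> [^] k \<otimes> l) = d (\<upsilon> [^] k)"
proof -
  let ?c = "coset_sum (cyc y)"
  have sub: "subgroup (cyc y) G" using xy(2) by (rule subgroup_cyc)
  have LG: "cyc y \<subseteq> carrier G" by (rule cyc_closed[OF xy(2)])
  have cL: "card (cyc y) = p ^ b" by (rule basis_card_cyc[OF p bas])
  have neg: "?c (z [^] t) = - ?c z" if "z \<in> carrier G" for z
    using coset_sum_power[OF sub tw that] by simp
  have c0: "?c \<one> = 0" using neg[of \<one>] by simp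
  have "(\<Sum>k<p. ?c (\<upsilon> [^] k)) = (\<Sum>k<p. ?c (\<upsilon> [^] (t * k)))"
  proof (rule sum_periodic_mult[symmetric])
    show "?c (\<upsilon> [^] i) = ?c (\<upsilon> [^] j)" if "[i = j] (mod p)" for i j :: nat
      using pow_cong[OF socle_gen_closed[OF p bas a] socle_gen_pow_p[OF p bas a] that] by simp
    show "coprime t p" using tw(1) p coprime_order_iff[OF p bas a] prime_imp_coprime coprime_commute by metis
  qed
  also have "\<dots> = (\<Sum>k<p. - ?c (\<upsilon> [^] k))"
    using neg socle_gen_closed[OF p bas a] by (intro sum.cong refl) (simp add: nat_pow_pow mult.commute flip: neg)
  finally have s0: "(\<Sum>k<p. ?c (\<upsilon> [^] k)) = 0" by (simp add: sum_negf)
  have "(\<Sum>k<p. (?c (\<upsilon> [^] k))\<^sup>2) = (\<Sum>k\<in>{1..<p}. (?c (\<upsilon> [^] k))\<^sup>2)"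
    unfolding sum_split_zero[OF prime_gt_0_nat[OF p]] using c0 by simp
  also have "\<dots> = (\<Sum>k\<in>{1..<p}. (?c \<upsilon>)\<^sup>2)"
    by (intro sum.cong refl socle_multiplier) (auto dest: dvd_imp_le)
  finally have "(\<Sum>k<p. (?c (\<upsilon> [^] k))\<^sup>2) = (int p - 1) * (?c \<upsilon>)\<^sup>2"
    using prime_gt_0_nat[OF p] by simp
  then have "(int p - 1) * (int p * (?c \<upsilon>)\<^sup>2) = (int p - 1) * int (order G)"
    using socle_energy s0 by (simp add: mult.left_commute)
  then have "int p * (?c \<upsilon>)\<^sup>2 = int (order G)" using prime_gt_1_nat[OF p] by simp
  moreover have "order G = p * p ^ (a - 1 + b)" using bas power_split_last[OF a, of p] by (simp add: basis_def power_add)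
  ultimately have "int p ^ (a - 1 + b) = (?c \<upsilon>)\<^sup>2" using prime_gt_0_nat[OF p] by simp
  then obtain i where i: "a - 1 + b = 2 * i" "\<bar>?c \<upsilon>\<bar> = int p ^ i"
    using even_exponent_if_square[OF p] by blast
  have "int p ^ i \<le> int p ^ b"
    using abs_coset_sum_le[OF LG socle_gen_closed[OF p bas a]] unfolding i(2) cL by simp
  then have "i \<le> b" by (rule power_le_imp_le_exp[rotated]) (use prime_gt_1_nat[OF p] in simp)
  then have "i = b" using i(1) ba a by presburger
  then have "(?c (\<upsilon> [^] k))\<^sup>2 = (int p ^ b)\<^sup>2" using socle_multiplier[OF k] i(2) by (metis power2_abs)
  then have "\<bar>?c (\<upsilon> [^] k)\<bar> = int (card (cyc y))"
    using cL by (auto simp: power2_eq_iff)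
  then have "d (\<upsilon> [^] k \<otimes> l) = d (\<upsilon> [^] k \<otimes> \<one>)"
    unfolding coset_sum_def using l LG socle_gen_closed[OF p bas a] finite_cyc[OF xy(2)]
    by (intro eq_if_sum_extremal[of "cyc y" "\<lambda>l. d (\<upsilon> [^] k \<otimes> l)"])
      (auto intro!: d_abs_le generate.one)
  then show ?thesis using socle_gen_closed[OF p bas a] by simp
qed

end

text \<open>
  Let \<open>v\<close> generate the subgroup of order \<open>p\<close> of \<open>\<langle>x\<rangle>\<close>. Both \<open>(x, y)\<close> and \<open>(x, y v)\<close> are bases, so by
  \<open>twisted_constant\<close> the value of \<open>d\<close> at \<open>v (y v) ^ (t - 1) = v ^ t y ^ (t - 1)\<close> is \<open>d v\<close> as well as
  \<open>d (v ^ t) = - d v\<close>.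
\<close>

lemma twisted_impossible:
  assumes p: "prime p" and bas: "basis p a b x y" and b: "1 \<le> b" "b \<le> a"
    and tw: "coprime t (order G)" "multiplier t (-1)"
  shows False
proof -
  have a: "a \<ge> 1" using b by simp
  have xy: "x \<in> carrier G" "y \<in> carrier G" using basis_carrier[OF bas] by auto
  let ?v = "socle_gen p a x"
  have v: "?v \<in> carrier G" by (rule socle_gen_closed[OF p bas a])
  have vp: "?v [^] p = \<one>" by (rule socle_gen_pow_p[OF p bas a])
  define w where "w = y \<otimes> ?v"
  have w: "w \<in> carrier G" using xy v by (simp add: w_def)
  have bas': "basis p a b x w"
  proof -
    have "?v \<otimes> ?v [^] (p - 1) = \<one>"
      using v vp prime_gt_0_nat[OF p] by (metis Suc_diff_1 m_comm nat_pow_Suc nat_pow_closed)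
    moreover have "?v [^] (p - 1) \<otimes> w [^] (1::nat) = y \<otimes> (?v \<otimes> ?v [^] (p - 1))"
      using xy v by (simp add: w_def m_ac)
    ultimately have "y = ?v [^] (p - 1) \<otimes> w [^] (1::nat)" using xy by simp
    then have "y = x [^] (p ^ (a - 1) * (p - 1)) \<otimes> w [^] (1::nat)"
      unfolding socle_gen_pow[OF p bas a] .
    moreover have "spans x y" using bas by (simp add: basis_def)
    ultimately have "spans x w" using w spans_change by blast
    moreover have "w [^] (p ^ b) = \<one>"
    proof -
      have "?v [^] (p ^ b) = \<one>"
        using pow_cong[OF v vp, of "p ^ b" 0] b(1) by (simp add: cong_0_iff dvd_power)
      then show ?thesis using bas xy v by (simp add: w_def basis_def pow_mult_distrib[OF m_comm])
    qed
    ultimately show ?thesis using bas by (simp add: basis_def)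
  qed
  have pt: "\<not> p dvd t" using tw(1) coprime_order_iff[OF p bas a] by simp
  then have "t > 0" by (cases t) auto
  have p1: "\<not> p dvd 1" using p by (metis not_prime_unit)
  have "w [^] (t - 1) \<in> cyc w" using cyc_eq[OF w] by auto
  then have "d (?v \<otimes> w [^] (t - 1)) = d ?v"
    using twisted_constant[OF p bas' a tw b(2) p1] v by simp
  moreover have "?v \<otimes> w [^] (t - 1) = ?v [^] t \<otimes> y [^] (t - 1)"
  proof -
    have "?v [^] t = ?v \<otimes> ?v [^] (t - 1)" using \<open>t > 0\<close> v by (cases t) (auto simp: m_comm)
    then show ?thesis using xy v by (simp add: w_def pow_mult_distrib[OF m_comm] m_ac)
  qed
  moreover have "y [^] (t - 1) \<in> cyc y" using cyc_eq[OF xy(2)] by auto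
  then have "d (?v [^] t \<otimes> y [^] (t - 1)) = d (?v [^] t)"
    by (rule twisted_constant[OF p bas a tw b(2) pt])
  moreover have "d (?v [^] t) = - d ?v" using tw(2) v by (simp add: multiplier_def)
  ultimately have "d ?v = 0" by simp
  then show False using d_nonzero[OF v socle_gen_neq_one[OF p bas a]] by simp
qed

text \<open>
  Two distinct odd primes cannot both be less than \<open>5\<close>, so \<open>no_second_prime\<close> excludes a second
  prime divisor of the order. In a basis of the resulting \<open>p\<close>-group both factors are nontrivial, as the
  group is not cyclic, so \<open>twisted_impossible\<close> and \<open>rational_homocyclic\<close> apply.
\<close>

theorem homocyclic_structure:
  assumes sp: "spans g h" and noncyc: "\<And>x. x \<in> carrier G \<Longrightarrow> cyc x \<noteq> carrier G"
  obtains p n x y where "prime p" "odd p" "n \<ge> 1" "basis p n n x y" rational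
proof -
  have "order G \<noteq> 1"
  proof
    assume "order G = 1"
    then have "carrier G = {\<one>}" unfolding order_def by (metis card_1_singletonE one_closed singletonD)
    then show False using noncyc[of \<one>] generate_one by auto
  qed
  then obtain p0 where p0: "prime p0" "p0 dvd order G" using prime_factor_nat by blast
  have odd: "odd q" if "q dvd order G" for q using that odd_order dvd_trans by blast
  have only: "r = p0" if r: "prime r" "r dvd order G" for r
  proof (rule ccontr)
    assume ne: "r \<noteq> p0"
    have ge5: "q \<ge> 5" if "prime q" "q dvd order G" "q \<noteq> 3" for q :: nat
    proof (rule ccontr)
      assume "\<not> q \<ge> 5"
      then have "q = 2 \<or> q = 4" using that prime_ge_2_nat[OF that(1)] by auto
      then show False using odd[OF that(2)] by auto
    qed
    have bound: "card (fibre q \<one>) \<le> q\<^sup>2" if "prime q" for q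
      using sp prime_gt_0_nat[OF that] by (intro card_fibre_le[of g h]) (auto simp: spans_def)
    show False
    proof (cases "r = 3")
      case True
      then show False using no_second_prime[OF p0 ge5[OF p0] r ne bound[OF p0(1)]] ne by simp
    next
      case False
      then show False using no_second_prime[OF r ge5[OF r] p0 _ bound[OF r(1)]] ne by simp
    qed
  qed
  obtain M where M: "order G = p0 ^ multiplicity p0 (order G) * M" "\<not> p0 dvd M"
    using multiplicity_decompose'[of "order G" p0] order_pos p0(1)
    by (metis not_prime_unit less_numeral_extra(3) mult.commute)
  have "M = 1"
  proof (rule ccontr)
    assume "M \<noteq> 1"
    then obtain r where r: "prime r" "r dvd M" using prime_factor_nat by blast
    then have "r dvd order G" by (subst M(1)) simp
    then show False using only r M(2) by blast
  qed
  then have N: "order G = p0 ^ multiplicity p0 (order G)" using M(1) by simp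
  obtain a b x y where ab: "b \<le> a" "basis p0 a b x y" by (rule basis_exists[OF p0(1) N sp])
  have b1: "b \<ge> 1"
  proof (rule ccontr)
    assume "\<not> b \<ge> 1"
    then have b0: "y = \<one>" using ab(2) basis_carrier[OF ab(2)] by (simp add: basis_def not_le)
    have x: "x \<in> carrier G" using basis_carrier[OF ab(2)] by simp
    have "carrier G \<subseteq> cyc x"
    proof
      fix z assume "z \<in> carrier G"
      then obtain i j :: nat where "z = x [^] i \<otimes> y [^] j" using ab(2) by (auto simp: basis_def spans_def)
      then show "z \<in> cyc x" using b0 x cyc_eq[OF x] by auto
    qed
    then show False using noncyc[OF x] cyc_closed[OF x] by blast
  qed
  then have a1: "a \<ge> 1" using ab(1) by simp
  have rat: rational
    unfolding rational_def using twisted_impossible[OF p0(1) ab(2) b1 ab(1)]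
    by (metis multiplier_def)
  have "a = b" using rational_homocyclic[OF p0(1) ab(2) a1 rat ab(1)] .
  then show thesis using that[of p0 a x y] p0 odd[OF p0(2)] a1 ab(2) rat by blast
qed

section \<open>The fibre sums in the homocyclic case\<close>

context
  fixes p n :: nat and g h :: 'a
  assumes p: "prime p" and n: "n \<ge> 1" and gh: "basis p n n g h" and rat: rational
begin

lemma p_ge_3: "p \<ge> 3"
proof -
  have "odd p" using p_dvd_order[OF p n gh] odd_order dvd_trans by blast
  then show ?thesis using prime_ge_2_nat[OF p] by (cases "p = 2") auto
qed

lemma d_power:
  assumes "\<not> p dvd t" "x \<in> carrier G"
  shows "d (x [^] t) = d x"
proof -
  have ct: "coprime t (order G)" using coprime_order_iff[OF p gh n] assms(1) by simp
  obtain s where s: "multiplier t s" using multiplier_exists[OF ct] ..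
  then show ?thesis using rationalD[OF rat ct s] assms(2) by (simp add: multiplier_def)
qed

lemmas fibre_sums = fibre_sum_rigidity[OF p p_dvd_order[OF p n gh] card_socle_le[OF p n gh]]

lemma fibre_sum_power:
  assumes "\<not> p dvd t" "z \<in> powers p"
  shows "fibre_sum p (z [^] t) = fibre_sum p z"
proof -
  obtain x where x: "x \<in> carrier G" "z = x [^] p" using assms(2) by (auto simp: powers_def)
  have ct: "coprime t (order G)" using coprime_order_iff[OF p gh n] assms(1) by simp
  have m: "multiplier t 1"
    using multiplier_exists[OF ct] rationalD[OF rat ct] by auto
  have sub: "subgroup (fibre p \<one>) G"
    by (rule subgroupI) (auto simp: fibre_def pow_mult_distrib[OF m_comm] nat_pow_inv intro!: exI[of _ \<one>])
  have "z [^] t = (x [^] t) [^] p" using x by (simp add: nat_pow_pow mult.commute)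
  then show ?thesis using x coset_sum_power[OF sub ct m x(1)] by (simp add: fibre_sum_eq)
qed

text \<open>
  The fibre sums over the \<open>p\<close>-th powers in \<open>\<langle>l\<rangle>\<close> add up to the sum of \<open>d\<close> over the preimage of these
  powers, which is the subgroup generated by \<open>\<langle>l\<rangle>\<close> and the socle, a union of \<open>p\<close> cosets of \<open>\<langle>l\<rangle>\<close>.
\<close>

lemma sum_fibre_sums_cyclic:
  assumes bas: "basis p n n w l"
  defines "\<alpha> \<equiv> coset_sum (cyc l) \<one>" and "\<beta> \<equiv> coset_sum (cyc l) (socle_gen p n w)"
  shows "\<alpha> = (\<Sum>i<p ^ n. d (l [^] i))"
    and "(\<Sum>i<p ^ (n - 1). fibre_sum p (l [^] (p * i))) = \<alpha> + (int p - 1) * \<beta>"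
proof -
  let ?L = "cyc l" and ?v = "socle_gen p n w" and ?u = "socle_gen p n l"
  have bas': "basis p n n l w" using bas by (rule basis_commute)
  have wl: "w \<in> carrier G" "l \<in> carrier G" using basis_carrier[OF bas] by auto
  have lpn: "l [^] (p ^ n) = \<one>" using bas by (simp add: basis_def)
  have sub: "subgroup ?L G" using wl(2) by (rule subgroup_cyc)
  have inj: "inj_on (\<lambda>i. l [^] i) {..<p ^ n}"
  proof (rule inj_onI)
    fix i j assume ij: "i \<in> {..<p ^ n}" "j \<in> {..<p ^ n}" "l [^] i = l [^] j"
    then have "[i = j] (mod p ^ n)" using basis_eq_iff[OF p bas, of 0 i 0 j] wl by simp
    then show "i = j" using ij by (simp add: cong_def)
  qed
  have "(\<lambda>i. l [^] i) ` {..<p ^ n} = ?L"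
  proof (rule card_seteq)
    show "(\<lambda>i. l [^] i) ` {..<p ^ n} \<subseteq> ?L" using cyc_eq[OF wl(2)] by auto
    show "card ?L \<le> card ((\<lambda>i. l [^] i) ` {..<p ^ n})"
      using basis_card_cyc[OF p bas] by (simp add: card_image[OF inj])
  qed (rule finite_cyc[OF wl(2)])
  then have reL: "(\<Sum>z\<in>?L. f z) = (\<Sum>i<p ^ n. f (l [^] i))" for f :: "'a \<Rightarrow> int"
    using sum.reindex[OF inj, of f] by simp
  have vc: "?v \<in> carrier G" "?u \<in> carrier G"
    using socle_gen_closed[OF p bas n] socle_gen_closed[OF p bas' n] by auto
  show "\<alpha> = (\<Sum>i<p ^ n. d (l [^] i))" unfolding \<alpha>_def coset_sum_def reL using wl by simp
  have per: "l [^] (p * (i + p ^ (n - 1))) = l [^] (p * i)" for i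
    using pow_cong[OF wl(2) lpn, of "p * (i + p ^ (n - 1))" "p * i"]
    by (simp add: distrib_left cong_def power_split_last[OF n, of p] mult.commute[of p])
  \<comment> \<open>The sum of \<open>d (z \<otimes> c)\<close> over \<open>z\<close> in \<open>\<langle>l\<rangle>\<close> and \<open>c\<close> in the socle, computed in two ways, counts the
    subgroup generated by both with multiplicity \<open>p\<close>, the order of their intersection.\<close>
  have "(\<Sum>z\<in>?L. coset_sum (fibre p \<one>) z) = (\<Sum>i<p ^ n. fibre_sum p (l [^] (p * i)))"
    unfolding reL using wl by (intro sum.cong refl) (simp add: fibre_sum_eq[symmetric] nat_pow_pow mult.commute)
  also have "p ^ n = p * p ^ (n - 1)" using power_split_last[OF n, of p] by simp
  also have "(\<Sum>i<p * p ^ (n - 1). fibre_sum p (l [^] (p * i))) = int p * (\<Sum>i<p ^ (n - 1). fibre_sum p (l [^] (p * i)))"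
    by (rule sum_period_multiple) (simp only: per)
  finally have A: "(\<Sum>z\<in>?L. coset_sum (fibre p \<one>) z) = int p * (\<Sum>i<p ^ (n - 1). fibre_sum p (l [^] (p * i)))" .
  have "(\<Sum>z\<in>?L. coset_sum (fibre p \<one>) z) = (\<Sum>c\<in>fibre p \<one>. coset_sum ?L c)"
    unfolding coset_sum_def
    by (subst sum.swap, intro sum.cong refl arg_cong[of _ _ d])
      (use cyc_closed[OF wl(2)] in \<open>auto simp: fibre_def m_comm\<close>)
  also have "\<dots> = (\<Sum>(k, j)\<in>{..<p} \<times> {..<p}. coset_sum ?L (?v [^] k \<otimes> ?u [^] j))"
    unfolding socle_eq(2)[OF p n gh bas, symmetric] sum.reindex[OF socle_eq(1)[OF p n gh bas]]
    by (simp add: case_prod_unfold)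
  also have "\<dots> = (\<Sum>(k, j)\<in>{..<p} \<times> {..<p}. coset_sum ?L (?v [^] k))"
  proof (intro sum.cong refl, clarify)
    fix k j :: nat
    have "?u [^] j \<in> ?L" using cyc_eq[OF wl(2)] by (auto simp: socle_gen_pow[OF p bas' n])
    then show "coset_sum ?L (?v [^] k \<otimes> ?u [^] j) = coset_sum ?L (?v [^] k)"
      using vc by (intro coset_sum_shift[OF sub]) auto
  qed
  also have "\<dots> = int p * (\<Sum>k<p. coset_sum ?L (?v [^] k))"
    by (simp add: sum.cartesian_product[symmetric] sum_distrib_left)
  also have "(\<Sum>k<p. coset_sum ?L (?v [^] k)) = \<alpha> + (\<Sum>k\<in>{1..<p}. \<beta>)"
    unfolding sum_split_zero[OF prime_gt_0_nat[OF p]]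
  proof (intro arg_cong2[of _ _ _ _ "(+)"] sum.cong refl)
    show "coset_sum ?L (?v [^] (0::nat)) = \<alpha>" by (simp add: \<alpha>_def)
    fix k assume "k \<in> {1..<p}"
    then have "\<not> p dvd k" using nat_dvd_not_less[of k p] by auto
    then show "coset_sum ?L (?v [^] k) = \<beta>"
      unfolding \<beta>_def by (rule rational_discriminant(2)[OF p bas n rat])
  qed
  also have "(\<Sum>k\<in>{1..<p}. \<beta>) = (int p - 1) * \<beta>" using prime_gt_0_nat[OF p] by simp
  finally show "(\<Sum>i<p ^ (n - 1). fibre_sum p (l [^] (p * i))) = \<alpha> + (int p - 1) * \<beta>"
    using A prime_gt_0_nat[OF p] by simp
qed

text \<open>
  Both \<open>p d(z)\<close> and the fibre sum are \<open>\<plusminus> p\<close>, or both are \<open>0\<close>.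
\<close>

lemma fibre_sum_defect:
  assumes z: "z \<in> powers p"
  obtains e where "\<bar>e\<bar> \<le> 1" "int p * d z - fibre_sum p z = 2 * int p * e"
proof (cases "z = \<one>")
  case True
  then show thesis using that[of 0] fibre_sums(1) d_one by simp
next
  case False
  have zc: "z \<in> carrier G" using z by (auto simp: powers_def)
  have "fibre_sum p z = int p \<or> fibre_sum p z = - int p" using fibre_sums(2)[OF z False] by linarith
  moreover have "d z = 1 \<or> d z = -1" using d_vals zc False by blast
  ultimately show thesis using that[of 0] that[of 1] that[of "-1"] by auto
qed

text \<open>
  Let \<open>f i\<close> be the normalised defect at \<open>l ^ (p i)\<close>. The equation \<open>\<alpha> - \<beta> = \<plusminus> p ^ n\<close> makes twice the sum
  of \<open>f\<close> over \<open>i < M = p ^ (n - 1)\<close> equal to \<open>(p - 1) M (\<plusminus>1 - d l)\<close>, that is \<open>0\<close> or \<open>\<plusminus>2 (p - 1) M\<close>. The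
  second is too large for a sum of \<open>M\<close> terms of absolute value at most \<open>1\<close>, so the sum is \<open>0\<close> and
  \<open>zero_if_sum_zero\<close> applies.
\<close>

lemma fibre_sum_basis:
  assumes bas: "basis p n n w l" and s: "s < n - 1"
  shows "fibre_sum p (l [^] (p * p ^ s)) = int p * d (l [^] (p * p ^ s))"
proof -
  have wl: "w \<in> carrier G" "l \<in> carrier G" using basis_carrier[OF bas] by auto
  have pw: "l [^] (p * i) \<in> powers p" for i :: nat
    unfolding powers_def using wl by (intro image_eqI[of _ _ "l [^] i"]) (auto simp: nat_pow_pow mult.commute)
  \<comment> \<open>The choice depends on \<open>i\<close> only through the values of \<open>d\<close> and of the fibre sum at \<open>l ^ (p i)\<close>, so
    \<open>f\<close> inherits their invariance under multipliers.\<close>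
  define f where "f i = (SOME e. \<bar>e\<bar> \<le> 1 \<and> int p * d (l [^] (p * i)) - fibre_sum p (l [^] (p * i)) = 2 * int p * e)"
    for i :: nat
  have f: "\<bar>f i\<bar> \<le> 1 \<and> int p * d (l [^] (p * i)) - fibre_sum p (l [^] (p * i)) = 2 * int p * f i" for i
    unfolding f_def by (rule someI_ex) (use fibre_sum_defect[OF pw[of i]] in blast)
  define M where "M = p ^ (n - 1)"
  have pn: "p ^ n = p * M" using power_split_last[OF n, of p] by (simp add: M_def)
  define \<alpha> \<beta> where "\<alpha> = coset_sum (cyc l) \<one>" and "\<beta> = coset_sum (cyc l) (socle_gen p n w)"
  have "(\<alpha> - \<beta>)\<^sup>2 = (int p * int M)\<^sup>2"
    using rational_discriminant(1)[OF p bas n rat] bas pn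
    by (simp add: \<alpha>_def \<beta>_def basis_def power_add power2_eq_square)
  then have "\<alpha> - \<beta> = 1 * (int p * int M) \<or> \<alpha> - \<beta> = (-1) * (int p * int M)"
    by (simp add: power2_eq_iff)
  then obtain c where c: "\<alpha> - \<beta> = c * (int p * int M)" "c = 1 \<or> c = -1" by blast
  have "\<alpha> = (\<Sum>i<p * M. d (l [^] i))" using sum_fibre_sums_cyclic(1)[OF bas] by (simp add: \<alpha>_def pn)
  also have "\<dots> = (int p - 1) * int M * d l + (\<Sum>i<M. d (l [^] (p * i)))"
    using d_power wl prime_gt_0_nat[OF p] by (intro sum_split_multiples) auto
  finally have \<alpha>: "\<alpha> = (int p - 1) * int M * d l + (\<Sum>i<M. d (l [^] (p * i)))" .
  have F: "(\<Sum>i<M. fibre_sum p (l [^] (p * i))) = \<alpha> + (int p - 1) * \<beta>"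
    using sum_fibre_sums_cyclic(2)[OF bas] by (simp add: \<alpha>_def \<beta>_def M_def)
  have "2 * int p * (\<Sum>i<M. f i) = (\<Sum>i<M. int p * d (l [^] (p * i)) - fibre_sum p (l [^] (p * i)))"
    unfolding sum_distrib_left using f by (intro sum.cong) auto
  also have "\<dots> = int p * (\<Sum>i<M. d (l [^] (p * i))) - (\<alpha> + (int p - 1) * \<beta>)"
    by (simp add: sum_subtractf sum_distrib_left F)
  also have "\<dots> = (int p - 1) * (\<alpha> - \<beta>) - int p * (int p - 1) * int M * d l"
  proof -
    have "(\<Sum>i<M. d (l [^] (p * i))) = \<alpha> - (int p - 1) * int M * d l" using \<alpha> by simp
    then show ?thesis by (simp only:) (simp add: algebra_simps)
  qed
  also have "\<dots> = int p * ((int p - 1) * int M * (c - d l))"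
    unfolding c(1) by (simp add: algebra_simps)
  finally have "int p * (2 * (\<Sum>i<M. f i)) = int p * ((int p - 1) * int M * (c - d l))" by (simp only: mult_ac)
  then have two: "2 * (\<Sum>i<M. f i) = (int p - 1) * int M * (c - d l)" using prime_gt_0_nat[OF p] by simp
  have le: "\<bar>\<Sum>i<M. f i\<bar> \<le> int M"
  proof -
    have "\<bar>\<Sum>i<M. f i\<bar> \<le> (\<Sum>i<M. \<bar>f i\<bar>)" by (rule sum_abs)
    also have "\<dots> \<le> (\<Sum>i<M. 1)" by (rule sum_mono) (use f in blast)
    finally show ?thesis by simp
  qed
  have Mpos: "int M > 0" using prime_gt_0_nat[OF p] by (simp add: M_def)
  have l1: "l \<noteq> \<one>"
  proof
    assume "l = \<one>"
    then have "p ^ n = 1" using basis_ords(2)[OF p bas] by simp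
    moreover have "1 < p ^ n" using one_less_power[OF prime_gt_1_nat[OF p]] n by simp
    ultimately show False by linarith
  qed
  have dl: "d l = 1 \<or> d l = -1" using d_vals[OF wl(2) l1] .
  have "c - d l = 0"
  proof (rule ccontr)
    assume "c - d l \<noteq> 0"
    then have "\<bar>c - d l\<bar> = 2" using c(2) dl by auto
    then have "\<bar>(int p - 1) * int M * (c - d l)\<bar> = (int p - 1) * int M * 2"
      using p_ge_3 by (simp add: abs_mult)
    then have "(int p - 1) * int M \<le> int M" using two le by linarith
    moreover have "2 * int M \<le> (int p - 1) * int M" using p_ge_3 by (intro mult_right_mono) auto
    ultimately show False using Mpos by linarith
  qed
  then have sum0: "(\<Sum>i<p ^ (n - 1). f i) = 0" using two by (simp add: M_def)
  have "f (p ^ s) = 0"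
  proof (rule zero_if_sum_zero[OF p_ge_3 _ _ sum0 s])
    show "\<bar>f i\<bar> \<le> 1" for i using f by blast
    fix r u assume u: "\<not> p dvd u"
    have eq: "l [^] (p * (p ^ r * u)) = (l [^] (p * p ^ r)) [^] u"
      using wl by (simp add: nat_pow_pow mult.assoc)
    show "f (p ^ r * u) = f (p ^ r)"
      unfolding f_def eq using d_power[OF u, of "l [^] (p * p ^ r)"] fibre_sum_power[OF u pw] wl by simp
  qed
  then show ?thesis using f[of "p ^ s"] by simp
qed

text \<open>
  Every \<open>p\<close>-th power other than the identity is \<open>l ^ (p ^ (s + 1))\<close> for a basis element \<open>l\<close>, so
  \<open>fibre_sum_basis\<close> covers it; at the identity both sides are \<open>0\<close>.
\<close>

theorem fibre_sum_eq_d: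
  assumes z: "z \<in> powers p"
  shows "fibre_sum p z = int p * d z"
proof (cases "z = \<one>")
  case True
  then show ?thesis using fibre_sums(1) d_one by simp
next
  case False
  obtain u where u: "u \<in> carrier G" "z = u [^] p" using z by (auto simp: powers_def)
  then have "u \<noteq> \<one>" using False by auto
  then obtain w l s where l: "basis p n n w l" "u = l [^] (p ^ s)" using primitive_vector[OF p n gh] u(1) by blast
  have lc: "l \<in> carrier G" using basis_carrier[OF l(1)] by simp
  have zl: "z = l [^] (p * p ^ s)" using u l lc by (simp add: nat_pow_pow mult.commute)
  have "s < n - 1"
  proof (rule ccontr)
    assume "\<not> s < n - 1"
    then have "p ^ n dvd p ^ Suc s" by (intro le_imp_power_dvd) simp
    then have "z = \<one>" unfolding zl using pow_eq_id[OF lc] basis_ords(2)[OF p l(1)] by simp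
    then show False using False by simp
  qed
  then show ?thesis unfolding zl by (rule fibre_sum_basis[OF l(1)])
qed

end

section \<open>Counting sons\<close>

text \<open>
  The family of cyclic subgroups that defines the graph.
\<close>

definition positive_cyclics :: "'a set set" where
  "positive_cyclics = cyc ` {x \<in> carrier G. d x = 1}"

context
  fixes p n :: nat and g h :: 'a
  assumes p: "prime p" and n: "n \<ge> 1" and gh: "basis p n n g h" and rat: rational
begin

lemma d_generator:
  assumes "x \<in> carrier G" "x' \<in> carrier G" "cyc x' = cyc x"
  shows "d x' = d x"
  using generator_power[OF p n gh assms] d_power[OF p n gh rat] assms(1) by metis

lemma cyc_in_positive_iff:
  assumes "x \<in> carrier G"
  shows "cyc x \<in> positive_cyclics \<longleftrightarrow> d x = 1"
proof
  assume "cyc x \<in> positive_cyclics"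
  then obtain z where z: "z \<in> carrier G" "d z = 1" "cyc x = cyc z" by (auto simp: positive_cyclics_def)
  then show "d x = 1" using d_generator[OF z(1) assms z(3)] by simp
qed (use assms in \<open>auto simp: positive_cyclics_def\<close>)

lemma Union_generators: "(\<Union>H\<in>positive_cyclics. generators G H) = {x \<in> carrier G. d x = 1}"
proof (intro equalityI subsetI)
  fix x assume "x \<in> (\<Union>H\<in>positive_cyclics. generators G H)"
  then obtain z where z: "z \<in> carrier G" "d z = 1" "x \<in> cyc z" "cyc x = cyc z"
    by (auto simp: positive_cyclics_def generators_def)
  then have "x \<in> carrier G" using cyc_closed by blast
  then show "x \<in> {x \<in> carrier G. d x = 1}" using d_generator[of z x] z by simp
next
  fix x assume "x \<in> {x \<in> carrier G. d x = 1}"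
  then show "x \<in> (\<Union>H\<in>positive_cyclics. generators G H)"
    using in_cyc_self[of x] by (auto simp: positive_cyclics_def generators_def)
qed

text \<open>
  A son of \<open>\<langle>y\<rangle>\<close> is generated by a \<open>p\<close>-th root of \<open>y\<close>: a generator whose \<open>p\<close>-th power is another
  generator of \<open>\<langle>y\<rangle>\<close> can be replaced by a suitable power of itself.
\<close>

lemma sons_eq:
  assumes y: "y \<in> carrier G"
  shows "sons G p (cyc y) \<inter> positive_cyclics = cyc ` {x \<in> fibre p y. d x = 1}"
proof (intro equalityI subsetI)
  fix F assume "F \<in> sons G p (cyc y) \<inter> positive_cyclics"
  then obtain z where z: "z \<in> carrier G" "d z = 1" "F = cyc z" "(\<lambda>z. z [^] p) ` cyc z = cyc y"
    by (auto simp: sons_def positive_cyclics_def)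
  then have "cyc y = cyc (z [^] p)" using p_power_image_cyc by simp
  then obtain t where t: "\<not> p dvd t" "y = (z [^] p) [^] t" using generator_power[OF p n gh, of "z [^] p" y] y z(1) by auto
  have "z [^] t \<in> fibre p y" using z(1) t(2) by (simp add: fibre_def nat_pow_pow mult.commute)
  moreover have "d (z [^] t) = 1" using d_power[OF p n gh rat t(1) z(1)] z(2) by simp
  moreover have "F = cyc (z [^] t)" using cyc_unit_power[OF p n gh t(1) z(1)] z(3) by simp
  ultimately show "F \<in> cyc ` {x \<in> fibre p y. d x = 1}" by blast
next
  fix F assume "F \<in> cyc ` {x \<in> fibre p y. d x = 1}"
  then obtain x where x: "x \<in> carrier G" "x [^] p = y" "d x = 1" "F = cyc x" by (auto simp: fibre_def)
  then have "x \<noteq> \<one>" using d_one by auto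
  then have "F \<noteq> {\<one>}" using in_cyc_self[OF x(1)] x(4) by auto
  then show "F \<in> sons G p (cyc y) \<inter> positive_cyclics"
    using x p_power_image_cyc[OF x(1)] by (auto simp: sons_def positive_cyclics_def cyclic_subgroups_def)
qed

text \<open>
  The fibre sum is \<open>p d(y)\<close> and the fibre has \<open>p\<^sup>2\<close> elements, all with \<open>d = \<plusminus>1\<close> except the identity,
  which belongs to the fibre only over itself.
\<close>

lemma card_positive_fibre:
  assumes y: "y \<in> powers p"
  shows "2 * int (card {x \<in> fibre p y. d x = 1})
    = int p * d y + int (p\<^sup>2) - (if y = \<one> then 1 else 0)"
proof -
  let ?X = "{x \<in> fibre p y. d x = 1}"
  have cF: "card (fibre p y) = p\<^sup>2" using y card_fibre card_socle[OF p n gh] by (auto simp: powers_def)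
  have dx: "d x = 2 * (if x \<in> ?X then 1 else 0) - 1 + (if x = \<one> then 1 else 0)" if "x \<in> fibre p y" for x
    using that d_vals[of x] d_one by (auto simp: fibre_def)
  have "int p * d y = (\<Sum>x\<in>fibre p y. d x)"
    using fibre_sum_eq_d[OF p n gh rat y] by (simp add: fibre_sum_def)
  also have "\<dots> = (\<Sum>x\<in>fibre p y. 2 * (if x \<in> ?X then 1 else 0) - 1 + (if x = \<one> then 1 else 0))"
    using dx by (rule sum.cong[OF refl])
  also have "\<dots> = 2 * (\<Sum>x\<in>fibre p y. if x \<in> ?X then 1 else 0) - int (card (fibre p y))
      + (\<Sum>x\<in>fibre p y. if x = \<one> then 1 else 0)"
    by (simp only: sum.distrib sum_subtractf sum_distrib_left[symmetric] sum_constant)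
  also have "(\<Sum>x\<in>fibre p y. if x \<in> ?X then 1 else (0::int)) = int (card ?X)"
    by (simp add: sum.If_cases Int_def conj_commute)
  also have "(\<Sum>x\<in>fibre p y. if x = \<one> then 1 else (0::int)) = (if \<one> \<in> fibre p y then 1 else 0)"
    by simp
  also have "\<one> \<in> fibre p y \<longleftrightarrow> y = \<one>" by (auto simp: fibre_def)
  finally show ?thesis using cF by simp
qed

text \<open>
  Each son of \<open>\<langle>y\<rangle>\<close> contains \<open>p\<close> roots of \<open>y\<close>, forming a coset of its subgroup of order \<open>p\<close>. For
  \<open>y \<noteq> 1\<close> all of them generate the son; for \<open>y = 1\<close> the identity does not.
\<close>

lemma card_same_cyc:
  assumes y: "y \<in> carrier G" and x: "x \<in> fibre p y" "d x = 1"
  shows "card {x' \<in> {x \<in> fibre p y. d x = 1}. cyc x' = cyc x} = (if y = \<one> then p - 1 else p)"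
proof -
  have xc: "x \<in> carrier G" "x [^] p = y" "x \<noteq> \<one>" using x d_one by (auto simp: fibre_def)
  let ?E = "{x' \<in> {x \<in> fibre p y. d x = 1}. cyc x' = cyc x}"
  have E: "?E = {x' \<in> fibre p y. cyc x' = cyc x}"
    using d_generator[OF xc(1)] x by (auto simp: fibre_def)
  show ?thesis
  proof (cases "y = \<one>")
    case True
    have gen: "{x' \<in> carrier G. cyc x' = cyc x} = cyc x - {\<one>}" "card (cyc x - {\<one>}) = p - 1"
      using cyc_prime_generators[OF p xc(1,3)] xc(2) True by auto
    have "x' [^] p = \<one>" if x': "x' \<in> cyc x" for x'
    proof -
      obtain k :: nat where "x' = x [^] k" using x' cyc_eq[OF xc(1)] by auto
      then have "x' [^] p = (x [^] p) [^] k" using xc(1) by (simp add: nat_pow_pow mult.commute)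
      then show ?thesis using xc True by simp
    qed
    then have "?E = cyc x - {\<one>}" unfolding E using gen(1) True by (auto simp: fibre_def)
    then show ?thesis using gen True by simp
  next
    case False
    obtain k where k: "ord x = p ^ k" using ord_prime_power[OF p _ xc(1)] gh by (auto simp: basis_def)
    have "k \<noteq> 0" using k xc(3) ord_eq_1[OF xc(1)] by (metis power_0)
    then obtain k' where k': "k = Suc k'" by (cases k) auto
    have "k' \<noteq> 0"
    proof
      assume "k' = 0"
      then have "x [^] p = \<one>" using pow_ord_eq_1[OF xc(1)] k k' by simp
      then show False using False xc by simp
    qed
    then have pk': "p dvd p ^ k'" by (intro dvd_power) simp
    have tors: "(x [^] j) [^] p = \<one> \<longleftrightarrow> p ^ k' dvd j" for j :: nat
    proof -
      have "(x [^] j) [^] p = \<one> \<longleftrightarrow> p ^ k' * p dvd j * p"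
        using pow_eq_id[OF xc(1), of "j * p"] xc(1) k k' by (simp add: nat_pow_pow mult.commute)
      then show ?thesis using prime_gt_0_nat[OF p] by simp
    qed
    let ?u = "x [^] (p ^ k')"
    have u: "?u \<in> carrier G" "?u [^] p = \<one>" using xc(1) tors[of "p ^ k'"] by auto
    have "?u \<noteq> \<one>"
    proof
      assume "?u = \<one>"
      then have "p ^ k dvd p ^ k'" using pow_eq_id[OF xc(1)] k by simp
      then show False using k' p prime_gt_0_nat[OF p] by (simp add: not_prime_unit)
    qed
    then have "card (cyc ?u) = p" using ord_prime[OF p u(1) _ u(2)] generate_pow_card[OF u(1)] by simp
    moreover have "?E = (\<otimes>) x ` cyc ?u"
    proof (intro equalityI subsetI)
      fix x' assume "x' \<in> ?E"
      then have x': "x' \<in> carrier G" "x' [^] p = x [^] p" "cyc x' = cyc x" using xc E by (auto simp: fibre_def)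
      have sub: "subgroup (cyc x) G" using xc(1) by (rule subgroup_cyc)
      have "inv x \<otimes> x' \<in> cyc x"
        using in_cyc_self[OF x'(1)] in_cyc_self[OF xc(1)] x'(3) sub
        by (auto intro: subgroup.m_closed subgroup.m_inv_closed)
      then obtain j :: nat where j: "inv x \<otimes> x' = x [^] j" using cyc_eq[OF xc(1)] by auto
      have "(inv x \<otimes> x') [^] p = (inv x \<otimes> x) [^] p"
        using x' xc(1) by (simp only: pow_mult_distrib[OF m_comm] inv_closed)
      then have "p ^ k' dvd j" using xc(1) tors[of j] j by simp
      then obtain r where "j = p ^ k' * r" by auto
      then have "x [^] j \<in> cyc ?u" using cyc_eq[OF u(1)] xc(1) by (auto simp: nat_pow_pow)
      moreover have "x' = x \<otimes> (inv x \<otimes> x')" using xc(1) x'(1) by (simp add: m_assoc[symmetric])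
      ultimately show "x' \<in> (\<otimes>) x ` cyc ?u" using j by (intro image_eqI[of _ _ "x [^] j"]) auto
    next
      fix x' assume "x' \<in> (\<otimes>) x ` cyc ?u"
      then obtain r :: nat where "x' = x \<otimes> ?u [^] r" using cyc_eq[OF u(1)] by auto
      then have x': "x' = x \<otimes> x [^] (p ^ k' * r)" using xc(1) by (simp add: nat_pow_pow)
      then have x'': "x' = x [^] (1 + p ^ k' * r)" using xc(1) by (simp add: nat_pow_mult[symmetric] m_comm)
      have "x' [^] p = x [^] p \<otimes> (x [^] (p ^ k' * r)) [^] p"
        unfolding x' using xc(1) by (simp add: pow_mult_distrib[OF m_comm])
      also have "\<dots> = y" using tors[of "p ^ k' * r"] xc y by simp
      finally have "x' [^] p = y" .
      moreover have "\<not> p dvd 1 + p ^ k' * r"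
        using pk' p by (metis dvd_add_left_iff dvd_mult2 not_prime_unit)
      then have "cyc x' = cyc x" unfolding x'' using xc(1) by (rule cyc_unit_power[OF p n gh])
      ultimately show "x' \<in> ?E" unfolding E using x' xc(1) by (simp add: fibre_def)
    qed
    moreover have "inj_on ((\<otimes>) x) (cyc ?u)"
      using cyc_closed[OF u(1)] xc(1) by (auto simp: inj_on_def subset_iff)
    ultimately show ?thesis using False by (simp add: card_image)
  qed
qed

text \<open>
  Divide the count of roots in \<open>card_positive_fibre\<close> by the multiplicity in \<open>card_same_cyc\<close>.
\<close>

theorem card_positive_sons:
  assumes y: "y \<in> powers p"
  shows "2 * int (card (sons G p (cyc y) \<inter> positive_cyclics)) = (if y = \<one> then int p + 1 else int p + d y)"
proof -
  have yc: "y \<in> carrier G" using y by (auto simp: powers_def)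
  let ?X = "{x \<in> fibre p y. d x = 1}" and ?m = "if y = \<one> then p - 1 else p"
  have "card ?X = ?m * card (cyc ` ?X)"
    by (rule card_eq_mult_card_image) (use card_same_cyc[OF yc] in auto)
  then have c: "card ?X = ?m * card (sons G p (cyc y) \<inter> positive_cyclics)" by (simp add: sons_eq[OF yc])
  have p1: "int (p - 1) = int p - 1" "int p > 1" using prime_gt_1_nat[OF p] by auto
  show ?thesis
  proof (cases "y = \<one>")
    case True
    then have "(int p - 1) * (2 * int (card (sons G p (cyc y) \<inter> positive_cyclics))) = (int p - 1) * (int p + 1)"
      using card_positive_fibre[OF y] c p1 d_one by (simp add: power2_eq_square algebra_simps)
    then show ?thesis using True p1 by simp
  next
    case False
    then have "int p * (2 * int (card (sons G p (cyc y) \<inter> positive_cyclics))) = int p * (int p + d y)"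
      using card_positive_fibre[OF y] c by (simp add: power2_eq_square algebra_simps)
    then show ?thesis using False p1 by simp
  qed
qed

lemma homogeneous_count:
  assumes H: "H \<in> cyclic_subgroups G" and lev: "level p H < n"
  defines "a \<equiv> (p + 1) div 2 # replicate (n - 1) ((p - 1) div 2)"
  shows "card (sons G p H \<inter> positive_cyclics)
    = (if H \<in> positive_cyclics then a ! level p H + 1 else a ! level p H)"
proof -
  obtain y where y: "y \<in> carrier G" "H = cyc y" using H by (auto simp: cyclic_subgroups_def)
  have yp: "y \<in> powers p" using powers_if_level_less[OF p n gh] y lev by simp
  let ?c = "card (sons G p H \<inter> positive_cyclics)"
  have c: "2 * int ?c = (if y = \<one> then int p + 1 else int p + d y)"
    using card_positive_sons[OF yp] y by simp
  have odd: "odd p" using p_dvd_order[OF p n gh] odd_order dvd_trans by blast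
  obtain i where i: "ord y = p ^ i" using ord_prime_power[OF p _ y(1)] gh by (auto simp: basis_def)
  have lev': "level p H = i" using level_cyc[OF p y(1) i] y(2) by simp
  have i0: "i = 0 \<longleftrightarrow> y = \<one>" using i ord_eq_1[OF y(1)] prime_gt_1_nat[OF p]
    by (metis power_0 power_inject_exp)
  have Hpos: "H \<in> positive_cyclics \<longleftrightarrow> d y = 1" using cyc_in_positive_iff[OF y(1)] y(2) by simp
  show ?thesis
  proof (cases "y = \<one>")
    case True
    then have "?c = (p + 1) div 2" using c by simp
    then show ?thesis using True i0 Hpos lev' d_one by (simp add: a_def)
  next
    case False
    then have ai: "a ! level p H = (p - 1) div 2" using i0 lev lev' by (simp add: a_def nth_Cons')
    show ?thesis unfolding ai Hpos using c False odd d_vals[OF y(1) False] by auto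
  qed
qed

end

end

section \<open>Paley graphs\<close>

definition paley_sign :: "('a, 'b) monoid_scheme \<Rightarrow> 'a set \<Rightarrow> 'a \<Rightarrow> int" where
  "paley_sign A T x = (if x = \<one>\<^bsub>A\<^esub> then 0 else if x \<in> T then 1 else -1)"

text \<open>
  With \<open>T\<close> also denoting the sum of its elements, \<open>d = 2 T + e - \<Sigma>\<close>, and strong regularity says that
  \<open>T * T\<close> takes the value \<open>k\<close> at the identity, \<open>l\<close> on \<open>T\<close> and \<open>m\<close> elsewhere, because \<open>T\<close> is symmetric
  and the coefficient of \<open>T * T\<close> at \<open>z\<close> counts the common neighbours of \<open>1\<close> and \<open>z\<close>. The Paley
  parameters are those for which \<open>d * d\<close> becomes \<open>\<nu> e - \<Sigma>\<close>.
\<close>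

theorem paley_if_strongly_regular:
  fixes A :: "('a, 'b) monoid_scheme"
  assumes "comm_group A" "finite (carrier A)" and T: "connection_set A T"
    and srg: "strongly_regular (cayley_graph A T) \<nu> k l m"
    and nu: "\<nu> = order A"
    and k: "real k = (real \<nu> - 1) / 2"
    and l: "real l = (real \<nu> - 5) / 4"
    and m: "real m = (real \<nu> - 1) / 4"
  shows "paley A (paley_sign A T)"
proof -
  interpret comm_group A by (rule assms(1))
  interpret finite_abelian A by unfold_locales (rule assms(2))
  have TA: "T \<subseteq> carrier A" "\<one>\<^bsub>A\<^esub> \<notin> T" and Tinv: "\<And>x. x \<in> T \<Longrightarrow> inv\<^bsub>A\<^esub> x \<in> T"
    using T by (auto simp: connection_set_def)
  have Tinv_iff: "inv\<^bsub>A\<^esub> x \<in> T \<longleftrightarrow> x \<in> T" if "x \<in> carrier A" for x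
    using Tinv[of x] Tinv[of "inv\<^bsub>A\<^esub> x"] that by auto
  have fT: "finite T" using TA assms(2) finite_subset by blast
  let ?\<Gamma> = "cayley_graph A T"
  have verts: "pverts ?\<Gamma> = carrier A" by (simp add: cayley_graph_def)
  have arc: "(x, y) \<in> parcs ?\<Gamma> \<longleftrightarrow> y \<otimes>\<^bsub>A\<^esub> inv\<^bsub>A\<^esub> x \<in> T" if "x \<in> carrier A" "y \<in> carrier A" for x y
  proof
    assume "(x, y) \<in> parcs ?\<Gamma>"
    then obtain t where "t \<in> T" "y = t \<otimes>\<^bsub>A\<^esub> x" by (auto simp: cayley_graph_def)
    then show "y \<otimes>\<^bsub>A\<^esub> inv\<^bsub>A\<^esub> x \<in> T" using TA that by (auto simp: m_assoc subset_iff)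
  next
    assume "y \<otimes>\<^bsub>A\<^esub> inv\<^bsub>A\<^esub> x \<in> T"
    moreover have "y = (y \<otimes>\<^bsub>A\<^esub> inv\<^bsub>A\<^esub> x) \<otimes>\<^bsub>A\<^esub> x" using that by (simp add: m_assoc)
    ultimately show "(x, y) \<in> parcs ?\<Gamma>" using that unfolding cayley_graph_def by auto
  qed
  have nb: "neighbours ?\<Gamma> x = {y \<in> carrier A. y \<otimes>\<^bsub>A\<^esub> inv\<^bsub>A\<^esub> x \<in> T}" if "x \<in> carrier A" for x
  proof -
    have "y \<in> carrier A" if "(x, y) \<in> parcs ?\<Gamma>" for y
      using that TA \<open>x \<in> carrier A\<close> by (auto simp: cayley_graph_def)
    then show ?thesis using arc[OF that] unfolding neighbours_def by blast
  qed
  have nb1: "neighbours ?\<Gamma> \<one>\<^bsub>A\<^esub> = T" using nb[of "\<one>\<^bsub>A\<^esub>"] TA by auto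
  have cT: "card T = k" using srg nb1 verts unfolding strongly_regular_def by (metis one_closed)
  let ?ind = "\<lambda>X x. if x \<in> X then 1 else (0::int)"
  have common: "(\<Sum>x\<in>carrier A. ?ind T x * ?ind T (inv\<^bsub>A\<^esub> x \<otimes>\<^bsub>A\<^esub> z))
      = (if z = \<one>\<^bsub>A\<^esub> then int k else if z \<in> T then int l else int m)" if z: "z \<in> carrier A" for z
  proof -
    have "(\<Sum>x\<in>carrier A. ?ind T x * ?ind T (inv\<^bsub>A\<^esub> x \<otimes>\<^bsub>A\<^esub> z))
        = (\<Sum>x\<in>carrier A. ?ind {x \<in> T. inv\<^bsub>A\<^esub> x \<otimes>\<^bsub>A\<^esub> z \<in> T} x)" by (rule sum.cong) auto
    also have "\<dots> = int (card {x \<in> T. inv\<^bsub>A\<^esub> x \<otimes>\<^bsub>A\<^esub> z \<in> T})"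
      using assms(2) TA by (simp add: sum.If_cases Int_def) (rule arg_cong[of _ _ card], auto)
    also have "{x \<in> T. inv\<^bsub>A\<^esub> x \<otimes>\<^bsub>A\<^esub> z \<in> T} = neighbours ?\<Gamma> \<one>\<^bsub>A\<^esub> \<inter> neighbours ?\<Gamma> z"
    proof -
      have "inv\<^bsub>A\<^esub> x \<otimes>\<^bsub>A\<^esub> z \<in> T \<longleftrightarrow> x \<otimes>\<^bsub>A\<^esub> inv\<^bsub>A\<^esub> z \<in> T" if "x \<in> carrier A" for x
      proof -
        have "inv\<^bsub>A\<^esub> (x \<otimes>\<^bsub>A\<^esub> inv\<^bsub>A\<^esub> z) = inv\<^bsub>A\<^esub> x \<otimes>\<^bsub>A\<^esub> z" using that z by (simp add: inv_mult)
        then show ?thesis using Tinv_iff[of "x \<otimes>\<^bsub>A\<^esub> inv\<^bsub>A\<^esub> z"] that z by simp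
      qed
      then show ?thesis unfolding nb1 nb[OF z] using TA by auto
    qed
    also have "int (card (neighbours ?\<Gamma> \<one>\<^bsub>A\<^esub> \<inter> neighbours ?\<Gamma> z))
        = (if z = \<one>\<^bsub>A\<^esub> then int k else if z \<in> T then int l else int m)"
    proof (cases "z = \<one>\<^bsub>A\<^esub>")
      case True
      then show ?thesis using nb1 cT by simp
    next
      case False
      have "(\<one>\<^bsub>A\<^esub>, z) \<in> parcs ?\<Gamma> \<longleftrightarrow> z \<in> T" using arc[of "\<one>\<^bsub>A\<^esub>" z] z by simp
      then show ?thesis using srg False z verts unfolding strongly_regular_def
        by (metis one_closed)
    qed
    finally show ?thesis .
  qed
  let ?d = "paley_sign A T"
  have d_eq: "?d x = 2 * ?ind T x + (if x = \<one>\<^bsub>A\<^esub> then 1 else 0) - 1" for x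
    using TA by (simp add: paley_sign_def)
  have "real_of_int (2 * int k) = real_of_int (int \<nu> - 1)"
    "real_of_int (4 * int l) = real_of_int (int \<nu> - 5)"
    "real_of_int (4 * int m) = real_of_int (int \<nu> - 1)"
    using k l m by simp_all
  then have nui: "2 * int k = int \<nu> - 1" "4 * int l = int \<nu> - 5" "4 * int m = int \<nu> - 1"
    by (simp_all only: of_int_eq_iff)
  have sT: "(\<Sum>x\<in>carrier A. ?ind T x) = int k"
    using assms(2) TA cT by (simp add: sum.If_cases Int_absorb1)
  have sT': "(\<Sum>x\<in>carrier A. ?ind T (inv\<^bsub>A\<^esub> x \<otimes>\<^bsub>A\<^esub> z)) = int k" if z: "z \<in> carrier A" for z
  proof -
    have "(\<Sum>x\<in>carrier A. ?ind T (inv\<^bsub>A\<^esub> x \<otimes>\<^bsub>A\<^esub> z)) = (\<Sum>x\<in>carrier A. ?ind T (x \<otimes>\<^bsub>A\<^esub> z))"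
      by (rule sum_invert[of "\<lambda>x. ?ind T (x \<otimes>\<^bsub>A\<^esub> z)"])
    also have "\<dots> = (\<Sum>x\<in>carrier A. ?ind T (z \<otimes>\<^bsub>A\<^esub> x))" using z by (intro sum.cong) (auto simp: m_comm)
    finally show ?thesis using sum_translate[OF z, of "?ind T"] sT by simp
  qed
  show ?thesis
  proof unfold_locales
    show "odd (order A)" using nui(1) nu by presburger
    show "?d \<one>\<^bsub>A\<^esub> = 0" by (simp add: paley_sign_def)
    show "?d x = 1 \<or> ?d x = -1" if "x \<in> carrier A" "x \<noteq> \<one>\<^bsub>A\<^esub>" for x using that by (simp add: paley_sign_def)
    show "?d (inv\<^bsub>A\<^esub> x) = ?d x" if "x \<in> carrier A" for x
      using that Tinv_iff[OF that] by (simp add: paley_sign_def inv_eq_one_eq)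
    fix z assume z: "z \<in> carrier A"
    let ?e = "\<lambda>x. if x = \<one>\<^bsub>A\<^esub> then 1 else (0::int)"
    let ?i = "\<lambda>x. inv\<^bsub>A\<^esub> x \<otimes>\<^bsub>A\<^esub> z"
    have "?d x * ?d (?i x) = 4 * (?ind T x * ?ind T (?i x)) + 2 * ((if x = z then 1 else 0) * ?ind T x)
        + 2 * (?e x * ?ind T (?i x)) + ?e x * (if x = z then 1 else 0)
        - 2 * ?ind T x - 2 * ?ind T (?i x) - ?e x - (if x = z then 1 else 0) * 1 + 1"
      if "x \<in> carrier A" for x
    proof -
      have "?i x = \<one>\<^bsub>A\<^esub> \<longleftrightarrow> x = z" using that z by (metis inv_closed inv_equality inv_inv l_inv)
      then show ?thesis unfolding d_eq by (simp add: algebra_simps)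
    qed
    then have "(\<Sum>x\<in>carrier A. ?d x * ?d (?i x)) = (\<Sum>x\<in>carrier A. 4 * (?ind T x * ?ind T (?i x)) + 2 * ((if x = z then 1 else 0) * ?ind T x)
        + 2 * (?e x * ?ind T (?i x)) + ?e x * (if x = z then 1 else 0)
        - 2 * ?ind T x - 2 * ?ind T (?i x) - ?e x - (if x = z then 1 else 0) * 1 + 1)"
      by (rule sum.cong[OF refl])
    also have "\<dots> = 4 * (\<Sum>x\<in>carrier A. ?ind T x * ?ind T (?i x)) + 2 * (\<Sum>x\<in>carrier A. (if x = z then 1 else 0) * ?ind T x)
        + 2 * (\<Sum>x\<in>carrier A. ?e x * ?ind T (?i x)) + (\<Sum>x\<in>carrier A. ?e x * (if x = z then 1 else 0))
        - 2 * (\<Sum>x\<in>carrier A. ?ind T x) - 2 * (\<Sum>x\<in>carrier A. ?ind T (?i x)) - (\<Sum>x\<in>carrier A. ?e x)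
        - (\<Sum>x\<in>carrier A. (if x = z then 1 else 0) * 1) + int (order A)"
      by (simp only: sum.distrib sum_subtractf sum_distrib_left[symmetric] sum_constant order_def mult_1_right of_nat_id)
    also have "\<dots> = 4 * (if z = \<one>\<^bsub>A\<^esub> then int k else if z \<in> T then int l else int m) + 2 * ?ind T z
        + 2 * ?ind T z + ?e z - 2 * int k - 2 * int k - 1 - 1 + int (order A)"
      unfolding common[OF z] sT sT'[OF z] sum_eq_one_indicator[OF assms(2) z]
        sum_eq_one_indicator[OF assms(2) one_closed]
      using z assms(2) by (simp add: eq_commute)
    also have "\<dots> = (if z = \<one>\<^bsub>A\<^esub> then int (order A) else 0) - 1"
      using nui nu TA(2) by auto
    finally show "(\<Sum>x\<in>carrier A. ?d x * ?d (inv\<^bsub>A\<^esub> x \<otimes>\<^bsub>A\<^esub> z)) = (if z = \<one>\<^bsub>A\<^esub> then int (order A) else 0) - 1" .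
  qed
qed

lemma paley_transport:
  assumes "paley A d" and iso: "\<phi> \<in> iso A B" and "group B"
    and d': "\<And>x. x \<in> carrier A \<Longrightarrow> d' (\<phi> x) = d x"
  shows "paley B d'"
proof -
  interpret A: paley A d by (rule assms(1))
  interpret B: group B by (rule assms(3))
  have hom: "\<phi> \<in> hom A B" and bij: "bij_betw \<phi> (carrier A) (carrier B)" using iso by (auto simp: iso_def)
  interpret \<phi>: group_hom A B \<phi> by unfold_locales (rule hom)
  have "A \<cong> B" using iso by (auto simp: is_iso_def)
  then interpret B: comm_group B using A.iso_imp_comm_group B.is_monoid by blast
  have finB: "finite (carrier B)" using bij A.fin bij_betw_finite by blast
  have ord: "order B = order A" using bij by (simp add: order_def bij_betw_same_card)
  have surj: "\<exists>x\<in>carrier A. y = \<phi> x" if "y \<in> carrier B" for y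
    using that bij by (auto simp: bij_betw_def)
  have one_iff: "\<phi> x = \<one>\<^bsub>B\<^esub> \<longleftrightarrow> x = \<one>\<^bsub>A\<^esub>" if "x \<in> carrier A" for x
    using bij that \<phi>.hom_one A.one_closed by (metis bij_betw_inv_into_left)
  show ?thesis
  proof unfold_locales
    show "finite (carrier B)" by (rule finB)
    show "odd (order B)" using ord A.odd_order by simp
    show "d' \<one>\<^bsub>B\<^esub> = 0" using d'[of "\<one>\<^bsub>A\<^esub>"] A.d_one by simp
    show "d' y = 1 \<or> d' y = -1" if y: "y \<in> carrier B" "y \<noteq> \<one>\<^bsub>B\<^esub>" for y
    proof -
      obtain x where x: "x \<in> carrier A" "y = \<phi> x" using surj[OF y(1)] by auto
      then show ?thesis using y(2) one_iff d' A.d_vals by simp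
    qed
    show "d' (inv\<^bsub>B\<^esub> y) = d' y" if y: "y \<in> carrier B" for y
    proof -
      obtain x where x: "x \<in> carrier A" "y = \<phi> x" using surj[OF y] by auto
      then show ?thesis using d' A.d_inv by (simp flip: \<phi>.hom_inv)
    qed
    fix z assume "z \<in> carrier B"
    then obtain u where u: "u \<in> carrier A" "z = \<phi> u" using surj by auto
    have "(\<Sum>y\<in>carrier B. d' y * d' (inv\<^bsub>B\<^esub> y \<otimes>\<^bsub>B\<^esub> z)) = (\<Sum>x\<in>carrier A. d' (\<phi> x) * d' (inv\<^bsub>B\<^esub> \<phi> x \<otimes>\<^bsub>B\<^esub> z))"
      by (rule sum.reindex_bij_betw[OF bij, symmetric])
    also have "\<dots> = (\<Sum>x\<in>carrier A. d x * d (inv\<^bsub>A\<^esub> x \<otimes>\<^bsub>A\<^esub> u))"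
    proof (rule sum.cong[OF refl])
      fix x assume x: "x \<in> carrier A"
      have eq: "inv\<^bsub>B\<^esub> \<phi> x \<otimes>\<^bsub>B\<^esub> z = \<phi> (inv\<^bsub>A\<^esub> x \<otimes>\<^bsub>A\<^esub> u)" using x u by simp
      show "d' (\<phi> x) * d' (inv\<^bsub>B\<^esub> \<phi> x \<otimes>\<^bsub>B\<^esub> z) = d x * d (inv\<^bsub>A\<^esub> x \<otimes>\<^bsub>A\<^esub> u)"
        using d'[OF x] d'[of "inv\<^bsub>A\<^esub> x \<otimes>\<^bsub>A\<^esub> u"] x u(1) unfolding eq by (simp only: A.m_closed A.inv_closed)
    qed
    also have "\<dots> = (if z = \<one>\<^bsub>B\<^esub> then int (order B) else 0) - 1"
      using A.conv[OF u(1)] one_iff[OF u(1)] u(2) ord by simp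
    finally show "(\<Sum>y\<in>carrier B. d' y * d' (inv\<^bsub>B\<^esub> y \<otimes>\<^bsub>B\<^esub> z)) = (if z = \<one>\<^bsub>B\<^esub> then int (order B) else 0) - 1" .
  qed
qed

lemma graph_image_cayley:
  assumes "\<phi> \<in> iso A B" "T \<subseteq> carrier A"
  shows "graph_image \<phi> (cayley_graph A T) = cayley_graph B (\<phi> ` T)"
proof -
  have im: "\<phi> ` carrier A = carrier B" using assms(1) by (simp add: iso_def bij_betw_def)
  have hom: "\<phi> (t \<otimes>\<^bsub>A\<^esub> x) = \<phi> t \<otimes>\<^bsub>B\<^esub> \<phi> x" if "t \<in> T" "x \<in> carrier A" for t x
    using assms that by (auto simp: iso_def hom_def)
  have "map_prod \<phi> \<phi> ` {(x, t \<otimes>\<^bsub>A\<^esub> x) |x t. x \<in> carrier A \<and> t \<in> T}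
      = {(x, t \<otimes>\<^bsub>B\<^esub> x) |x t. x \<in> \<phi> ` carrier A \<and> t \<in> \<phi> ` T}"
  proof (intro equalityI subsetI)
    fix e assume "e \<in> map_prod \<phi> \<phi> ` {(x, t \<otimes>\<^bsub>A\<^esub> x) |x t. x \<in> carrier A \<and> t \<in> T}"
    then obtain x t where "x \<in> carrier A" "t \<in> T" "e = (\<phi> x, \<phi> (t \<otimes>\<^bsub>A\<^esub> x))" by auto
    then show "e \<in> {(x, t \<otimes>\<^bsub>B\<^esub> x) |x t. x \<in> \<phi> ` carrier A \<and> t \<in> \<phi> ` T}" using hom by blast
  next
    fix e assume "e \<in> {(x, t \<otimes>\<^bsub>B\<^esub> x) |x t. x \<in> \<phi> ` carrier A \<and> t \<in> \<phi> ` T}"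
    then obtain x t where xt: "x \<in> carrier A" "t \<in> T" "e = (\<phi> x, \<phi> t \<otimes>\<^bsub>B\<^esub> \<phi> x)" by auto
    then have "e = map_prod \<phi> \<phi> (x, t \<otimes>\<^bsub>A\<^esub> x)" using hom by simp
    then show "e \<in> map_prod \<phi> \<phi> ` {(x, t \<otimes>\<^bsub>A\<^esub> x) |x t. x \<in> carrier A \<and> t \<in> T}" using xt by blast
  qed
  then show ?thesis unfolding graph_image_def cayley_graph_def im[symmetric] by simp
qed

theorem corollary7p3:
  fixes A :: "('a, 'b) monoid_scheme"
    and T :: "'a set"
    and \<nu> k l m :: nat
  assumes "comm_group A"
    and "finite (carrier A)"
    and "group_rank A = 2"
    and "connection_set A T"
    and "strongly_regular (cayley_graph A T) \<nu> k l m"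
    and "\<nu> = order A"
    and "real k = (real \<nu> - 1) / 2"
    and "real l = (real \<nu> - 5) / 4"
    and "real m = (real \<nu> - 1) / 4"
  shows "\<exists>p n. prime p \<and> odd p \<and> n \<ge> 1 \<and> A \<cong> Zpn2 p n \<and>
    (\<forall>\<phi>\<in>iso A (Zpn2 p n). \<exists>S.
       homogeneous p n ((p + 1) div 2 # replicate (n - 1) ((p - 1) div 2)) S \<and>
       graph_image \<phi> (cayley_graph A T) = subgroup_family_graph (Zpn2 p n) S)"
proof -
  let ?d = "paley_sign A T"
  have TA: "T \<subseteq> carrier A" "\<one>\<^bsub>A\<^esub> \<notin> T" using assms(4) by (auto simp: connection_set_def)
  interpret A: paley A ?d by (rule paley_if_strongly_regular[OF assms(1,2,4-9)])
  obtain g h where gh: "A.spans g h" "\<And>x. x \<in> carrier A \<Longrightarrow> A.cyc x \<noteq> carrier A"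
    using A.rank_two_generators[OF assms(3)] by metis
  obtain p n x y where p: "prime p" "odd p" and n: "n \<ge> 1" and bas: "A.basis p n n x y" and rat: A.rational
    using A.homocyclic_structure[OF gh] by blast
  have xy: "x \<in> carrier A" "y \<in> carrier A" using A.basis_carrier[OF bas] by auto
  have "\<exists>S. homogeneous p n ((p + 1) div 2 # replicate (n - 1) ((p - 1) div 2)) S \<and>
       graph_image \<phi> (cayley_graph A T) = subgroup_family_graph (Zpn2 p n) S"
    if \<phi>: "\<phi> \<in> iso A (Zpn2 p n)" for \<phi>
  proof -
    let ?Z = "Zpn2 p n"
    interpret Z: group ?Z by (rule group_Zpn2)
    have bij: "bij_betw \<phi> (carrier A) (carrier ?Z)" using \<phi> by (auto simp: iso_def)
    interpret \<phi>: group_hom A ?Z \<phi> by unfold_locales (use \<phi> in \<open>simp add: iso_def\<close>)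
    define d' where "d' z = ?d (inv_into (carrier A) \<phi> z)" for z
    have d': "d' (\<phi> z) = ?d z" if "z \<in> carrier A" for z
      using that bij by (simp add: d'_def bij_betw_inv_into_left)
    interpret Z: paley ?Z d' by (rule paley_transport[OF A.paley_axioms \<phi> Z.is_group d'])
    have ord: "order ?Z = order A" using bij by (simp add: order_def bij_betw_same_card)
    have basZ: "Z.basis p n n (\<phi> x) (\<phi> y)"
      unfolding Z.basis_def Z.spans_def
    proof (intro conjI ballI)
      show "\<phi> x [^]\<^bsub>?Z\<^esub> (p ^ n) = \<one>\<^bsub>?Z\<^esub>" "\<phi> y [^]\<^bsub>?Z\<^esub> (p ^ n) = \<one>\<^bsub>?Z\<^esub>"
        using bas xy by (simp_all add: A.basis_def flip: \<phi>.hom_nat_pow)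
      show "order ?Z = p ^ (n + n)" using bas ord by (simp add: A.basis_def)
      fix z assume "z \<in> carrier ?Z"
      then obtain u where u: "u \<in> carrier A" "z = \<phi> u" using bij by (auto simp: bij_betw_def)
      then obtain i j :: nat where "u = x [^]\<^bsub>A\<^esub> i \<otimes>\<^bsub>A\<^esub> y [^]\<^bsub>A\<^esub> j"
        using bas by (auto simp: A.basis_def A.spans_def)
      then have "z = \<phi> x [^]\<^bsub>?Z\<^esub> i \<otimes>\<^bsub>?Z\<^esub> \<phi> y [^]\<^bsub>?Z\<^esub> j" using u xy by (simp add: \<phi>.hom_nat_pow)
      then show "\<exists>(i::nat) (j::nat). z = \<phi> x [^]\<^bsub>?Z\<^esub> i \<otimes>\<^bsub>?Z\<^esub> \<phi> y [^]\<^bsub>?Z\<^esub> j" by blast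
    qed (use xy in auto)
    have ratZ: Z.rational
      unfolding Z.rational_def
    proof (intro allI impI)
      fix t s assume t: "coprime t (order ?Z)" "Z.multiplier t s"
      have "?d (u [^]\<^bsub>A\<^esub> t) = s * ?d u" if "u \<in> carrier A" for u
        using t(2) that d' unfolding Z.multiplier_def
        by (metis A.nat_pow_closed \<phi>.hom_closed \<phi>.hom_nat_pow)
      then have "A.multiplier t s" using t(2) by (simp add: A.multiplier_def Z.multiplier_def)
      then show "s = 1" using A.rationalD[OF rat] t(1) ord by simp
    qed
    have pos: "{z \<in> carrier ?Z. d' z = 1} = \<phi> ` T"
    proof (intro equalityI subsetI)
      fix z assume z: "z \<in> {z \<in> carrier ?Z. d' z = 1}"
      then obtain u where u: "u \<in> carrier A" "z = \<phi> u" using bij by (auto simp: bij_betw_def)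
      then have "?d u = 1" using z d' by simp
      then show "z \<in> \<phi> ` T" using u by (auto simp: paley_sign_def split: if_splits)
    next
      fix z assume "z \<in> \<phi> ` T"
      then obtain u where u: "u \<in> T" "z = \<phi> u" by auto
      then have "?d u = 1" using TA by (auto simp: paley_sign_def)
      then show "z \<in> {z \<in> carrier ?Z. d' z = 1}" using u TA d' by auto
    qed
    let ?S = Z.positive_cyclics
    have "homogeneous p n ((p + 1) div 2 # replicate (n - 1) ((p - 1) div 2)) ?S"
      unfolding homogeneous_def
    proof (intro conjI ballI impI allI)
      show "length ((p + 1) div 2 # replicate (n - 1) ((p - 1) div 2)) = n" using n by simp
      show "((p + 1) div 2 # replicate (n - 1) ((p - 1) div 2)) ! 0 \<le> p + 1" by simp
      show "((p + 1) div 2 # replicate (n - 1) ((p - 1) div 2)) ! i \<le> p - 1" if "1 \<le> i \<and> i < n" for i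
      proof -
        have "i - 1 < n - 1" using that by linarith
        then show ?thesis using that by (simp add: nth_Cons')
      qed
      show "?S \<subseteq> cyclic_subgroups ?Z"
        by (auto simp: Z.positive_cyclics_def cyclic_subgroups_def)
      show "{\<one>\<^bsub>?Z\<^esub>} \<notin> ?S"
        using Z.cyc_in_positive_iff[OF p(1) n basZ ratZ, of "\<one>\<^bsub>?Z\<^esub>"] Z.d_one Z.generate_one by simp
    qed (rule Z.homogeneous_count[OF p(1) n basZ ratZ])
    moreover have "graph_image \<phi> (cayley_graph A T) = subgroup_family_graph ?Z ?S"
      unfolding graph_image_cayley[OF \<phi> TA(1)] subgroup_family_graph_def
        Z.Union_generators[OF p(1) n basZ ratZ] pos ..
    ultimately show ?thesis by blast
  qed
  then show ?thesis using p n A.iso_Zpn2[OF p(1) bas] by blast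
qed

end
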